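(* Let $p\ge 1$, let $k$, $B_k$, $\Pi$ be as in the context, and let $\Psi:\mathcal H^{\lfloor p\rfloor}\to T^{(\Pi,1)}(B_k)$ be the algebra isomorphism $\tau_{r_1}\star\cdots\star\tau_{r_m}\mapsto \tau_{r_1}\dot\otimes\cdots\dot\otimes\tau_{r_m}$. Let $X:\triangle\to\mathcal H^{\lfloor p\rfloor}$ be a map and set $\bar X:=\Psi(X):\triangle\to T^{(\Pi,1)}(B_k)$. Then: (a) $X$ is multiplicative (i.e. $X_{s,u}\star X_{u,t}=X_{s,t}$ for all $s\le u\le t$) if and only if $\bar X$ is multiplicative (i.e. $\bar X_{s,u}\dot\otimes \bar X_{u,t}=\bar X_{s,t}$ for all $s\le u\le t$). (b) $X$ takes values in $\mathcal G^{\lfloor p\rfloor}$ if and only if $\bar X$ takes values in $G^{(\Pi,1)}(B_k)$. (c) There exists $C>0$, independent of $X$, such that if $Y:\triangle\to\mathcal H^{\lfloor p\rfloor}$ is another map and $\bar Y:=\Psi(Y)$, then $$C^{-1}\rho_{\Pi\text{-var}}(\bar X,\bar Y)\le \rho_{p\text{-var}}(X,Y)\le C\,\rho_{\Pi\text{-var}}(\bar X,\bar Y).$$ In particular, $X$ is a branched $p$-rough path if and only if $\bar X$ is a weakly geometric $\Pi$-rough path over $B_k$ (with respect to the decomposition $B_k=B^1\oplus\cdots\oplus B^k$). (d) Suppose that $X$ is a branched $p$-rough path. Let $S(X):\triangle\to\mathcal H^*$ denote the extension of $X$ and $S(\bar X):\triangle\to T((B_k))$ the extension of $\bar X$. Then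 $S(X)=\imath S(\bar X)$, where $\imath:T((B_k))\hookrightarrow P(B)$ is the natural inclusion and $P(B)$ is identified with $\mathcal H^*$ as in the context.
   Context: **Trees and the Grossman–Larson algebra.** Fix $d\ge1$. A *tree* is a (non-empty, finite) rooted tree with nodes labelled by $\{1,\dots,d\}$ (up to isomorphism); a *forest* is a finite multiset of trees, including the empty forest $\mathbf 1$; $\sigma_1\sigma_2$ denotes multiset union. $\mathcal T,\mathcal F$ are the sets of trees and forests, $|\sigma|$ is the number of nodes, $\mathcal B,\mathcal H$ are the real linear spans of $\mathcal T,\mathcal F$, and $\mathcal H^*$ is the space of formal series $\sum_{\sigma\in\mathcal F}\lambda_\sigma\sigma$; $\langle h,\sigma\rangle$ denotes the coefficient of $\sigma$ in $h$. $[\sigma_1\dots\sigma_n]_i$ is the tree obtained by attaching trees $\sigma_1,\dots,\sigma_n$ to a root labelled $i$ ($\bullet_i$ if $n=0$). The Connes–Kreimer coproduct $\Delta_{CK}:\mathcal H\to\mathcal H\otimes\mathcal H$ is the linear map multiplicative for juxtaposition of forests with $\Delta_{CK}\mathbf 1=\mathbf 1\otimes\mathbf 1$ and $\Delta_{CK}[\sigma_1\dots\sigma_n]_i=[\sigma_1\dots\sigma_n]_i\otimes\mathbf 1+(\mathrm{id}\otimes B_+^i)(\Delta_{CK}\sigma_1\cdots\Delta_{CK}\sigma_n)$, where $B^i_+(\tau_1\cdots\tau_m)=[\tau_1\dots\tau_m]_i$. The Grossman–Larson product $\star$ is dual to it: $\langle\sigma_1\star\sigma_2,\sigma\rangle$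 is the coefficient of $\sigma_1\otimes\sigma_2$ in $\Delta_{CK}\sigma$. The coproduct is $\delta(\sigma)=\sum_{(\sigma_1,\sigma_2):\sigma_1\sigma_2=\sigma}\sigma_1\otimes\sigma_2$. Both extend to formal series. $\mathcal G^*=\{g\in\mathcal H^*: \delta g=g\otimes g,\ g\ne0\}$ is the Butcher group. $\mathcal H^N$ is the quotient of $\mathcal H^*$ by the ideal of series in forests with more than $N$ nodes, $\rho^N:\mathcal H^*\to\mathcal H^N$ the projection, $\mathcal G^N=\rho^N(\mathcal G^* )$; $\mathcal H^N$ has the inner product making $\{\sigma\in\mathcal F:|\sigma|\le N\}$ orthonormal. $\pi^n$ is the projection $\sum\lambda_\sigma\sigma\mapsto\sum_{|\sigma|=n}\lambda_\sigma\sigma$. **Branched rough paths.** $\triangle=\{(s,t):0\le s\le t\le1\}$. A *control* is a continuous $\omega:\triangle\to[0,\infty)$ with $\omega(s,u)+\omega(u,t)\le\omega(s,t)$. A *branched $p$-rough path* is a continuous $X:\triangle\to\mathcal G^{\lfloor p\rfloor}$ with $X_{s,u}\star X_{u,t}=X_{s,t}$ and, for some control $\omega$, $|\pi^nX_{s,t}|\le\omega(s,t)^{n/p}$ for $n=1,\dots,\lfloor p\rfloor$. Its *extension* $S(X):\triangle\to\mathcal H^*$ is the unique map with $\rho^{\lfloor p\rfloor}S(X)=X$, $S(X)_{s,u}\star S(X)_{u,t}=S(X)_{s,t}$, and for each $n\ge1$ a control $\omega$ with $|\pi^nS(X)_{s,t}|\le\omega(s,t)^{n/p}$. **Free generators (known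 theorem of Foissy and Chapoton).** There is a subspace $B\subset\mathcal B$ such that $(\mathcal H,\star,\delta)$ is isomorphic as a Hopf algebra to the tensor Hopf algebra $T(B)$ (via the algebra morphism extending $B\subset\mathcal H$). Fix such $B$ with a basis $\tau_1,\tau_2,\dots$ of trees in $\mathcal T$ with $|\tau_i|\le|\tau_j|$ for $i<j$. Every element of $\mathcal H^*$ is then uniquely a series $\sum_{m\ge0}\sum_{r_1,\dots,r_m\ge1}\lambda_{r_1,\dots,r_m}\tau_{r_1}\star\cdots\star\tau_{r_m}$. $P(B)$ denotes the algebra of all formal series $\sum_{m\ge0}\sum_{r_1,\dots,r_m\ge1}\lambda_{r_1,\dots,r_m}\tau_{r_1}\dot\otimes\cdots\dot\otimes\tau_{r_m}$ (with $\dot\otimes$ the concatenation product); it is identified with $\mathcal H^*$ by $\tau_{r_1}\dot\otimes\cdots\dot\otimes\tau_{r_m}\leftrightarrow\tau_{r_1}\star\cdots\star\tau_{r_m}$. **$\Pi$-rough paths over $B_k$.** Let $k\ge1$ be the largest integer with $|\tau_k|\le p$, $B^j=\mathrm{span}(\tau_j)$, $B_k=B^1\oplus\cdots\oplus B^k$ (with a fixed norm), $p_j=p/|\tau_j|$, $\Pi=(p_1,\dots,p_k)$. For a multi-index $R=(r_1,\dots,r_m)\in\{1,\dots,k\}^m$, $m\ge0$, put $B_k^{\otimes R}=B^{r_1}\otimes\cdots\otimes B^{r_m}$ (projective norm), $\deg_\Pi(R)=\sum_j 1/p_{r_j}=\sum_j|\tau_{r_j}|/p$, and let $\pi_R:T((B_k))=\prod_{m\ge0}B_k^{\otimes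 m}\to B_k^{\otimes R}$ be the projection. $\mathcal A^\Pi_1$ is the (finite) set of multi-indices with $\deg_\Pi(R)\le1$, and $T^{(\Pi,1)}(B_k)$ is the quotient algebra of $(T((B_k)),\dot\otimes)$ by the ideal $\{v:\pi_R(v)=0\ \forall R\in\mathcal A^\Pi_1\}$. $G^{(\Pi,1)}(B_k)$ is the exponential of the Lie subalgebra of $T^{(\Pi,1)}(B_k)$ generated by $B_k$. A *$\Pi$-rough path* is a continuous multiplicative $\bar X:\triangle\to T^{(\Pi,1)}(B_k)$ such that for some control $\omega$, $|\pi_R(\bar X_{s,t})|\le\omega(s,t)^{\deg_\Pi(R)}$ for all non-empty $R\in\mathcal A_1^\Pi$; it is *weakly geometric* if it takes values in $G^{(\Pi,1)}(B_k)$. Its extension $S(\bar X):\triangle\to T((B_k))$ is the unique multiplicative map projecting to $\bar X$ and such that for every non-empty multi-index $R$ there is a control $\omega$ with $|\pi_RS(\bar X)_{s,t}|\le\omega(s,t)^{\deg_\Pi(R)}$. **Distances** (values in $[0,\infty]$; suprema over finite partitions $\mathcal P$ of $[0,1]$, sums over adjacent points): $$\rho_{p\text{-var}}(X,Y)=\max_{1\le n\le\lfloor p\rfloor}\sup_{\mathcal P}\Big(\sum_{[s,t]\in\mathcal P}|\pi^n(X_{s,t}-Y_{s,t})|^{p/n}\Big)^{n/p},$$ $$\rho_{\Pi\text{-var}}(\bar X,\bar Y)=\max_{\emptyset\ne R\in\mathcal A^\Pi_1}\sup_{\mathcal P}\Big(\sum_{[s,t]\in\mathcal P}|\pi_R(\bar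 X_{s,t}-\bar Y_{s,t})|^{1/\deg_\Pi(R)}\Big)^{\deg_\Pi(R)}.$$ *)

theory Defs
  imports "HOL-Analysis.Analysis" "HOL-Library.Multiset" "HOL-Library.Poly_Mapping"
begin

section \<open>Trees, forests and the Grossman--Larson algebra\<close>

text \<open>
  Non-planar rooted trees: the children form a multiset, so isomorphic trees are equal. The label
  set \<open>{1,\<dots>,d}\<close> is an arbitrary nonempty finite type \<open>'a\<close>, with \<open>d = CARD('a)\<close>.
\<close>

datatype 'a rtree = Node 'a "'a rtree multiset"

type_synonym 'a forest = "'a rtree multiset"

primrec tnodes :: "'a rtree \<Rightarrow> nat" where
  "tnodes (Node i F) = Suc (\<Sum>\<^sub># (image_mset tnodes F))"

definition fnodes :: "'a forest \<Rightarrow> nat" where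
  "fnodes \<sigma> = \<Sum>\<^sub># (image_mset tnodes \<sigma>)"

text \<open>
  \<open>\<H> \<otimes> \<H>\<close> is the space of finitely supported functions on pairs of forests. Its \<open>poly_mapping\<close>
  product is the bilinear extension of \<open>(a \<otimes> b)(a' \<otimes> b') = aa' \<otimes> bb'\<close>, where juxtaposition of
  forests is multiset union \<open>+\<close>.
\<close>

type_synonym 'a HH = "('a forest \<times> 'a forest) \<Rightarrow>\<^sub>0 real"

definition id_tensor_Bplus :: "'a \<Rightarrow> 'a HH \<Rightarrow> 'a HH" where
  "id_tensor_Bplus i h =
     (\<Sum>(a, b)\<in>Poly_Mapping.keys h.
        Poly_Mapping.single (a, {#Node i b#}) (Poly_Mapping.lookup h (a, b)))"

primrec ck_tree :: "'a rtree \<Rightarrow> 'a HH" where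
  "ck_tree (Node i F) =
     Poly_Mapping.single ({#Node i F#}, {#}) 1
     + id_tensor_Bplus i (\<Prod>\<^sub># (image_mset ck_tree F))"

definition ck :: "'a forest \<Rightarrow> 'a HH" where
  "ck \<sigma> = \<Prod>\<^sub># (image_mset ck_tree \<sigma>)"

text \<open>\<open>\<H>\<^sup>*\<close>: a formal series is its coefficient function; \<open>\<H>\<close> consists of those of finite support.\<close>

type_synonym 'a series = "'a forest \<Rightarrow> real"

definition fin_supp :: "('b \<Rightarrow> real) set" where
  "fin_supp = {h. finite {x. h x \<noteq> 0}}"

definition basis :: "'b \<Rightarrow> 'b \<Rightarrow> real" where
  "basis x = (\<lambda>y. if y = x then 1 else 0)"

definition star :: "'a series \<Rightarrow> 'a series \<Rightarrow> 'a series" where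
  "star g h = (\<lambda>\<sigma>. \<Sum>(a, b)\<in>Poly_Mapping.keys (ck \<sigma>).
                   g a * h b * Poly_Mapping.lookup (ck \<sigma>) (a, b))"

definition delta_forest :: "'a forest \<Rightarrow> 'a forest \<times> 'a forest \<Rightarrow> real" where
  "delta_forest \<sigma> = (\<lambda>(a, b). if a + b = \<sigma> then 1 else 0)"

definition delta :: "'a series \<Rightarrow> 'a forest \<times> 'a forest \<Rightarrow> real" where
  "delta g = (\<lambda>ab. Sum_any (\<lambda>\<sigma>. g \<sigma> * delta_forest \<sigma> ab))"

definition butcher_group :: "'a series set" where
  "butcher_group = {g. delta g = (\<lambda>(a, b). g a * g b) \<and> g \<noteq> (\<lambda>_. 0)}"

text \<open>
  The quotient \<open>\<H>\<^sup>N\<close> is represented by the canonical representatives, i.e. by the series supported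
  on forests with at most \<open>N\<close> nodes; its product is \<open>\<rho>\<^sup>N (g \<star> h)\<close>.
\<close>

definition HN :: "nat \<Rightarrow> 'a series set" where
  "HN N = {h. \<forall>\<sigma>. N < fnodes \<sigma> \<longrightarrow> h \<sigma> = 0}"

definition rhoN :: "nat \<Rightarrow> 'a series \<Rightarrow> 'a series" where
  "rhoN N h = (\<lambda>\<sigma>. if fnodes \<sigma> \<le> N then h \<sigma> else 0)"

definition starN :: "nat \<Rightarrow> 'a series \<Rightarrow> 'a series \<Rightarrow> 'a series" where
  "starN N g h = rhoN N (star g h)"

definition GN :: "nat \<Rightarrow> 'a series set" where
  "GN N = rhoN N ` butcher_group"

definition level :: "nat \<Rightarrow> 'a series \<Rightarrow> 'a series" where
  "level n h = (\<lambda>\<sigma>. if fnodes \<sigma> = n then h \<sigma> else 0)"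

definition hnorm :: "nat \<Rightarrow> 'a series \<Rightarrow> real" where
  "hnorm N h = sqrt (\<Sum>\<sigma> | fnodes \<sigma> \<le> N. (h \<sigma>)\<^sup>2)"


section \<open>Words and the free generators\<close>

text \<open>
  Indices are shifted by one: letter \<open>r :: nat\<close> stands for the generator usually written
  \<open>\<tau>\<^sub>r\<^sub>+\<^sub>1\<close>. A (formal or finite) combination of words \<open>\<tau>\<^bsub>r1\<^esub> \<otimes> \<dots> \<otimes> \<tau>\<^bsub>rm\<^esub>\<close> is its coefficient function.
  Hence \<open>P(B)\<close> is the whole type \<open>wseries\<close>, \<open>T(B)\<close> is \<open>fin_supp\<close>, and \<open>T((B\<^sub>k))\<close> below is a
  subset of \<open>P(B)\<close>, so that the natural inclusion of \<open>T((B\<^sub>k))\<close> in \<open>P(B)\<close> is the identity on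
  coefficient functions.
\<close>

type_synonym wseries = "nat list \<Rightarrow> real"

definition conc :: "wseries \<Rightarrow> wseries \<Rightarrow> wseries" where
  "conc u v = (\<lambda>R. \<Sum>(R1, R2) | R1 @ R2 = R. u R1 * v R2)"

definition star_word :: "(nat \<Rightarrow> 'a rtree) \<Rightarrow> nat list \<Rightarrow> 'a series" where
  "star_word \<tau> R = foldr (\<lambda>r h. star (basis {#\<tau> r#}) h) R (basis {#})"

text \<open>
  The linear map \<open>\<tau>\<^bsub>r1\<^esub> \<otimes> \<dots> \<otimes> \<tau>\<^bsub>rm\<^esub> \<mapsto> \<tau>\<^bsub>r1\<^esub> \<star> \<dots> \<star> \<tau>\<^bsub>rm\<^esub>\<close>. For a sequence of distinct trees
  each coefficient is a finite sum even for formal series, because \<open>\<star>\<close> is graded by the number of nodes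
  and only finitely many words have a given total number of nodes. On \<open>T(B)\<close> this is the algebra
  morphism extending \<open>B \<subset> \<H>\<close>; on \<open>P(B)\<close> it is the identification with \<open>\<H>\<^sup>*\<close>.
\<close>

definition word_to_H :: "(nat \<Rightarrow> 'a rtree) \<Rightarrow> wseries \<Rightarrow> 'a series" where
  "word_to_H \<tau> v = (\<lambda>\<sigma>. Sum_any (\<lambda>R. v R * star_word \<tau> R \<sigma>))"

text \<open>
  The coproduct of the tensor Hopf algebra: the multiplicative extension (for concatenation) of
  \<open>r \<mapsto> r \<otimes> 1 + 1 \<otimes> r\<close>, listed with multiplicities.
\<close>

primrec unshuffle :: "nat list \<Rightarrow> (nat list \<times> nat list) multiset" where
  "unshuffle [] = {#([], [])#}"
| "unshuffle (r # R) =
     image_mset (\<lambda>(u, v). (r # u, v)) (unshuffle R)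
     + image_mset (\<lambda>(u, v). (u, r # v)) (unshuffle R)"

text \<open>
  \<open>word_to_H \<tau>\<close> restricts to a Hopf algebra isomorphism from \<open>T(B)\<close>, \<open>B = span {\<tau>\<^sub>i}\<close>, onto
  \<open>(\<H>, \<star>, \<delta>)\<close>: linear by construction, and compatible with product, unit, coproduct and counit
  (the antipodes are then automatically respected) and bijective.
\<close>

definition free_generators :: "(nat \<Rightarrow> 'a rtree) \<Rightarrow> bool" where
  "free_generators \<tau> \<longleftrightarrow>
     (\<forall>x\<in>fin_supp. \<forall>y\<in>fin_supp.
        word_to_H \<tau> (conc x y) = star (word_to_H \<tau> x) (word_to_H \<tau> y)) \<and>
     word_to_H \<tau> (basis []) = basis {#} \<and>
     (\<forall>x\<in>fin_supp. \<forall>a b.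
        delta (word_to_H \<tau> x) (a, b) =
          (\<Sum>R | x R \<noteq> 0. x R *
             \<Sum>\<^sub># (image_mset (\<lambda>(u, v). star_word \<tau> u a * star_word \<tau> v b) (unshuffle R)))) \<and>
     (\<forall>x\<in>fin_supp. word_to_H \<tau> x {#} = x []) \<and>
     bij_betw (word_to_H \<tau>) fin_supp fin_supp"


section \<open>The inhomogeneous tensor algebra over \<open>B\<^sub>k\<close>\<close>

definition Pi_exp :: "(nat \<Rightarrow> 'a rtree) \<Rightarrow> real \<Rightarrow> nat \<Rightarrow> real" where
  "Pi_exp \<tau> p j = p / real (tnodes (\<tau> j))"

definition deg_Pi :: "(nat \<Rightarrow> 'a rtree) \<Rightarrow> real \<Rightarrow> nat list \<Rightarrow> real" where
  "deg_Pi \<tau> p R = (\<Sum>r\<leftarrow>R. 1 / Pi_exp \<tau> p r)"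

definition A1 :: "(nat \<Rightarrow> 'a rtree) \<Rightarrow> real \<Rightarrow> nat \<Rightarrow> nat list set" where
  "A1 \<tau> p k = {R. set R \<subseteq> {..<k} \<and> deg_Pi \<tau> p R \<le> 1}"

definition TBk :: "nat \<Rightarrow> wseries set" where
  "TBk k = {v. \<forall>R. \<not> set R \<subseteq> {..<k} \<longrightarrow> v R = 0}"

text \<open>
  As for \<open>\<H>\<^sup>N\<close>, the quotient algebra \<open>T\<^bsup>(\<Pi>,1)\<^esup>(B\<^sub>k)\<close> is represented by the canonical
  representatives, supported on \<open>A1 \<tau> p k\<close>.
\<close>

definition TPi :: "(nat \<Rightarrow> 'a rtree) \<Rightarrow> real \<Rightarrow> nat \<Rightarrow> wseries set" where
  "TPi \<tau> p k = {v. \<forall>R. R \<notin> A1 \<tau> p k \<longrightarrow> v R = 0}"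

definition truncPi :: "(nat \<Rightarrow> 'a rtree) \<Rightarrow> real \<Rightarrow> nat \<Rightarrow> wseries \<Rightarrow> wseries" where
  "truncPi \<tau> p k v = (\<lambda>R. if R \<in> A1 \<tau> p k then v R else 0)"

definition concPi :: "(nat \<Rightarrow> 'a rtree) \<Rightarrow> real \<Rightarrow> nat \<Rightarrow> wseries \<Rightarrow> wseries \<Rightarrow> wseries" where
  "concPi \<tau> p k u v = truncPi \<tau> p k (conc u v)"

text \<open>An element of \<open>B\<^sub>k = B\<^sup>1 \<oplus> \<dots> \<oplus> B\<^sup>k\<close> is given by its coordinates in the basis of generators.\<close>

definition Bk :: "nat \<Rightarrow> (nat \<Rightarrow> real) set" where
  "Bk k = {x. \<forall>i. k \<le> i \<longrightarrow> x i = 0}"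

definition Bline :: "nat \<Rightarrow> (nat \<Rightarrow> real) set" where
  "Bline r = {x. \<forall>i. i \<noteq> r \<longrightarrow> x i = 0}"

definition is_norm_on :: "(nat \<Rightarrow> real) set \<Rightarrow> ((nat \<Rightarrow> real) \<Rightarrow> real) \<Rightarrow> bool" where
  "is_norm_on V \<nu> \<longleftrightarrow>
     (\<forall>x\<in>V. 0 \<le> \<nu> x \<and> (\<nu> x = 0 \<longleftrightarrow> x = (\<lambda>_. 0))) \<and>
     (\<forall>x\<in>V. \<forall>c. \<nu> (\<lambda>i. c * x i) = \<bar>c\<bar> * \<nu> x) \<and>
     (\<forall>x\<in>V. \<forall>y\<in>V. \<nu> (\<lambda>i. x i + y i) \<le> \<nu> x + \<nu> y)"

definition elem_tensor :: "(nat \<Rightarrow> real) list \<Rightarrow> wseries" where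
  "elem_tensor xs =
     (\<lambda>R. if length R = length xs then \<Prod>j<length xs. (xs ! j) (R ! j) else 0)"

text \<open>The projective norm on \<open>B\<^bsup>r1\<^esup> \<otimes> \<dots> \<otimes> B\<^bsup>rm\<^esup>\<close>, each factor normed as a subspace of \<open>B\<^sub>k\<close>.\<close>

definition proj_norm :: "((nat \<Rightarrow> real) \<Rightarrow> real) \<Rightarrow> nat list \<Rightarrow> wseries \<Rightarrow> real" where
  "proj_norm \<nu> R v =
     Inf {(\<Sum>xs\<leftarrow>xss. \<Prod>x\<leftarrow>xs. \<nu> x) | xss.
            (\<forall>xs\<in>set xss. list_all2 (\<lambda>x r. x \<in> Bline r) xs R) \<and>
            v = (\<lambda>w. \<Sum>xs\<leftarrow>xss. elem_tensor xs w)}"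

definition piR :: "nat list \<Rightarrow> wseries \<Rightarrow> wseries" where
  "piR R v = (\<lambda>w. if w = R then v R else 0)"

definition embed_Bk :: "(nat \<Rightarrow> 'a rtree) \<Rightarrow> real \<Rightarrow> nat \<Rightarrow> (nat \<Rightarrow> real) \<Rightarrow> wseries" where
  "embed_Bk \<tau> p k x = truncPi \<tau> p k (elem_tensor [x])"

inductive_set lie_Pi :: "(nat \<Rightarrow> 'a rtree) \<Rightarrow> real \<Rightarrow> nat \<Rightarrow> wseries set"
  for \<tau> :: "nat \<Rightarrow> 'a rtree" and p :: real and k :: nat where
  gen: "x \<in> Bk k \<Longrightarrow> embed_Bk \<tau> p k x \<in> lie_Pi \<tau> p k"
| lin: "u \<in> lie_Pi \<tau> p k \<Longrightarrow> v \<in> lie_Pi \<tau> p k \<Longrightarrow> (\<lambda>R. a * u R + b * v R) \<in> lie_Pi \<tau> p k"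
| bracket: "u \<in> lie_Pi \<tau> p k \<Longrightarrow> v \<in> lie_Pi \<tau> p k \<Longrightarrow>
     (\<lambda>R. concPi \<tau> p k u v R - concPi \<tau> p k v u R) \<in> lie_Pi \<tau> p k"

definition pow_Pi :: "(nat \<Rightarrow> 'a rtree) \<Rightarrow> real \<Rightarrow> nat \<Rightarrow> wseries \<Rightarrow> nat \<Rightarrow> wseries" where
  "pow_Pi \<tau> p k v n = ((concPi \<tau> p k v) ^^ n) (basis [])"

definition exp_Pi :: "(nat \<Rightarrow> 'a rtree) \<Rightarrow> real \<Rightarrow> nat \<Rightarrow> wseries \<Rightarrow> wseries" where
  "exp_Pi \<tau> p k v = (\<lambda>R. suminf (\<lambda>n. pow_Pi \<tau> p k v n R / fact n))"

definition GPi :: "(nat \<Rightarrow> 'a rtree) \<Rightarrow> real \<Rightarrow> nat \<Rightarrow> wseries set" where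
  "GPi \<tau> p k = exp_Pi \<tau> p k ` lie_Pi \<tau> p k"

definition is_Psi :: "(nat \<Rightarrow> 'a rtree) \<Rightarrow> real \<Rightarrow> nat \<Rightarrow> ('a series \<Rightarrow> wseries) \<Rightarrow> bool" where
  "is_Psi \<tau> p k \<Psi> \<longleftrightarrow>
     (let N = nat \<lfloor>p\<rfloor> in
      bij_betw \<Psi> (HN N) (TPi \<tau> p k) \<and>
      (\<forall>g\<in>HN N. \<forall>h\<in>HN N. \<forall>a b.
         \<Psi> (\<lambda>\<sigma>. a * g \<sigma> + b * h \<sigma>) = (\<lambda>R. a * \<Psi> g R + b * \<Psi> h R)) \<and>
      (\<forall>g\<in>HN N. \<forall>h\<in>HN N. \<Psi> (starN N g h) = concPi \<tau> p k (\<Psi> g) (\<Psi> h)) \<and>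
      (\<forall>R. set R \<subseteq> {..<k} \<longrightarrow>
         \<Psi> (rhoN N (star_word \<tau> R)) = truncPi \<tau> p k (basis R)))"


section \<open>Rough paths\<close>

text \<open>
  Paths are functions on \<open>real \<times> real\<close> of which only the values on \<open>time_simplex\<close> matter. Continuity
  refers to the product topology on coefficient functions, which on the finite-dimensional spaces
  \<open>\<H>\<^sup>N\<close> and \<open>T\<^bsup>(\<Pi>,1)\<^esup>(B\<^sub>k)\<close> is the norm topology.
\<close>

definition time_simplex :: "(real \<times> real) set" where
  "time_simplex = {(s, t). 0 \<le> s \<and> s \<le> t \<and> t \<le> 1}"

definition multiplicative :: "('b \<Rightarrow> 'b \<Rightarrow> 'b) \<Rightarrow> (real \<times> real \<Rightarrow> 'b) \<Rightarrow> bool" where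
  "multiplicative m X \<longleftrightarrow>
     (\<forall>s u t. 0 \<le> s \<and> s \<le> u \<and> u \<le> t \<and> t \<le> 1 \<longrightarrow> m (X (s, u)) (X (u, t)) = X (s, t))"

definition is_control :: "(real \<times> real \<Rightarrow> real) \<Rightarrow> bool" where
  "is_control \<omega> \<longleftrightarrow>
     continuous_on time_simplex \<omega> \<and> (\<forall>z\<in>time_simplex. 0 \<le> \<omega> z) \<and>
     (\<forall>s u t. 0 \<le> s \<and> s \<le> u \<and> u \<le> t \<and> t \<le> 1 \<longrightarrow> \<omega> (s, u) + \<omega> (u, t) \<le> \<omega> (s, t))"

definition branched_rough_path :: "real \<Rightarrow> (real \<times> real \<Rightarrow> 'a series) \<Rightarrow> bool" where
  "branched_rough_path p X \<longleftrightarrow>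
     (let N = nat \<lfloor>p\<rfloor> in
      (\<forall>z\<in>time_simplex. X z \<in> GN N) \<and> continuous_on time_simplex X \<and> multiplicative (starN N) X \<and>
      (\<exists>\<omega>. is_control \<omega> \<and>
         (\<forall>n\<in>{1..N}. \<forall>z\<in>time_simplex. hnorm n (level n (X z)) \<le> \<omega> z powr (real n / p))))"

definition branched_extension ::
    "real \<Rightarrow> (real \<times> real \<Rightarrow> 'a series) \<Rightarrow> (real \<times> real \<Rightarrow> 'a series) \<Rightarrow> bool" where
  "branched_extension p X S \<longleftrightarrow>
     (\<forall>z\<in>time_simplex. rhoN (nat \<lfloor>p\<rfloor>) (S z) = X z) \<and> multiplicative star S \<and>
     (\<forall>n\<ge>1. \<exists>\<omega>. is_control \<omega> \<and>
        (\<forall>z\<in>time_simplex. hnorm n (level n (S z)) \<le> \<omega> z powr (real n / p)))"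

definition Pi_rough_path ::
    "(nat \<Rightarrow> 'a rtree) \<Rightarrow> real \<Rightarrow> nat \<Rightarrow> ((nat \<Rightarrow> real) \<Rightarrow> real) \<Rightarrow>
     (real \<times> real \<Rightarrow> wseries) \<Rightarrow> bool" where
  "Pi_rough_path \<tau> p k \<nu> Y \<longleftrightarrow>
     (\<forall>z\<in>time_simplex. Y z \<in> TPi \<tau> p k) \<and> continuous_on time_simplex Y \<and>
     multiplicative (concPi \<tau> p k) Y \<and>
     (\<exists>\<omega>. is_control \<omega> \<and>
        (\<forall>R\<in>A1 \<tau> p k - {[]}. \<forall>z\<in>time_simplex.
           proj_norm \<nu> R (piR R (Y z)) \<le> \<omega> z powr deg_Pi \<tau> p R))"

definition weakly_geometric ::
    "(nat \<Rightarrow> 'a rtree) \<Rightarrow> real \<Rightarrow> nat \<Rightarrow> (real \<times> real \<Rightarrow> wseries) \<Rightarrow> bool" where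
  "weakly_geometric \<tau> p k Y \<longleftrightarrow> (\<forall>z\<in>time_simplex. Y z \<in> GPi \<tau> p k)"

definition Pi_extension ::
    "(nat \<Rightarrow> 'a rtree) \<Rightarrow> real \<Rightarrow> nat \<Rightarrow> ((nat \<Rightarrow> real) \<Rightarrow> real) \<Rightarrow>
     (real \<times> real \<Rightarrow> wseries) \<Rightarrow> (real \<times> real \<Rightarrow> wseries) \<Rightarrow> bool" where
  "Pi_extension \<tau> p k \<nu> Y S \<longleftrightarrow>
     (\<forall>z\<in>time_simplex. S z \<in> TBk k \<and> truncPi \<tau> p k (S z) = Y z) \<and> multiplicative conc S \<and>
     (\<forall>R. R \<noteq> [] \<and> set R \<subseteq> {..<k} \<longrightarrow>
        (\<exists>\<omega>. is_control \<omega> \<and>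
           (\<forall>z\<in>time_simplex. proj_norm \<nu> R (piR R (S z)) \<le> \<omega> z powr deg_Pi \<tau> p R)))"


section \<open>Distances\<close>

definition partitions :: "real list set" where
  "partitions = {ts. ts \<noteq> [] \<and> hd ts = 0 \<and> last ts = 1 \<and> sorted_wrt (<) ts}"

text \<open>\<open>x \<mapsto> x\<^sup>a\<close> on \<open>[0,\<infinity>]\<close> for an exponent \<open>a > 0\<close>.\<close>

definition epowr :: "ennreal \<Rightarrow> real \<Rightarrow> ennreal" where
  "epowr x a = (if x = top then top else ennreal (enn2real x powr a))"

definition var_power :: "real \<Rightarrow> (real \<times> real \<Rightarrow> real) \<Rightarrow> ennreal" where
  "var_power q f =
     epowr (SUP ts\<in>partitions. ennreal (\<Sum>i<length ts - 1. \<bar>f (ts ! i, ts ! Suc i)\<bar> powr q)) (1 / q)"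

definition rho_pvar ::
    "real \<Rightarrow> (real \<times> real \<Rightarrow> 'a series) \<Rightarrow> (real \<times> real \<Rightarrow> 'a series) \<Rightarrow> ennreal" where
  "rho_pvar p X Y =
     (MAX n\<in>{1..nat \<lfloor>p\<rfloor>}.
        var_power (p / real n) (\<lambda>z. hnorm n (level n (\<lambda>\<sigma>. X z \<sigma> - Y z \<sigma>))))"

definition rho_Pivar ::
    "(nat \<Rightarrow> 'a rtree) \<Rightarrow> real \<Rightarrow> nat \<Rightarrow> ((nat \<Rightarrow> real) \<Rightarrow> real) \<Rightarrow>
     (real \<times> real \<Rightarrow> wseries) \<Rightarrow> (real \<times> real \<Rightarrow> wseries) \<Rightarrow> ennreal" where
  "rho_Pivar \<tau> p k \<nu> X Y =
     (MAX R\<in>A1 \<tau> p k - {[]}.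
        var_power (1 / deg_Pi \<tau> p R) (\<lambda>z. proj_norm \<nu> R (piR R (\<lambda>w. X z w - Y z w))))"

end

theory Submission
  imports Defs
begin

text \<open>
  Everything is graded by the number of nodes, which on words is the sum of the sizes of the letters;
  \<open>A1\<close> consists of the words of size at most \<open>\<lfloor>p\<rfloor>\<close>, so \<open>\<Psi>\<close> is the truncated inverse of the graded
  isomorphism between word series and forest series.

  A truncated group-like element is a function on forests that is multiplicative up to \<open>\<lfloor>p\<rfloor>\<close>
  nodes. Lie elements are primitive, and the exponential of a primitive element is multiplicative.
  Conversely a logarithm is constructed degree by degree: the lowest-order difference between two
  group-like elements is primitive, and primitive elements are Lie elements because on them the Dynkin
  operator multiplies words of length \<open>m\<close> by \<open>m\<close>.

  The distances are comparable because \<open>\<Psi>\<close> maps each degree to itself, all spaces involved are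
  finite-dimensional, and the exponents \<open>n / p\<close> and \<open>deg_Pi\<close> agree. The extensions agree because the
  lowest-order difference of two extensions is additive in time and bounded by \<open>\<omega>\<^sup>\<theta>\<close> with \<open>\<theta> > 1\<close>,
  hence zero.
\<close>

section \<open>Grading of forests\<close>

text \<open>Freeness is assumed only for finitely supported series. The grading makes this enough: a
  coefficient at a forest sees only the finitely many words of the same weight, so the product rule,
  injectivity and surjectivity pass to formal series one degree at a time. Coassociativity of
  \<open>ck\<close> is never established; even the unit laws of \<open>star\<close> are transported
  from concatenation. Besides the grading, the one property of \<open>ck\<close> that enters is
  multiplicativity for juxtaposition, which says that \<open>delta\<close> is a morphism for
  \<open>star\<close>.

  Up to \<lfloor>p\<rfloor> nodes the bound \<open>k\<close> on the alphabet is automatic, since a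
  letter is no larger than its word. For extensions it is a real restriction: the extension of the
  branched path might a priori involve further letters. Hence the two extensions are compared as
  forest series, and only the word extension is moved. The exponent above 1 in that comparison is n
  / p for an integer n > \<lfloor>p\<rfloor>.\<close>

lemma fnodes_empty [simp]: "fnodes {#} = 0"
  by (simp add: fnodes_def)

lemma fnodes_union [simp]: "fnodes (\<sigma> + \<sigma>') = fnodes \<sigma> + fnodes \<sigma>'"
  by (simp add: fnodes_def)

lemma fnodes_add_mset [simp]: "fnodes (add_mset t \<sigma>) = tnodes t + fnodes \<sigma>"
  by (simp add: fnodes_def)

lemma tnodes_Node: "tnodes (Node i F) = Suc (fnodes F)"
  by (simp add: fnodes_def)

lemma tnodes_pos: "0 < tnodes t"
  by (cases t) simp

lemma tnodes_neq_0 [simp]: "tnodes t \<noteq> 0"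
  using tnodes_pos[of t] by simp

lemma fnodes_eq_0_iff [simp]: "fnodes \<sigma> = 0 \<longleftrightarrow> \<sigma> = {#}"
  by (cases \<sigma>) auto

lemma size_le_fnodes: "size \<sigma> \<le> fnodes \<sigma>"
proof (induction \<sigma>)
  case (add t \<sigma>)
  then show ?case using tnodes_pos[of t] by simp
qed simp

lemma tnodes_le_fnodes: "t \<in># \<sigma> \<Longrightarrow> tnodes t \<le> fnodes \<sigma>"
  by (metis fnodes_add_mset le_add1 multi_member_split)

text \<open>The two claims need each other: a tree is one of finitely many root labels over a
  smaller forest, and a forest is a multiset of boundedly many trees of bounded size.\<close>

lemma finite_trees_forests:
  "finite {t::'a::finite rtree. tnodes t \<le> n} \<and> finite {\<sigma>::'a forest. fnodes \<sigma> \<le> n}"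
proof (induction n)
  case 0
  then show ?case by simp
next
  case (Suc n)
  have "{t::'a rtree. tnodes t \<le> Suc n} \<subseteq> (\<lambda>(i, F). Node i F) ` (UNIV \<times> {\<sigma>. fnodes \<sigma> \<le> n})"
  proof
    fix t :: "'a rtree" assume "t \<in> {t. tnodes t \<le> Suc n}"
    then show "t \<in> (\<lambda>(i, F). Node i F) ` (UNIV \<times> {\<sigma>. fnodes \<sigma> \<le> n})"
      by (cases t) (auto simp: tnodes_Node simp del: tnodes.simps)
  qed
  then have trees: "finite {t::'a rtree. tnodes t \<le> Suc n}"
    by (rule finite_subset) (use Suc in simp)
  have "{\<sigma>::'a forest. fnodes \<sigma> \<le> Suc n} \<subseteq>
    mset ` {ts. set ts \<subseteq> {t. tnodes t \<le> Suc n} \<and> length ts \<le> Suc n}"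
  proof
    fix \<sigma> :: "'a forest" assume \<sigma>: "\<sigma> \<in> {\<sigma>. fnodes \<sigma> \<le> Suc n}"
    obtain ts where ts: "\<sigma> = mset ts" by (metis ex_mset)
    have "set ts \<subseteq> {t. tnodes t \<le> Suc n}"
      using tnodes_le_fnodes[of _ \<sigma>] \<sigma> ts by fastforce
    moreover have "length ts \<le> Suc n"
      using size_le_fnodes[of \<sigma>] \<sigma> ts by simp
    ultimately show "\<sigma> \<in> mset ` {ts. set ts \<subseteq> {t. tnodes t \<le> Suc n} \<and> length ts \<le> Suc n}"
      using ts by blast
  qed
  then have "finite {\<sigma>::'a forest. fnodes \<sigma> \<le> Suc n}"
    by (rule finite_subset) (use finite_lists_length_le[OF trees] in blast)
  with trees show ?case by blast
qed

lemmas finite_trees = finite_trees_forests[THEN conjunct1]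
lemmas finite_forests = finite_trees_forests[THEN conjunct2]

lemma finite_forests_eq: "finite {\<sigma>::'a::finite forest. fnodes \<sigma> = n}"
  by (rule finite_subset[OF _ finite_forests[of n]]) auto

lemma HN_subset_fin_supp: "HN N \<subseteq> (fin_supp :: ('a::finite forest \<Rightarrow> real) set)"
  by (auto simp: HN_def fin_supp_def intro!: finite_subset[OF _ finite_forests[of N]])
    (meson not_le_imp_less)

text \<open>Homogeneity of the factors is a hypothesis, because inside the induction on trees it is
  known only for the children of the root.\<close>

lemma keys_prod_mset_ck:
  assumes "\<And>t a b. t \<in># F \<Longrightarrow> (a, b) \<in> Poly_Mapping.keys (ck_tree t) \<Longrightarrow> fnodes a + fnodes b = tnodes t"
    and "(a, b) \<in> Poly_Mapping.keys (\<Prod>\<^sub># (image_mset ck_tree F))"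
  shows "fnodes a + fnodes b = fnodes F"
  using assms
proof (induction F arbitrary: a b)
  case empty
  then show ?case by (auto simp: zero_prod_def simp flip: single_one split: if_splits)
next
  case (add t F)
  from add.prems(2) obtain c d where
    "(a, b) = c + d" "c \<in> Poly_Mapping.keys (ck_tree t)" "d \<in> Poly_Mapping.keys (\<Prod>\<^sub># (image_mset ck_tree F))"
    using keys_mult[of "ck_tree t" "\<Prod>\<^sub># (image_mset ck_tree F)"] by auto
  moreover from this have "fnodes (fst d) + fnodes (snd d) = fnodes F"
    using add.IH[of "fst d" "snd d"] add.prems(1) by simp
  moreover have "fnodes (fst c) + fnodes (snd c) = tnodes t"
    using add.prems(1)[of t "fst c" "snd c"] calculation by simp
  ultimately show ?case by (cases c; cases d) (simp add: ac_simps)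
qed

lemma keys_ck_tree:
  "(a, b) \<in> Poly_Mapping.keys (ck_tree t) \<Longrightarrow> fnodes a + fnodes b = tnodes t"
proof (induction t arbitrary: a b)
  case (Node i F)
  let ?P = "\<Prod>\<^sub># (image_mset ck_tree F)"
  have "(a, b) = ({#Node i F#}, {#}) \<or> (a, b) \<in> Poly_Mapping.keys (id_tensor_Bplus i ?P)"
    using Node.prems keys_add[of "Poly_Mapping.single ({#Node i F#}, {#}) (1::real)" "id_tensor_Bplus i ?P"]
    by auto
  then show ?case
  proof
    assume "(a, b) \<in> Poly_Mapping.keys (id_tensor_Bplus i ?P)"
    then obtain c d where cd: "(c, d) \<in> Poly_Mapping.keys ?P" "a = c" "b = {#Node i d#}"
      unfolding id_tensor_Bplus_def
      using keys_sum[of "\<lambda>(a, b). Poly_Mapping.single (a, {#Node i b#}) (Poly_Mapping.lookup ?P (a, b))" "Poly_Mapping.keys ?P"]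
      by (fastforce split: if_splits)
    have "fnodes c + fnodes d = fnodes F"
      by (rule keys_prod_mset_ck[OF _ cd(1)]) (use Node.IH in auto)
    then show ?thesis using cd by (simp add: tnodes_Node del: tnodes.simps)
  qed (simp add: tnodes_Node del: tnodes.simps)
qed

lemma keys_ck: "(a, b) \<in> Poly_Mapping.keys (ck \<sigma>) \<Longrightarrow> fnodes a + fnodes b = fnodes \<sigma>"
  unfolding ck_def by (rule keys_prod_mset_ck) (auto intro: keys_ck_tree)

lemma ck_union: "ck (\<sigma> + \<sigma>') = ck \<sigma> * ck \<sigma>'"
  by (simp add: ck_def)

section \<open>Linear functionals on finitely supported functions, and the dual form of
  multiplicativity\<close>

lemma sum_keys_superset:
  assumes "finite K" "Poly_Mapping.keys P \<subseteq> K"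
  shows "(\<Sum>k\<in>Poly_Mapping.keys P. F k * Poly_Mapping.lookup P k) = (\<Sum>k\<in>K. F k * Poly_Mapping.lookup P k :: real)"
  using assms by (intro sum.mono_neutral_left) (auto simp: in_keys_iff)

lemma poly_mapping_eq_sum_single:
  "P = (\<Sum>k\<in>Poly_Mapping.keys P. Poly_Mapping.single k (Poly_Mapping.lookup P k))"
  by (rule poly_mapping_eqI) (auto simp: lookup_sum lookup_single when_def in_keys_iff)

text \<open>The monomials \<open>m i\<close> may coincide and their coefficients may cancel, so the
  support of the sum is not controlled. The linear extension of \<open>F\<close> can nevertheless be
  evaluated term by term.\<close>

lemma sum_keys_sum_single:
  assumes "finite I"
  shows "(\<Sum>k\<in>Poly_Mapping.keys (\<Sum>i\<in>I. Poly_Mapping.single (m i) (c i)).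
      F k * Poly_Mapping.lookup (\<Sum>i\<in>I. Poly_Mapping.single (m i) (c i)) k) = (\<Sum>i\<in>I. F (m i) * c i :: real)"
proof -
  let ?P = "\<Sum>i\<in>I. Poly_Mapping.single (m i) (c i)"
  have sub: "Poly_Mapping.keys ?P \<subseteq> m ` I"
    using keys_sum[of "\<lambda>i. Poly_Mapping.single (m i) (c i)" I] by (auto split: if_splits)
  have "(\<Sum>k\<in>Poly_Mapping.keys ?P. F k * Poly_Mapping.lookup ?P k) = (\<Sum>k\<in>m ` I. F k * Poly_Mapping.lookup ?P k)"
    using assms sub by (intro sum_keys_superset) auto
  also have "\<dots> = (\<Sum>k\<in>m ` I. \<Sum>i\<in>I. if m i = k then F k * c i else 0)"
    by (intro sum.cong) (auto simp: lookup_sum lookup_single when_def sum_distrib_left intro!: sum.cong)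
  also have "\<dots> = (\<Sum>i\<in>I. \<Sum>k\<in>m ` I. if m i = k then F k * c i else 0)"
    by (rule sum.swap)
  also have "\<dots> = (\<Sum>i\<in>I. F (m i) * c i)"
    using assms by (intro sum.cong) (auto simp: sum.delta)
  finally show ?thesis .
qed

lemma sum_keys_mult:
  fixes P Q :: "'b::monoid_add \<Rightarrow>\<^sub>0 real"
  shows "(\<Sum>k\<in>Poly_Mapping.keys (P * Q). F k * Poly_Mapping.lookup (P * Q) k) =
    (\<Sum>k\<in>Poly_Mapping.keys P. \<Sum>l\<in>Poly_Mapping.keys Q. F (k + l) * (Poly_Mapping.lookup P k * Poly_Mapping.lookup Q l))"
proof -
  have "P * Q = (\<Sum>k\<in>Poly_Mapping.keys P. Poly_Mapping.single k (Poly_Mapping.lookup P k)) *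
      (\<Sum>l\<in>Poly_Mapping.keys Q. Poly_Mapping.single l (Poly_Mapping.lookup Q l))"
    by (simp flip: poly_mapping_eq_sum_single)
  also have "\<dots> = (\<Sum>x\<in>Poly_Mapping.keys P \<times> Poly_Mapping.keys Q.
      Poly_Mapping.single (fst x + snd x) (Poly_Mapping.lookup P (fst x) * Poly_Mapping.lookup Q (snd x)))"
    by (simp add: sum_product mult_single sum.cartesian_product split_def)
  finally have "P * Q = \<dots>" .
  then show ?thesis
    by (simp add: sum_keys_sum_single sum.cartesian_product split_def)
qed

lemma star_union:
  "star g h (\<sigma> + \<sigma>') = (\<Sum>(a, b)\<in>Poly_Mapping.keys (ck \<sigma>). \<Sum>(a', b')\<in>Poly_Mapping.keys (ck \<sigma>').
     g (a + a') * h (b + b') * (Poly_Mapping.lookup (ck \<sigma>) (a, b) * Poly_Mapping.lookup (ck \<sigma>') (a', b')))"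
  unfolding star_def ck_union
  using sum_keys_mult[of "\<lambda>(a, b). g a * h b" "ck \<sigma>" "ck \<sigma>'"]
  by (simp add: split_def)

lemma star_cong:
  assumes "\<And>a. fnodes a \<le> fnodes \<sigma> \<Longrightarrow> g a = g' a" "\<And>b. fnodes b \<le> fnodes \<sigma> \<Longrightarrow> h b = h' b"
  shows "star g h \<sigma> = star g' h' \<sigma>"
  unfolding star_def
proof (intro sum.cong refl, clarify)
  fix a b assume "(a, b) \<in> Poly_Mapping.keys (ck \<sigma>)"
  from keys_ck[OF this] show "g a * h b * Poly_Mapping.lookup (ck \<sigma>) (a, b) = g' a * h' b * Poly_Mapping.lookup (ck \<sigma>) (a, b)"
    using assms by simp
qed

lemma star_sum_right: "star h (\<lambda>\<sigma>. \<Sum>i\<in>I. c i * g i \<sigma>) \<sigma> = (\<Sum>i\<in>I. c i * star h (g i) \<sigma>)"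
  by (simp add: star_def sum_distrib_left sum_distrib_right split_def sum.swap[of _ I] ac_simps)

lemma star_diff_left: "star (\<lambda>\<sigma>. g \<sigma> - g' \<sigma>) h \<sigma> = star g h \<sigma> - star g' h \<sigma>"
  by (simp add: star_def sum_subtractf split_def algebra_simps)

lemma star_diff_right: "star h (\<lambda>\<sigma>. g \<sigma> - g' \<sigma>) \<sigma> = star h g \<sigma> - star h g' \<sigma>"
  by (simp add: star_def sum_subtractf split_def algebra_simps)

lemma star_graded:
  assumes "\<And>\<sigma>. g \<sigma> \<noteq> 0 \<Longrightarrow> fnodes \<sigma> = m" "\<And>\<sigma>. h \<sigma> \<noteq> 0 \<Longrightarrow> fnodes \<sigma> = n"
    and "star g h \<sigma> \<noteq> 0"
  shows "fnodes \<sigma> = m + n"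
proof -
  have "\<exists>x\<in>Poly_Mapping.keys (ck \<sigma>). g (fst x) \<noteq> 0 \<and> h (snd x) \<noteq> 0"
  proof (rule ccontr)
    assume "\<not> ?thesis"
    then have "star g h \<sigma> = 0"
      unfolding star_def split_def by (intro sum.neutral) auto
    with assms(3) show False by contradiction
  qed
  then obtain a b where ab: "(a, b) \<in> Poly_Mapping.keys (ck \<sigma>)" "g a \<noteq> 0" "h b \<noteq> 0"
    by auto
  from assms(1)[OF ab(2)] assms(2)[OF ab(3)] keys_ck[OF ab(1)] show ?thesis by simp
qed

text \<open>The bialgebra law: if \<open>delta g\<close> is a sum of \<alpha> \<otimes> \<beta> and
  \<open>delta h\<close> a sum of \<gamma> \<otimes> \<eta>, then \<open>delta (star g h)\<close> is
  the sum of the products taken factor by factor. It is dual to multiplicativity of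
  \<open>ck\<close>. The bound \<open>N\<close> survives because \<open>ck\<close> preserves the
  number of nodes.\<close>

lemma star_split_coproduct:
  assumes g: "\<And>a b. fnodes (a + b) \<le> N \<Longrightarrow> g (a + b) = (\<Sum>i\<in>I. \<alpha> i a * \<beta> i b)"
    and h: "\<And>a b. fnodes (a + b) \<le> N \<Longrightarrow> h (a + b) = (\<Sum>j\<in>J. \<gamma> j a * \<eta> j b)"
    and N: "fnodes (a + b) \<le> N"
  shows "star g h (a + b) = (\<Sum>i\<in>I. \<Sum>j\<in>J. star (\<alpha> i) (\<gamma> j) a * star (\<beta> i) (\<eta> j) b)"
proof -
  let ?c = "\<lambda>x y. Poly_Mapping.lookup (ck a) x * Poly_Mapping.lookup (ck b) y"
  have "star g h (a + b) = (\<Sum>x\<in>Poly_Mapping.keys (ck a). \<Sum>y\<in>Poly_Mapping.keys (ck b).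
     (\<Sum>i\<in>I. \<alpha> i (fst x) * \<beta> i (fst y)) * (\<Sum>j\<in>J. \<gamma> j (snd x) * \<eta> j (snd y)) * ?c x y)"
    unfolding star_union split_def
  proof (intro sum.cong refl)
    fix x y assume "x \<in> Poly_Mapping.keys (ck a)" "y \<in> Poly_Mapping.keys (ck b)"
    then have "fnodes (fst x) + fnodes (snd x) = fnodes a" "fnodes (fst y) + fnodes (snd y) = fnodes b"
      by (simp_all add: keys_ck)
    then show "g (fst x + fst y) * h (snd x + snd y) * (Poly_Mapping.lookup (ck a) (fst x, snd x) * Poly_Mapping.lookup (ck b) (fst y, snd y)) =
     (\<Sum>i\<in>I. \<alpha> i (fst x) * \<beta> i (fst y)) * (\<Sum>j\<in>J. \<gamma> j (snd x) * \<eta> j (snd y)) * ?c x y"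
      using N by (subst g, simp, subst h, simp_all)
  qed
  also have "\<dots> = (\<Sum>x\<in>Poly_Mapping.keys (ck a). \<Sum>y\<in>Poly_Mapping.keys (ck b). \<Sum>i\<in>I. \<Sum>j\<in>J.
     (\<alpha> i (fst x) * \<gamma> j (snd x) * Poly_Mapping.lookup (ck a) x) * (\<beta> i (fst y) * \<eta> j (snd y) * Poly_Mapping.lookup (ck b) y))"
    by (simp only: sum_product, simp only: sum_distrib_right, simp only: ac_simps)
  also have "\<dots> = (\<Sum>i\<in>I. \<Sum>j\<in>J. \<Sum>x\<in>Poly_Mapping.keys (ck a). \<Sum>y\<in>Poly_Mapping.keys (ck b).
     (\<alpha> i (fst x) * \<gamma> j (snd x) * Poly_Mapping.lookup (ck a) x) * (\<beta> i (fst y) * \<eta> j (snd y) * Poly_Mapping.lookup (ck b) y))"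
    by (simp only: sum.swap[of _ J "Poly_Mapping.keys (ck b)"] sum.swap[of _ I "Poly_Mapping.keys (ck b)"]
        sum.swap[of _ J "Poly_Mapping.keys (ck a)"] sum.swap[of _ I "Poly_Mapping.keys (ck a)"])
  also have "\<dots> = (\<Sum>i\<in>I. \<Sum>j\<in>J. star (\<alpha> i) (\<gamma> j) a * star (\<beta> i) (\<eta> j) b)"
    by (simp add: star_def sum_product split_def)
  finally show ?thesis .
qed

section \<open>Concatenation of word series and the Dynkin operator\<close>

lemma splits_Cons:
  "{(R1, R2). R1 @ R2 = s # S} = insert ([], s # S) ((\<lambda>(R1, R2). (s # R1, R2)) ` {(R1, R2). R1 @ R2 = S})"
  by (auto simp: append_eq_Cons_conv image_iff)

lemma finite_splits: "finite {(R1, R2). R1 @ R2 = S}"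
proof (induction S)
  case (Cons s S)
  then show ?case by (simp add: splits_Cons)
qed simp

lemma conc_Nil [simp]: "conc u v [] = u [] * v []"
  by (simp add: conc_def)

text \<open>The prefix in a splitting is empty or starts with \<open>s\<close>. This recursion lets
  identities for \<open>conc\<close> be shown by induction on the word, with \<open>u\<close>
  replaced by its shift, instead of by rearranging sums over splittings.\<close>

lemma conc_Cons: "conc u v (s # S) = u [] * v (s # S) + conc (\<lambda>R. u (s # R)) v S"
proof -
  have "inj_on (\<lambda>(R1, R2). (s # R1, R2)) {(R1, R2). R1 @ R2 = S}"
    by (auto simp: inj_on_def)
  then have "(\<Sum>(R1, R2)\<in>(\<lambda>(R1, R2). (s # R1, R2)) ` {(R1, R2). R1 @ R2 = S}. u R1 * v R2) =
      conc (\<lambda>R. u (s # R)) v S"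
    unfolding conc_def by (subst sum.reindex) (auto simp: o_def split_def)
  then show ?thesis
    unfolding conc_def[of u v] splits_Cons
    by (subst sum.insert) (auto simp: finite_splits)
qed

lemma conc_linear_left:
  "conc (\<lambda>R. a * u R + b * u' R) v S = a * conc u v S + b * conc u' v S"
  by (simp add: conc_def split_def sum_distrib_left sum.distrib algebra_simps)

lemma conc_linear_right:
  "conc u (\<lambda>R. a * v R + b * v' R) S = a * conc u v S + b * conc u v' S"
  by (simp add: conc_def split_def sum_distrib_left sum.distrib algebra_simps)

lemma conc_add_left: "conc (\<lambda>R. u R + u' R) v S = conc u v S + conc u' v S"
  using conc_linear_left[of 1 u 1 u'] by simp

lemma conc_diff_left: "conc (\<lambda>R. u R - u' R) v S = conc u v S - conc u' v S"
  using conc_linear_left[of 1 u "-1" u'] by simp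

lemma conc_scale_left: "conc (\<lambda>R. a * u R) v S = a * conc u v S"
  using conc_linear_left[of a u 0 u] by simp

lemma conc_zero_left [simp]: "conc (\<lambda>_. 0) v S = 0"
  by (simp add: conc_def)

lemma conc_zero_right [simp]: "conc v (\<lambda>_. 0) S = 0"
  by (simp add: conc_def)

lemma conc_assoc: "conc (conc u v) w = conc u (conc v w)"
proof
  show "conc (conc u v) w S = conc u (conc v w) S" for S
  proof (induction S arbitrary: u v)
    case (Cons s S)
    then show ?case
      by (simp add: conc_Cons conc_add_left conc_scale_left algebra_simps)
  qed simp
qed

lemma basis_Nil_Cons [simp]: "(\<lambda>R. basis [] (s # R)) = (\<lambda>_. 0)"
  by (simp add: basis_def)

lemma basis_Cons_Cons: "(\<lambda>R. basis (r # Q) (s # R)) = (if r = s then basis Q else (\<lambda>_. 0))"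
  by (auto simp: basis_def)

lemma basis_Cons_Nil [simp]: "basis (r # Q) [] = 0"
  by (simp add: basis_def)

lemma basis_self [simp]: "basis x x = 1"
  by (simp add: basis_def)

lemma conc_unit_left [simp]: "conc (basis []) v = v"
proof
  show "conc (basis []) v S = v S" for S
    by (cases S) (simp_all add: conc_Cons)
qed

lemma conc_unit_right [simp]: "conc v (basis []) = v"
proof
  show "conc v (basis []) S = v S" for S
    by (induction S arbitrary: v) (simp_all add: conc_Cons, simp add: basis_def)
qed

lemma conc_basis [simp]: "conc (basis Q) (basis R) = basis (Q @ R)"
proof
  show "conc (basis Q) (basis R) S = basis (Q @ R) S" for S
  proof (induction Q arbitrary: S)
    case (Cons q Q)
    then show ?case
      by (cases S) (auto simp: conc_Cons basis_Cons_Cons, simp_all add: basis_def)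
  qed simp
qed

lemma conc_support:
  assumes "conc u v S \<noteq> 0"
  obtains Q R where "S = Q @ R" "u Q \<noteq> 0" "v R \<noteq> 0"
proof -
  have "\<exists>x\<in>{(Q, R). Q @ R = S}. u (fst x) \<noteq> 0 \<and> v (snd x) \<noteq> 0"
  proof (rule ccontr)
    assume "\<not> ?thesis"
    then have "conc u v S = 0"
      unfolding conc_def split_def by (intro sum.neutral) auto
    with assms show False by contradiction
  qed
  then show ?thesis using that by auto
qed

text \<open>Right-normed bracketing \<open>r\<^sub>1 \<dots> r\<^sub>m \<mapsto> [r\<^sub>1, [r\<^sub>2, \<dots> r\<^sub>m]]\<close>; since the value at the empty word
  is \<open>0\<close>, the correction term makes the value at a single letter that letter.\<close>

primrec dynkin :: "nat list \<Rightarrow> wseries" where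
  "dynkin [] = (\<lambda>_. 0)"
| "dynkin (r # R) = (\<lambda>S. conc (basis [r]) (dynkin R) S - conc (dynkin R) (basis [r]) S
      + (if R = [] then basis [r] S else 0))"

lemma dynkin_single: "dynkin [r] = basis [r]"
  by auto

text \<open>Bracketing only permutes letters. Hence the operator preserves both the length and the
  weight of words.\<close>

lemma dynkin_support: "dynkin R S \<noteq> 0 \<Longrightarrow> mset S = mset R"
proof (induction R arbitrary: S)
  case (Cons r R)
  from Cons.prems consider "conc (basis [r]) (dynkin R) S \<noteq> 0" | "conc (dynkin R) (basis [r]) S \<noteq> 0"
    | "R = []" "basis [r] S \<noteq> 0"
    by (cases "conc (basis [r]) (dynkin R) S = 0"; cases "conc (dynkin R) (basis [r]) S = 0")
      (auto split: if_splits)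
  then show ?case
  proof cases
    case 1
    then obtain Q Q' where "S = Q @ Q'" "basis [r] Q \<noteq> 0" "dynkin R Q' \<noteq> 0"
      by (rule conc_support)
    then show ?thesis using Cons.IH[of Q'] by (auto simp: basis_def split: if_splits)
  next
    case 2
    then obtain Q Q' where "S = Q @ Q'" "basis [r] Q' \<noteq> 0" "dynkin R Q \<noteq> 0"
      by (rule conc_support)
    then show ?thesis using Cons.IH[of Q] by (auto simp: basis_def split: if_splits)
  qed (auto simp: basis_def split: if_splits)
qed simp

lemma unshuffle_mset: "(u, v) \<in># unshuffle R \<Longrightarrow> mset u + mset v = mset R"
  by (induction R arbitrary: u v) auto

text \<open>Exactly one unshuffle has an empty left part: all letters must have gone to the
  right.\<close>

lemma sum_unshuffle_Nil:
  "(\<Sum>x\<in>#unshuffle R. if fst x = [] then f (snd x) else 0) = (f R :: real)"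
proof (induction R arbitrary: f)
  case (Cons r R)
  from Cons[of "\<lambda>v. f (r # v)"] show ?case
    by (simp add: image_mset.compositionality o_def split_def cong: if_cong)
qed simp

text \<open>In the shuffle bialgebra this says that the convolution of the Dynkin operator with the identity
  is multiplication by the length.\<close>

lemma sum_unshuffle_dynkin:
  "(\<Sum>x\<in>#unshuffle R. conc (dynkin (fst x)) (basis (snd x)) S) = real (length R) * basis R S"
proof (induction R arbitrary: S)
  case (Cons r R)
  \<comment> \<open>The next letter \<open>r\<close> goes to the left or to the right part. The
    subtracted half of the bracket in \<open>dynkin (r # u)\<close> cancels the contribution of the
    right part, which leaves \<open>r\<close> in front of the old term; the correction survives only
    for empty \<open>u\<close>.\<close>
  have step: "conc (dynkin (r # u)) (basis v) S + conc (dynkin u) (basis (r # v)) S =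
      conc (basis [r]) (conc (dynkin u) (basis v)) S + (if u = [] then basis (r # v) S else 0)" for u v
  proof -
    have "conc (dynkin (r # u)) (basis v) S =
        conc (conc (basis [r]) (dynkin u)) (basis v) S - conc (conc (dynkin u) (basis [r])) (basis v) S
        + (if u = [] then basis (r # v) S else 0)"
      by (simp add: conc_add_left conc_diff_left)
    then show ?thesis
      by (simp add: conc_assoc)
  qed
  have shift: "conc (basis [r]) f S = (case S of [] \<Rightarrow> 0 | s # S' \<Rightarrow> if r = s then f S' else 0)" for f
    by (cases S) (simp_all add: conc_Cons basis_Cons_Cons)
  have "(\<Sum>x\<in>#unshuffle (r # R). conc (dynkin (fst x)) (basis (snd x)) S) =
      (\<Sum>x\<in>#unshuffle R. conc (dynkin (r # fst x)) (basis (snd x)) S +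
         conc (dynkin (fst x)) (basis (r # snd x)) S)"
    by (simp add: image_mset.compositionality o_def split_def sum_mset.distrib del: dynkin.simps)
  also have "\<dots> = (\<Sum>x\<in>#unshuffle R. conc (basis [r]) (conc (dynkin (fst x)) (basis (snd x))) S) +
      (\<Sum>x\<in>#unshuffle R. if fst x = [] then basis (r # snd x) S else 0)"
    by (simp only: step sum_mset.distrib)
  also have "(\<Sum>x\<in>#unshuffle R. if fst x = [] then basis (r # snd x) S else 0) = basis (r # R) S"
    by (rule sum_unshuffle_Nil)
  also have "(\<Sum>x\<in>#unshuffle R. conc (basis [r]) (conc (dynkin (fst x)) (basis (snd x))) S) =
      real (length R) * basis (r # R) S"
    unfolding shift using Cons.IH by (cases S) (simp_all add: basis_Cons_Cons[THEN fun_cong])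
  finally show ?case by (simp add: algebra_simps)
qed simp

section \<open>The identification of word series with forest series\<close>

lemma delta_eq: "delta g (a, b) = g (a + b)"
  unfolding delta_def delta_forest_def
  by (subst Sum_any.expand_superset[of "{a + b}"]) auto

lemma butcher_group_iff:
  "g \<in> butcher_group \<longleftrightarrow> (\<forall>a b. g (a + b) = g a * g b) \<and> g \<noteq> (\<lambda>_. 0)"
proof -
  have "delta g = (\<lambda>(a, b). g a * g b) \<longleftrightarrow> (\<forall>a b. g (a + b) = g a * g b)"
    by (auto simp: fun_eq_iff delta_eq)
  then show ?thesis by (simp add: butcher_group_def)
qed

lemma sum_mset_eq_sum_count:
  assumes "finite K" "set_mset M \<subseteq> K"
  shows "(\<Sum>x\<in>#M. f x) = (\<Sum>k\<in>K. real (count M k) * f k)"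
  using assms(2)
proof (induction M)
  case (add x M)
  have "(\<Sum>k\<in>K. real (count (add_mset x M) k) * f k) =
      (\<Sum>k\<in>K. real (count M k) * f k + (if k = x then f k else 0))"
    by (intro sum.cong) (auto simp: algebra_simps)
  also have "\<dots> = (\<Sum>k\<in>K. real (count M k) * f k) + f x"
    using add.prems assms(1) by (simp add: sum.distrib)
  finally show ?case using add by simp
qed simp

locale free_gens =
  fixes \<tau> :: "nat \<Rightarrow> 'a::finite rtree"
  assumes inj_gens: "inj \<tau>" and free_gens: "free_generators \<tau>"
begin

abbreviation "sw \<equiv> star_word \<tau>"
abbreviation "W \<equiv> word_to_H \<tau>"
abbreviation one_H :: "'a series" where "one_H \<equiv> basis {#}"

definition wt :: "nat list \<Rightarrow> nat" where
  "wt R = (\<Sum>r\<leftarrow>R. tnodes (\<tau> r))"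

lemma wt_simps [simp]: "wt [] = 0" "wt (r # R) = tnodes (\<tau> r) + wt R" "wt (R @ S) = wt R + wt S"
  by (simp_all add: wt_def)

lemma wt_eq_0_iff [simp]: "wt R = 0 \<longleftrightarrow> R = []"
  by (cases R) auto

lemma wt_mset: "mset R = mset S \<Longrightarrow> wt R = wt S"
  unfolding wt_def by (metis mset_map sum_mset_sum_list)

lemma length_le_wt: "length R \<le> wt R"
proof (induction R)
  case (Cons r R)
  then show ?case using tnodes_pos[of "\<tau> r"] by simp
qed simp

lemma letter_le_wt: "r \<in> set R \<Longrightarrow> tnodes (\<tau> r) \<le> wt R"
  by (induction R) auto

lemma finite_words: "finite {R. wt R \<le> n}"
proof (rule finite_subset)
  have "{r. tnodes (\<tau> r) \<le> n} = \<tau> -` {t. tnodes t \<le> n}" by auto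
  then have "finite {r. tnodes (\<tau> r) \<le> n}"
    using finite_vimageI[OF finite_trees inj_gens] by simp
  then show "finite {R. set R \<subseteq> {r. tnodes (\<tau> r) \<le> n} \<and> length R \<le> n}"
    by (rule finite_lists_length_le)
  show "{R. wt R \<le> n} \<subseteq> {R. set R \<subseteq> {r. tnodes (\<tau> r) \<le> n} \<and> length R \<le> n}"
    using length_le_wt letter_le_wt by (auto intro: order_trans)
qed

lemma finite_words_eq: "finite {R. wt R = n}"
  by (rule finite_subset[OF _ finite_words[of n]]) auto

lemma star_word_Nil [simp]: "sw [] = one_H"
  by (simp add: star_word_def)

lemma star_word_Cons: "sw (r # R) = star (basis {#\<tau> r#}) (sw R)"
  by (simp add: star_word_def)

lemma star_word_graded: "sw R \<sigma> \<noteq> 0 \<Longrightarrow> fnodes \<sigma> = wt R"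
proof (induction R arbitrary: \<sigma>)
  case Nil
  then show ?case by (simp add: basis_def split: if_splits)
next
  case (Cons r R)
  have "fnodes \<sigma> = tnodes (\<tau> r) + wt R"
    by (rule star_graded[of "basis {#\<tau> r#}" _ "sw R"])
      (use Cons in \<open>auto simp: star_word_Cons basis_def split: if_splits\<close>)
  then show ?case by simp
qed

lemma W_eq_sum:
  assumes "finite A" "\<And>R. wt R = fnodes \<sigma> \<Longrightarrow> x R \<noteq> 0 \<Longrightarrow> R \<in> A"
  shows "W x \<sigma> = (\<Sum>R\<in>A. x R * sw R \<sigma>)"
  unfolding word_to_H_def
  by (rule Sum_any.expand_superset) (use assms star_word_graded in force)+

text \<open>Star words are homogeneous, so the coefficient at \<open>\<sigma>\<close> sees only
  words of weight \<open>fnodes \<sigma>\<close>. This is what allows formal series to be cut down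
  to finite ones.\<close>

lemma W_cong:
  assumes "\<And>R. wt R = fnodes \<sigma> \<Longrightarrow> x R = y R"
  shows "W x \<sigma> = W y \<sigma>"
proof -
  have "W x \<sigma> = (\<Sum>R | wt R = fnodes \<sigma>. x R * sw R \<sigma>)"
    by (rule W_eq_sum) (simp_all add: finite_words_eq)
  also have "\<dots> = (\<Sum>R | wt R = fnodes \<sigma>. y R * sw R \<sigma>)"
    using assms by simp
  also have "\<dots> = W y \<sigma>"
    by (rule W_eq_sum[symmetric]) (simp_all add: finite_words_eq)
  finally show ?thesis .
qed

lemma W_zero [simp]: "W (\<lambda>_. 0) = (\<lambda>_. 0)"
  by (simp add: word_to_H_def)

lemma W_basis [simp]: "W (basis R) = sw R"
proof
  show "W (basis R) \<sigma> = sw R \<sigma>" for \<sigma>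
    by (subst W_eq_sum[of "{R}"]) (auto simp: basis_def split: if_splits)
qed

lemma W_sum:
  "W (\<lambda>R. \<Sum>i\<in>I. c i * x i R) \<sigma> = (\<Sum>i\<in>I. c i * W (x i) \<sigma>)"
proof -
  have W: "W y \<sigma> = (\<Sum>R | wt R = fnodes \<sigma>. y R * sw R \<sigma>)" for y
    by (rule W_eq_sum) (simp_all add: finite_words_eq)
  show ?thesis
    unfolding W by (simp add: sum_distrib_left sum_distrib_right sum.swap[of _ I] ac_simps)
qed

lemma W_linear: "W (\<lambda>R. a * x R + b * y R) \<sigma> = a * W x \<sigma> + b * W y \<sigma>"
  using W_sum[of "case_bool a b" "case_bool x y" UNIV \<sigma>] by (simp add: UNIV_bool add.commute)

lemma W_diff: "W (\<lambda>R. x R - y R) \<sigma> = W x \<sigma> - W y \<sigma>"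
  using W_linear[of 1 x "-1" y] by simp

lemma W_at_empty [simp]: "W x {#} = x []"
  by (subst W_eq_sum[of "{[]}"]) auto

definition cut :: "nat \<Rightarrow> wseries \<Rightarrow> wseries" where
  "cut n x = (\<lambda>R. if wt R \<le> n then x R else 0)"

lemma cut_fin_supp: "cut n x \<in> fin_supp"
  unfolding fin_supp_def cut_def by (auto intro: finite_subset[OF _ finite_words[of n]])

lemma conc_cong:
  assumes "\<And>R. wt R \<le> wt S \<Longrightarrow> u R = u' R" "\<And>R. wt R \<le> wt S \<Longrightarrow> v R = v' R"
  shows "conc u v S = conc u' v' S"
  unfolding conc_def using assms by (intro sum.cong) auto

text \<open>Both products are graded, so at a fixed forest the factors may be replaced by their
  \<open>cut\<close>, which lies in \<open>fin_supp\<close>, where the assumption on the generators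
  applies.\<close>

lemma W_conc: "W (conc x y) = star (W x) (W y)"
proof
  fix \<sigma> :: "'a forest"
  let ?n = "fnodes \<sigma>"
  have "W (conc x y) \<sigma> = W (conc (cut ?n x) (cut ?n y)) \<sigma>"
    by (intro W_cong conc_cong) (auto simp: cut_def)
  also have "\<dots> = star (W (cut ?n x)) (W (cut ?n y)) \<sigma>"
    using free_gens cut_fin_supp by (metis free_generators_def)
  also have "\<dots> = star (W x) (W y) \<sigma>"
    by (intro star_cong W_cong) (auto simp: cut_def)
  finally show "W (conc x y) \<sigma> = star (W x) (W y) \<sigma>" .
qed

text \<open>Injectivity separately in each degree: the parts of weight \<open>n\<close> are finitely
  supported, and equality in degree \<open>n\<close> alone makes their images equal
  everywhere.\<close>

lemma W_inj:
  assumes "\<And>\<sigma>. fnodes \<sigma> = n \<Longrightarrow> W x \<sigma> = W y \<sigma>" and "wt R = n"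
  shows "x R = y R"
proof -
  define x' y' where "x' = (\<lambda>R. if wt R = n then x R else 0)" and "y' = (\<lambda>R. if wt R = n then y R else 0)"
  have "x' \<in> fin_supp" "y' \<in> fin_supp"
    unfolding fin_supp_def x'_def y'_def by (auto intro: finite_subset[OF _ finite_words_eq[of n]])
  moreover have "W x' = W y'"
  proof
    fix \<sigma> :: "'a forest"
    show "W x' \<sigma> = W y' \<sigma>"
    proof (cases "fnodes \<sigma> = n")
      case True
      then have "W x' \<sigma> = W x \<sigma>" "W y \<sigma> = W y' \<sigma>"
        by (auto intro!: W_cong simp: x'_def y'_def)
      then show ?thesis using assms(1)[OF True] by simp
    qed (auto intro!: W_cong simp: x'_def y'_def)
  qed
  moreover have "inj_on W fin_supp"
    using free_gens by (simp add: free_generators_def bij_betw_def)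
  ultimately have "x' = y'" by (simp add: inj_on_eq_iff)
  then have "x' R = y' R" by simp
  then show ?thesis using assms(2) by (simp add: x'_def y'_def)
qed

lemma W_surj:
  assumes "h \<in> HN N"
  obtains x where "\<And>R. N < wt R \<Longrightarrow> x R = 0" "W x = h"
proof -
  have "h \<in> fin_supp" using assms HN_subset_fin_supp by blast
  moreover have "W ` fin_supp = fin_supp"
    using free_gens by (simp add: free_generators_def bij_betw_def)
  ultimately obtain x where x: "W x = h" by (metis imageE)
  \<comment> \<open>The preimage is only known to be finitely supported. Comparison with the zero
    series in each degree above \<open>N\<close> shows that it respects the truncation.\<close>
  have "x R = 0" if "N < wt R" for R
  proof (rule W_inj[of "wt R" x "\<lambda>_. 0", OF _ refl])
    fix \<sigma> :: "'a forest" assume "fnodes \<sigma> = wt R"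
    then show "W x \<sigma> = W (\<lambda>_. 0) \<sigma>"
      using x assms that by (simp add: HN_def)
  qed
  with x that show thesis by blast
qed

text \<open>Instead of computing the terms of \<open>ck\<close> with an empty left factor,
  \<open>h\<close> is replaced up to the degree of the forest by some \<open>W x\<close>, and the
  unit law of concatenation is transported.\<close>

lemma star_one_left [simp]: "star one_H h = h"
proof
  fix \<sigma> :: "'a forest"
  have "rhoN (fnodes \<sigma>) h \<in> HN (fnodes \<sigma>)" by (simp add: HN_def rhoN_def)
  then obtain x where x: "W x = rhoN (fnodes \<sigma>) h" by (rule W_surj)
  have "star one_H h \<sigma> = star (W (basis [])) (W x) \<sigma>"
    by (rule star_cong) (auto simp: x rhoN_def)
  also have "\<dots> = W x \<sigma>" by (simp flip: W_conc W_basis)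
  finally show "star one_H h \<sigma> = h \<sigma>" by (simp add: x rhoN_def)
qed

lemma star_one_right [simp]: "star h one_H = h"
proof
  fix \<sigma> :: "'a forest"
  have "rhoN (fnodes \<sigma>) h \<in> HN (fnodes \<sigma>)" by (simp add: HN_def rhoN_def)
  then obtain x where x: "W x = rhoN (fnodes \<sigma>) h" by (rule W_surj)
  have "star h one_H \<sigma> = star (W x) (W (basis [])) \<sigma>"
    by (rule star_cong) (auto simp: x rhoN_def)
  also have "\<dots> = W x \<sigma>" by (simp flip: W_conc W_basis)
  finally show "star h one_H \<sigma> = h \<sigma>" by (simp add: x rhoN_def)
qed

section \<open>The coproduct on star words and primitive elements\<close>

lemma W_union:
  assumes "finite A" "\<And>R. x R \<noteq> 0 \<Longrightarrow> R \<in> A"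
  shows "W x (a + b) = (\<Sum>R\<in>A. x R * (\<Sum>z\<in>#unshuffle R. sw (fst z) a * sw (snd z) b))"
proof -
  have fin: "finite {R. x R \<noteq> 0}"
    using assms by (auto intro: finite_subset)
  then have "W x (a + b) = (\<Sum>R | x R \<noteq> 0. x R * (\<Sum>z\<in>#unshuffle R. sw (fst z) a * sw (snd z) b))"
    using free_gens by (simp add: free_generators_def fin_supp_def split_def flip: delta_eq)
  also have "\<dots> = (\<Sum>R\<in>A. x R * (\<Sum>z\<in>#unshuffle R. sw (fst z) a * sw (snd z) b))"
    using assms by (intro sum.mono_neutral_left) auto
  finally show ?thesis .
qed

text \<open>Linear independence of tensors of star words: injectivity of \<open>W\<close> is applied
  in the first variable with \<open>b\<close> fixed, then in the second.\<close>

lemma tensor_inj: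
  assumes "finite A"
    and "\<And>a b. (\<Sum>u\<in>A. \<Sum>v\<in>A. c u v * (sw u a * sw v b)) = 0"
    and "u \<in> A" "v \<in> A"
  shows "c u v = 0"
proof -
  have "(\<Sum>v\<in>A. c u v * sw v b) = 0" for b
  proof -
    define x where "x = (\<lambda>u. if u \<in> A then \<Sum>v\<in>A. c u v * sw v b else 0)"
    have "W x a = W (\<lambda>_. 0) a" for a
    proof -
      have "W x a = (\<Sum>u\<in>A. x u * sw u a)"
        by (rule W_eq_sum) (auto simp: x_def assms(1) split: if_splits)
      also have "\<dots> = (\<Sum>u\<in>A. \<Sum>v\<in>A. c u v * (sw u a * sw v b))"
        by (simp add: x_def sum_distrib_left sum_distrib_right ac_simps)
      finally show ?thesis using assms(2) by simp
    qed
    from W_inj[OF this refl, of u] show ?thesis using assms(3) by (simp add: x_def)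
  qed
  moreover define y where "y = (\<lambda>v. if v \<in> A then c u v else 0)"
  have "W y b = (\<Sum>v\<in>A. y v * sw v b)" for b
    by (rule W_eq_sum) (auto simp: y_def assms(1) split: if_splits)
  ultimately have "W y b = W (\<lambda>_. 0) b" for b by (simp add: y_def)
  from W_inj[OF this refl, of v] show ?thesis using assms(4) by (simp add: y_def)
qed

lemma unshuffle_wt: "(u, v) \<in># unshuffle R \<Longrightarrow> wt u + wt v = wt R"
  using unshuffle_mset[of u v R] wt_mset[of "u @ v" R] by simp

text \<open>Friedrichs' criterion, in the form that primitive elements are fixed by \<open>R \<mapsto> dynkin R / length R\<close>.\<close>

lemma primitive_dynkin:
  assumes x: "\<And>R. n < wt R \<Longrightarrow> x R = 0"
    and prim: "\<And>a b. W x (a + b) = W x a * one_H b + one_H a * W x b"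
  shows "real (length S) * x S = (\<Sum>R | wt R \<le> n. x R * dynkin R S)"
proof -
  define A where "A = {R. wt R \<le> n}"
  have fin: "finite A" and Nil: "[] \<in> A"
    by (simp_all add: A_def finite_words)
  have supp: "x R \<noteq> 0 \<Longrightarrow> R \<in> A" for R
    using x by (force simp: A_def)
  have unsh: "set_mset (unshuffle R) \<subseteq> A \<times> A" if "R \<in> A" for R
    using that unshuffle_wt by (fastforce simp: A_def)
  \<comment> \<open>The coefficients, in the basis of pairs of words, of the coproduct of
    \<open>x\<close> minus x \<otimes> 1 minus 1 \<otimes> x.\<close>
  define c where "c = (\<lambda>u v. (\<Sum>R\<in>A. x R * real (count (unshuffle R) (u, v)))
     - x u * basis [] v - basis [] u * x v)"
  \<comment> \<open>The tensor \<open>c\<close> is paired with an arbitrary \<open>F\<close>. With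
    star words as \<open>F\<close>, primitivity gives zero and forces \<open>c\<close> to vanish;
    with the convolution of \<open>dynkin\<close> and the identity, the vanishing of
    \<open>c\<close> gives the claim.\<close>
  have c: "(\<Sum>u\<in>A. \<Sum>v\<in>A. c u v * F u v) =
     (\<Sum>R\<in>A. x R * (\<Sum>z\<in>#unshuffle R. F (fst z) (snd z)))
     - (\<Sum>u\<in>A. x u * F u []) - (\<Sum>v\<in>A. x v * F [] v)" for F :: "nat list \<Rightarrow> nat list \<Rightarrow> real"
  proof -
    have "(\<Sum>R\<in>A. x R * (\<Sum>z\<in>#unshuffle R. F (fst z) (snd z))) =
        (\<Sum>R\<in>A. x R * (\<Sum>z\<in>A \<times> A. real (count (unshuffle R) z) * F (fst z) (snd z)))"
      using unsh fin by (intro sum.cong refl) (subst sum_mset_eq_sum_count[of "A \<times> A"]; auto)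
    also have "\<dots> = (\<Sum>R\<in>A. \<Sum>z\<in>A \<times> A. x R * real (count (unshuffle R) z) * F (fst z) (snd z))"
      by (simp add: sum_distrib_left ac_simps)
    also have "\<dots> = (\<Sum>z\<in>A \<times> A. \<Sum>R\<in>A. x R * real (count (unshuffle R) z) * F (fst z) (snd z))"
      by (rule sum.swap)
    also have "\<dots> = (\<Sum>u\<in>A. \<Sum>v\<in>A. (\<Sum>R\<in>A. x R * real (count (unshuffle R) (u, v))) * F u v)"
      using sum.cartesian_product[of "\<lambda>u v. \<Sum>R\<in>A. x R * real (count (unshuffle R) (u, v)) * F u v" A A]
      by (simp add: sum_distrib_right split_def)
    finally have 1: "(\<Sum>R\<in>A. x R * (\<Sum>z\<in>#unshuffle R. F (fst z) (snd z))) = \<dots>" .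
    have 2: "(\<Sum>u\<in>A. x u * F u []) = (\<Sum>u\<in>A. \<Sum>v\<in>A. x u * basis [] v * F u v)"
      using fin Nil by (intro sum.cong refl)
        (simp add: basis_def if_distrib[of "\<lambda>t. t * _"] if_distrib[of "\<lambda>t. _ * t"] cong: if_cong)
    have "(\<Sum>v\<in>A. x v * F [] v) = (\<Sum>v\<in>A. \<Sum>u\<in>A. basis [] u * x v * F u v)"
      using fin Nil by (intro sum.cong refl)
        (simp add: basis_def if_distrib[of "\<lambda>t. t * _"] cong: if_cong)
    also have "\<dots> = (\<Sum>u\<in>A. \<Sum>v\<in>A. basis [] u * x v * F u v)"
      by (rule sum.swap)
    finally show ?thesis
      unfolding 1 2 c_def by (simp add: left_diff_distrib sum_subtractf)
  qed
  have W: "W x a = (\<Sum>R\<in>A. x R * sw R a)" for a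
    by (rule W_eq_sum) (simp_all add: fin supp)
  have "c u v = 0" if "u \<in> A" "v \<in> A" for u v
  proof (rule tensor_inj[OF fin _ that])
    fix a b
    show "(\<Sum>u\<in>A. \<Sum>v\<in>A. c u v * (sw u a * sw v b)) = 0"
      unfolding c[of "\<lambda>u v. sw u a * sw v b"]
      using W_union[of A x a b, OF fin supp] unfolding prim
      by (simp add: W sum_distrib_left sum_distrib_right ac_simps)
  qed
  \<comment> \<open>Of the two subtracted terms only x \<otimes> 1 leaves a trace, since
    \<open>dynkin []\<close> is zero.\<close>
  then have "(\<Sum>R\<in>A. x R * (\<Sum>z\<in>#unshuffle R. conc (dynkin (fst z)) (basis (snd z)) S)) =
      (\<Sum>u\<in>A. x u * dynkin u S)"
    using c[of "\<lambda>u v. conc (dynkin u) (basis v) S"] by simp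
  moreover have "(\<Sum>R\<in>A. x R * (real (length R) * basis R S)) = real (length S) * x S"
    using supp[of S] fin
    by (cases "S \<in> A") (auto simp: basis_def if_distrib[of "\<lambda>t. _ * t"] eq_commute[of S] cong: if_cong)
  ultimately show ?thesis by (simp add: sum_unshuffle_dynkin A_def)
qed

end

section \<open>The truncated isomorphism\<close>

lemma elem_tensor_single: "elem_tensor [x] R = (case R of [r] \<Rightarrow> x r | _ \<Rightarrow> 0)"
  by (auto simp: elem_tensor_def split: list.splits)

text \<open>\<open>letter_iff\<close> condenses the ordering of the generators by size together with
  the maximality of \<open>k\<close>. Letters count from 0, so the admissible ones are those below
  \<open>k\<close>.\<close>

locale Pi_setting = free_gens \<tau> for \<tau> :: "nat \<Rightarrow> 'a::finite rtree" +
  fixes p :: real and k :: nat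
  assumes p_ge_1: "p \<ge> 1"
    and letter_iff: "\<And>r. real (tnodes (\<tau> r)) \<le> p \<longleftrightarrow> r < k"
begin

abbreviation "N \<equiv> nat \<lfloor>p\<rfloor>"

lemma le_N_iff: "n \<le> N \<longleftrightarrow> real n \<le> p"
  using p_ge_1 by (simp add: le_nat_iff le_floor_iff)

lemma N_ge_1: "N \<ge> 1"
  using p_ge_1 by (simp add: le_N_iff)

lemma deg_Pi_eq: "deg_Pi \<tau> p R = real (wt R) / p"
  by (induction R) (simp_all add: deg_Pi_def Pi_exp_def add_divide_distrib)

lemma letters_if_wt_le_N: "wt R \<le> N \<Longrightarrow> set R \<subseteq> {..<k}"
proof
  fix r assume R: "wt R \<le> N" and "r \<in> set R"
  then have "tnodes (\<tau> r) \<le> N" using letter_le_wt order_trans by blast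
  then show "r \<in> {..<k}" by (simp add: le_N_iff letter_iff)
qed

text \<open>The degree is the weight divided by \<open>p\<close>, and weights are integers, so
  degree at most 1 means weight at most \<lfloor>p\<rfloor>; the condition on the letters then
  follows.\<close>

lemma A1_eq: "A1 \<tau> p k = {R. wt R \<le> N}"
  using letters_if_wt_le_N p_ge_1 by (auto simp: A1_def deg_Pi_eq le_N_iff)

lemma mem_TPi: "v \<in> TPi \<tau> p k \<longleftrightarrow> (\<forall>R. N < wt R \<longrightarrow> v R = 0)"
  by (simp add: TPi_def A1_eq not_le)

lemma truncPi_eq_cut: "truncPi \<tau> p k v = cut N v"
  by (simp add: truncPi_def cut_def A1_eq)

lemma truncPi_TPi [simp]: "truncPi \<tau> p k v \<in> TPi \<tau> p k"
  by (simp add: TPi_def truncPi_def)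

lemma truncPi_id [simp]: "v \<in> TPi \<tau> p k \<Longrightarrow> truncPi \<tau> p k v = v"
  by (auto simp: TPi_def truncPi_def)

lemma concPi_TPi [simp]: "concPi \<tau> p k u v \<in> TPi \<tau> p k"
  by (simp add: concPi_def)

lemma concPi_apply: "wt R \<le> N \<Longrightarrow> concPi \<tau> p k u v R = conc u v R"
  by (simp add: concPi_def truncPi_def A1_eq)

lemma basis_Nil_TPi [simp]: "basis [] \<in> TPi \<tau> p k"
  by (auto simp: mem_TPi basis_def)

lemma TPi_linear:
  "u \<in> TPi \<tau> p k \<Longrightarrow> v \<in> TPi \<tau> p k \<Longrightarrow> (\<lambda>R. a * u R + b * v R) \<in> TPi \<tau> p k"
  by (simp add: mem_TPi)

lemma W_truncPi: "W (truncPi \<tau> p k x) = rhoN N (W x)"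
proof
  fix \<sigma> :: "'a forest"
  show "W (truncPi \<tau> p k x) \<sigma> = rhoN N (W x) \<sigma>"
  proof (cases "fnodes \<sigma> \<le> N")
    case True
    then show ?thesis
      by (auto simp: rhoN_def truncPi_eq_cut cut_def intro!: W_cong)
  next
    case False
    then have "W (truncPi \<tau> p k x) \<sigma> = W (\<lambda>_. 0) \<sigma>"
      by (intro W_cong) (auto simp: truncPi_eq_cut cut_def)
    with False show ?thesis by (simp add: rhoN_def)
  qed
qed

lemma W_concPi: "W (concPi \<tau> p k x y) = starN N (W x) (W y)"
  by (simp add: concPi_def W_truncPi W_conc starN_def)

lemma rhoN_HN [simp]: "rhoN n h \<in> HN n"
  by (simp add: rhoN_def HN_def)

lemma starN_HN [simp]: "starN n g h \<in> HN n"
  by (simp add: starN_def)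

lemma W_HN:
  assumes "x \<in> TPi \<tau> p k"
  shows "W x \<in> HN N"
proof -
  have "rhoN N (W x) = W x"
    using W_truncPi[of x, symmetric] by (simp only: truncPi_id[OF assms])
  with rhoN_HN[of N "W x"] show ?thesis by (simp only:)
qed

lemma W_bij: "bij_betw W (TPi \<tau> p k) (HN N)"
proof (rule bij_betw_imageI)
  show "inj_on W (TPi \<tau> p k)"
  proof (rule inj_onI, rule ext)
    fix x y R assume "W x = W y"
    then show "x R = y R" by - (rule W_inj[of "wt R"], simp_all)
  qed
  show "W ` TPi \<tau> p k = HN N"
  proof (intro antisym subsetI)
    fix h :: "'a series" assume "h \<in> HN N"
    then obtain x where "\<And>R. N < wt R \<Longrightarrow> x R = 0" "W x = h"
      by (rule W_surj) (rule that)
    then show "h \<in> W ` TPi \<tau> p k" by (auto simp: mem_TPi)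
  qed (auto simp: W_HN)
qed

section \<open>Existence and uniqueness of the truncated isomorphism\<close>

lemma is_Psi_exists: "\<exists>\<Psi>. is_Psi \<tau> p k \<Psi>"
proof -
  define \<Psi> where "\<Psi> = the_inv_into (TPi \<tau> p k) W"
  have inj: "inj_on W (TPi \<tau> p k)" and im: "W ` TPi \<tau> p k = HN N"
    using W_bij by (simp_all add: bij_betw_def)
  have \<Psi>W: "\<Psi> (W x) = x" if "x \<in> TPi \<tau> p k" for x
    using inj that by (simp add: \<Psi>_def the_inv_into_f_f)
  have W\<Psi>: "W (\<Psi> h) = h" "\<Psi> h \<in> TPi \<tau> p k" if "h \<in> HN N" for h
    using that \<Psi>W unfolding im[symmetric] by auto
  have "bij_betw \<Psi> (HN N) (TPi \<tau> p k)"
    unfolding \<Psi>_def by (rule bij_betw_the_inv_into[OF W_bij])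
  moreover have "\<Psi> (\<lambda>\<sigma>. a * g \<sigma> + b * h \<sigma>) = (\<lambda>R. a * \<Psi> g R + b * \<Psi> h R)"
    if "g \<in> HN N" "h \<in> HN N" for g h a b
  proof -
    have "\<Psi> (W (\<lambda>R. a * \<Psi> g R + b * \<Psi> h R)) = (\<lambda>R. a * \<Psi> g R + b * \<Psi> h R)"
      by (intro \<Psi>W TPi_linear W\<Psi> that)
    then show ?thesis by (simp add: W_linear[abs_def] W\<Psi> that)
  qed
  moreover have "\<Psi> (starN N g h) = concPi \<tau> p k (\<Psi> g) (\<Psi> h)" if "g \<in> HN N" "h \<in> HN N" for g h
    using \<Psi>W[of "concPi \<tau> p k (\<Psi> g) (\<Psi> h)"] that by (simp add: W_concPi W\<Psi>)
  moreover have "\<Psi> (rhoN N (sw R)) = truncPi \<tau> p k (basis R)" for R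
    using \<Psi>W[of "truncPi \<tau> p k (basis R)"] by (simp add: W_truncPi)
  ultimately have "is_Psi \<tau> p k \<Psi>"
    by (simp add: is_Psi_def Let_def)
  then show ?thesis by (rule exI[of _ \<Psi>])
qed

text \<open>Linearity and the values on star words determine the map, because the truncated word
  algebra is spanned by finitely many words. Thus any map with \<open>is_Psi\<close> is the inverse
  of \<open>W\<close>.\<close>

lemma is_Psi_inverse:
  assumes "is_Psi \<tau> p k \<Psi>" "x \<in> TPi \<tau> p k"
  shows "\<Psi> (W x) = x"
proof -
  note Psi = assms(1)[unfolded is_Psi_def Let_def]
  have lin: "\<Psi> (\<lambda>\<sigma>. a * g \<sigma> + b * h \<sigma>) = (\<lambda>R. a * \<Psi> g R + b * \<Psi> h R)"
    if "g \<in> HN N" "h \<in> HN N" for g h a b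
    using Psi that by blast
  have basis: "\<Psi> (sw R) = basis R" "sw R \<in> HN N" if "wt R \<le> N" for R
  proof -
    have R: "basis R \<in> TPi \<tau> p k"
      using that by (auto simp: mem_TPi basis_def)
    then show "sw R \<in> HN N" using W_HN by fastforce
    have "rhoN N (sw R) = sw R"
      using W_truncPi[of "basis R"] R by simp
    then show "\<Psi> (sw R) = basis R"
      using Psi letters_if_wt_le_N[OF that] R by (metis truncPi_id)
  qed
  have sum: "(\<lambda>\<sigma>. \<Sum>R\<in>F. x R * sw R \<sigma>) \<in> HN N \<and>
      \<Psi> (\<lambda>\<sigma>. \<Sum>R\<in>F. x R * sw R \<sigma>) = (\<lambda>S. \<Sum>R\<in>F. x R * basis R S)"
    if "finite F" "F \<subseteq> {R. wt R \<le> N}" for F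
    using that
  proof (induction F)
    case empty
    have "(\<lambda>_. 0 :: real) \<in> (HN N :: 'a series set)" by (simp add: HN_def)
    then show ?case using lin[of "\<lambda>_. 0" "\<lambda>_. 0" 0 0] by simp
  next
    case (insert R F)
    then have IH: "(\<lambda>\<sigma>. \<Sum>R\<in>F. x R * sw R \<sigma>) \<in> HN N"
      "\<Psi> (\<lambda>\<sigma>. \<Sum>R\<in>F. x R * sw R \<sigma>) = (\<lambda>S. \<Sum>R\<in>F. x R * basis R S)" by auto
    have R: "wt R \<le> N" using insert.prems by auto
    show ?case
      using lin[OF basis(2)[OF R] IH(1), of "x R" 1] basis(2)[OF R] IH insert.hyps
      by (simp add: basis(1)[OF R] HN_def)
  qed
  let ?A = "{R. wt R \<le> N}"
  have "W x = (\<lambda>\<sigma>. \<Sum>R\<in>?A. x R * sw R \<sigma>)"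
    using assms(2) by (intro ext W_eq_sum) (simp add: finite_words, metis mem_Collect_eq mem_TPi not_less)
  then have "\<Psi> (W x) = (\<lambda>S. \<Sum>R\<in>?A. x R * basis R S)"
    using sum[of ?A] by (simp only: finite_words subset_refl simp_thms)
  also have "\<dots> = x"
  proof
    fix S
    show "(\<Sum>R\<in>?A. x R * basis R S) = x S"
      using assms(2) finite_words[of N]
      by (cases "wt S \<le> N")
        (auto simp: mem_TPi basis_def if_distrib[of "\<lambda>t. _ * t"] eq_commute[of S] cong: if_cong)
  qed
  finally show ?thesis .
qed

lemma is_Psi_HN:
  assumes "is_Psi \<tau> p k \<Psi>" "h \<in> HN N"
  shows "\<Psi> h \<in> TPi \<tau> p k" "W (\<Psi> h) = h"
proof -
  obtain x where "x \<in> TPi \<tau> p k" "h = W x"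
    using W_bij assms(2) by (metis bij_betw_imp_surj_on imageE)
  then show "\<Psi> h \<in> TPi \<tau> p k" "W (\<Psi> h) = h"
    using is_Psi_inverse[OF assms(1)] by simp_all
qed

end

section \<open>Truncated characters and primitive elements\<close>

definition character_upto :: "nat \<Rightarrow> 'a series \<Rightarrow> bool" where
  "character_upto n h \<longleftrightarrow> h {#} = 1 \<and> (\<forall>a b. fnodes (a + b) \<le> n \<longrightarrow> h (a + b) = h a * h b)"

text \<open>Primitivity for \<open>delta\<close> read on coefficients: within \<open>n\<close> nodes
  the series is supported on single trees.\<close>

definition primitive_upto :: "nat \<Rightarrow> 'a series \<Rightarrow> bool" where
  "primitive_upto n g \<longleftrightarrow> g {#} = 0 \<and>
     (\<forall>a b. a \<noteq> {#} \<longrightarrow> b \<noteq> {#} \<longrightarrow> fnodes (a + b) \<le> n \<longrightarrow> g (a + b) = 0)"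

lemma primitive_uptoD:
  "primitive_upto n g \<Longrightarrow> fnodes (a + b) \<le> n \<Longrightarrow> g (a + b) = g a * basis {#} b + basis {#} a * g b"
  by (cases "a = {#}"; cases "b = {#}") (auto simp: primitive_upto_def basis_def)

text \<open>A truncated character is determined by its values on trees, and extends to a character by \<open>0\<close>
  on the trees beyond the truncation.\<close>

lemma GN_iff: "h \<in> GN n \<longleftrightarrow> h \<in> HN n \<and> character_upto n h"
proof
  assume "h \<in> GN n"
  then obtain g where h: "h = rhoN n g" and mult: "\<And>a b. g (a + b) = g a * g b" and "g \<noteq> (\<lambda>_. 0)"
    by (auto simp: GN_def butcher_group_iff)
  then have "g {#} \<noteq> 0" using mult[of _ "{#}"] by (metis add.right_neutral ext mult_zero_right)
  with mult[of "{#}" "{#}"] have "g {#} = 1" by simp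
  with h mult show "h \<in> HN n \<and> character_upto n h"
    by (simp add: HN_def rhoN_def character_upto_def)
next
  assume h: "h \<in> HN n \<and> character_upto n h"
  define g where "g = (\<lambda>\<sigma>. \<Prod>t\<in>#\<sigma>. h {#t#})"
  have "g {#} = 1" by (simp add: g_def)
  then have "g \<in> butcher_group"
    unfolding butcher_group_iff by (metis (no_types, lifting) g_def image_mset_union prod_mset_Un zero_neq_one)
  moreover have "g \<sigma> = h \<sigma>" if "fnodes \<sigma> \<le> n" for \<sigma>
    using that
  proof (induction \<sigma>)
    case empty
    then show ?case using h by (simp add: g_def character_upto_def)
  next
    case (add t \<sigma>)
    then have "h ({#t#} + \<sigma>) = h {#t#} * h \<sigma>"
      using h unfolding character_upto_def by (metis add_mset_add_single union_commute)
    then show ?case using add by (simp add: g_def)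
  qed
  then have "h = rhoN n g"
    using h by (auto simp: HN_def rhoN_def)
  ultimately show "h \<in> GN n" by (auto simp: GN_def)
qed

context free_gens
begin

text \<open>Left multiplication by a primitive element is a derivation for the coproduct: this is
  the bialgebra law with \<open>delta g\<close> equal to g \<otimes> 1 + 1 \<otimes> g. The
  decomposition of \<open>h\<close> is left general to cover both primitive elements and divided
  powers.\<close>

lemma star_primitive:
  fixes g h :: "'a series"
  assumes g: "primitive_upto n g"
    and h: "\<And>a b. fnodes (a + b) \<le> n \<Longrightarrow> h (a + b) = (\<Sum>j\<in>J. \<gamma> j a * \<eta> j b)"
    and "fnodes (a + b) \<le> n"
  shows "star g h (a + b) = (\<Sum>j\<in>J. star g (\<gamma> j) a * \<eta> j b + \<gamma> j a * star g (\<eta> j) b)"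
proof -
  have "star g h (a + b) = (\<Sum>i\<in>UNIV. \<Sum>j\<in>J.
      star (case_bool g one_H i) (\<gamma> j) a * star (case_bool one_H g i) (\<eta> j) b)"
    by (rule star_split_coproduct[where N = n])
      (simp_all add: UNIV_bool primitive_uptoD[OF g] h assms(3) del: fnodes_union)
  then show ?thesis by (simp add: UNIV_bool sum.distrib add.commute)
qed

text \<open>The mixed terms g \<otimes> h + h \<otimes> g in the coproduct of
  \<open>star g h\<close> are symmetric in the factors, so they cancel in the commutator.\<close>

lemma primitive_upto_commutator:
  fixes g h :: "'a series"
  assumes g: "primitive_upto n g" and h: "primitive_upto n h"
  shows "primitive_upto n (\<lambda>\<sigma>. star g h \<sigma> - star h g \<sigma>)"
proof -
  have split: "star g h (a + b) = star g h a * one_H b + h a * g b + g a * h b + one_H a * star g h b"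
    if "primitive_upto n g" "primitive_upto n h" "fnodes (a + b) \<le> n" for g h :: "'a series" and a b
  proof -
    have "star g h (a + b) = (\<Sum>j\<in>UNIV. star g (case_bool h one_H j) a * case_bool one_H h j b
        + case_bool h one_H j a * star g (case_bool one_H h j) b)"
      by (rule star_primitive[OF that(1) _ that(3)])
        (simp add: UNIV_bool primitive_uptoD[OF that(2)] del: fnodes_union)
    then show ?thesis by (simp add: UNIV_bool)
  qed
  have "star g h {#} = 0" "star h g {#} = 0"
    using split[OF g h, of "{#}" "{#}"] split[OF h g, of "{#}" "{#}"] g h
    by (simp_all add: primitive_upto_def)
  then show ?thesis
    using split[OF g h] split[OF h g] by (simp add: primitive_upto_def basis_def)
qed

end

section \<open>Exponentials of Lie elements\<close>

context Pi_setting
begin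

lemma pow_Pi_0 [simp]: "pow_Pi \<tau> p k L 0 = basis []"
  by (simp add: pow_Pi_def)

lemma pow_Pi_Suc [simp]: "pow_Pi \<tau> p k L (Suc n) = concPi \<tau> p k L (pow_Pi \<tau> p k L n)"
  by (simp add: pow_Pi_def)

lemma pow_Pi_TPi [simp]: "pow_Pi \<tau> p k L n \<in> TPi \<tau> p k"
  by (cases n) simp_all

text \<open>Without a constant term every factor \<open>L\<close> uses at least one node. Hence
  \<open>L\<close> is nilpotent in the truncated algebra, \<open>exp_Pi\<close> is a finite sum, and
  the n-th power is invisible on forests with fewer than n nodes.\<close>

lemma pow_Pi_support:
  assumes "L [] = 0" "pow_Pi \<tau> p k L n R \<noteq> 0"
  shows "n \<le> wt R"
  using assms(2)
proof (induction n arbitrary: R)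
  case (Suc n)
  then have "conc L (pow_Pi \<tau> p k L n) R \<noteq> 0"
    by (auto simp: concPi_def truncPi_def split: if_splits)
  then obtain Q Q' where "R = Q @ Q'" "L Q \<noteq> 0" "pow_Pi \<tau> p k L n Q' \<noteq> 0"
    by (rule conc_support)
  moreover from this have "1 \<le> wt Q" using assms(1) wt_eq_0_iff[of Q] by (cases "wt Q") auto
  ultimately show ?case using Suc.IH[of Q'] by simp
qed simp

lemma pow_Pi_eq_0:
  assumes "L [] = 0" "N < n"
  shows "pow_Pi \<tau> p k L n R = 0"
proof (rule ccontr)
  assume nz: "pow_Pi \<tau> p k L n R \<noteq> 0"
  then have "n \<le> wt R" by (rule pow_Pi_support[of L, OF assms(1)])
  moreover have "wt R \<le> N" using nz pow_Pi_TPi[of L n] unfolding mem_TPi by (meson not_less)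
  ultimately show False using assms(2) by simp
qed

lemma exp_Pi_eq_sum:
  assumes "L [] = 0"
  shows "exp_Pi \<tau> p k L R = (\<Sum>n\<le>N. 1 / fact n * pow_Pi \<tau> p k L n R)"
  unfolding exp_Pi_def
  by (subst suminf_finite[of "{..N}"]) (auto simp: pow_Pi_eq_0[of L, OF assms])

lemma exp_Pi_TPi:
  assumes "L [] = 0"
  shows "exp_Pi \<tau> p k L \<in> TPi \<tau> p k"
  using pow_Pi_TPi[of L] unfolding mem_TPi exp_Pi_eq_sum[of L, OF assms] by simp

lemma W_exp_Pi:
  assumes "L [] = 0"
  shows "W (exp_Pi \<tau> p k L) \<sigma> = (\<Sum>n\<le>N. W (pow_Pi \<tau> p k L n) \<sigma> / fact n)"
  using W_sum[of "\<lambda>n. 1 / fact n" "pow_Pi \<tau> p k L" "{..N}" \<sigma>]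
  by (simp add: exp_Pi_eq_sum[of L, OF assms, abs_def])

text \<open>The divided powers of a primitive element form a divided power sequence. In the
  induction, multiplication by \<open>L\<close> turns the n-th divided power into n + 1 times the
  next one and acts as a derivation on the coproduct.\<close>

lemma W_pow_Pi_coproduct:
  assumes prim: "primitive_upto N (W L)" and "fnodes (a + b) \<le> N"
  shows "W (pow_Pi \<tau> p k L n) (a + b) / fact n =
    (\<Sum>i\<le>n. W (pow_Pi \<tau> p k L i) a / fact i * (W (pow_Pi \<tau> p k L (n - i)) b / fact (n - i)))"
  using assms(2)
proof (induction n arbitrary: a b)
  case 0
  show ?case by simp (auto simp: basis_def)
next
  case (Suc n)
  define e where "e = (\<lambda>n \<sigma>. W (pow_Pi \<tau> p k L n) \<sigma> / fact n)"
  have star_e: "star (W L) (e n) \<sigma> = real (Suc n) * e (Suc n) \<sigma>" if "fnodes \<sigma> \<le> N" for n \<sigma>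
  proof -
    have "star (W L) (e n) \<sigma> = star (W L) (W (pow_Pi \<tau> p k L n)) \<sigma> / fact n"
      using star_sum_right[of "W L" "\<lambda>_. 1 / fact n" "\<lambda>_. W (pow_Pi \<tau> p k L n)" "{()}" \<sigma>]
      by (simp add: e_def)
    also have "\<dots> = real (Suc n) * (star (W L) (W (pow_Pi \<tau> p k L n)) \<sigma> / fact (Suc n))"
      by (simp only: fact_Suc of_nat_mult) (simp add: field_simps del: of_nat_Suc)
    finally show ?thesis
      using that by (simp add: e_def W_concPi starN_def rhoN_def del: fact_Suc)
  qed
  have a: "fnodes a \<le> N" and b: "fnodes b \<le> N" using Suc.prems by auto
  have "real (Suc n) * e (Suc n) (a + b) = star (W L) (e n) (a + b)"
    using star_e[OF Suc.prems] by simp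
  also have "\<dots> = (\<Sum>i\<le>n. star (W L) (e i) a * e (n - i) b + e i a * star (W L) (e (n - i)) b)"
    by (rule star_primitive[OF prim _ Suc.prems]) (use Suc.IH in \<open>simp add: e_def\<close>)
  also have "\<dots> = (\<Sum>i\<le>n. real (Suc i) * e (Suc i) a * e (n - i) b)
      + (\<Sum>i\<le>n. real (Suc n - i) * e i a * e (Suc n - i) b)"
    unfolding sum.distrib[symmetric]
    by (intro sum.cong refl) (simp add: star_e a b Suc_diff_le algebra_simps)
  also have "(\<Sum>i\<le>n. real (Suc i) * e (Suc i) a * e (n - i) b) =
      (\<Sum>i\<le>Suc n. real i * e i a * e (Suc n - i) b)"
    by (simp only: sum.atMost_Suc_shift) simp
  also have "(\<Sum>i\<le>n. real (Suc n - i) * e i a * e (Suc n - i) b) =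
      (\<Sum>i\<le>Suc n. real (Suc n - i) * e i a * e (Suc n - i) b)"
    by simp
  \<comment> \<open>After the index shift both sums run over the same range: the terms added at the
    ends have coefficient 0, and the coefficients \<open>i\<close> and \<open>Suc n - i\<close> add
    up to \<open>Suc n\<close>.\<close>
  also have "(\<Sum>i\<le>Suc n. real i * e i a * e (Suc n - i) b) + \<dots> =
      (\<Sum>i\<le>Suc n. real (Suc n) * (e i a * e (Suc n - i) b))"
    unfolding sum.distrib[symmetric] by (intro sum.cong refl) (simp add: of_nat_diff algebra_simps)
  also have "\<dots> = real (Suc n) * (\<Sum>i\<le>Suc n. e i a * e (Suc n - i) b)"
    by (rule sum_distrib_left[symmetric])
  finally have "e (Suc n) (a + b) = (\<Sum>i\<le>Suc n. e i a * e (Suc n - i) b)"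
    by (simp only: mult_cancel_left of_nat_eq_0_iff) simp
  then show ?case by (simp only: e_def)
qed

lemma character_exp_Pi:
  assumes L: "L \<in> TPi \<tau> p k" and prim: "primitive_upto N (W L)"
  shows "character_upto N (W (exp_Pi \<tau> p k L))"
proof -
  have L0: "L [] = 0" using prim by (simp add: primitive_upto_def)
  define e where "e = (\<lambda>n \<sigma>. W (pow_Pi \<tau> p k L n) \<sigma> / fact n)"
  have e0: "e n \<sigma> = 0" if "fnodes \<sigma> < n" for n \<sigma>
  proof -
    have "W (pow_Pi \<tau> p k L n) \<sigma> = W (\<lambda>_. 0) \<sigma>"
      using pow_Pi_support[of L, OF L0] that by (intro W_cong) (metis linorder_not_less)
    then show ?thesis by (simp add: e_def)
  qed
  have exp: "W (exp_Pi \<tau> p k L) \<sigma> = (\<Sum>n\<le>N. e n \<sigma>)" for \<sigma>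
    by (simp add: W_exp_Pi[of L, OF L0] e_def)
  have "W (exp_Pi \<tau> p k L) {#} = 1"
  proof -
    have "(\<Sum>n\<le>N. e n {#}) = (\<Sum>n\<in>{0}. e n {#})"
      by (rule sum.mono_neutral_right) (auto simp: e0)
    then show ?thesis unfolding exp by (simp add: e_def)
  qed
  moreover have "W (exp_Pi \<tau> p k L) (a + b) = W (exp_Pi \<tau> p k L) a * W (exp_Pi \<tau> p k L) b"
    if "fnodes (a + b) \<le> N" for a b
  proof -
    have "(\<Sum>n\<le>N. e n (a + b)) = (\<Sum>n\<le>N. \<Sum>i\<le>n. e i a * e (n - i) b)"
      using W_pow_Pi_coproduct[OF prim that] by (simp add: e_def)
    also have "\<dots> = (\<Sum>(i, j)\<in>{(i, j). i + j \<le> N}. e i a * e j b)"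
      by (rule sum.triangle_reindex_eq[symmetric])
    \<comment> \<open>Passing from the triangle to the square adds only zeros: if i + j exceeds
      \<open>N\<close>, then i exceeds the size of \<open>a\<close> or j that of
      \<open>b\<close>.\<close>
    also have "\<dots> = (\<Sum>(i, j)\<in>{..N} \<times> {..N}. e i a * e j b)"
    proof (rule sum.mono_neutral_left)
      show "\<forall>x\<in>{..N} \<times> {..N} - {(i, j). i + j \<le> N}. (case x of (i, j) \<Rightarrow> e i a * e j b) = 0"
      proof
        fix z assume "z \<in> {..N} \<times> {..N} - {(i, j). i + j \<le> N}"
        then obtain i j where z: "z = (i, j)" "N < i + j" by (cases z) auto
        with that have "fnodes a < i \<or> fnodes b < j" by auto
        then show "(case z of (i, j) \<Rightarrow> e i a * e j b) = 0" by (auto simp: e0 z)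
      qed
    qed auto
    also have "\<dots> = (\<Sum>i\<le>N. e i a) * (\<Sum>j\<le>N. e j b)"
      by (simp add: sum_product sum.cartesian_product)
    finally show ?thesis unfolding exp .
  qed
  ultimately show ?thesis by (simp add: character_upto_def)
qed

text \<open>A letter is mapped to a single tree, which is never the union of two nonempty forests;
  linear combinations and commutators preserve primitivity.\<close>

lemma lie_Pi_primitive:
  "L \<in> lie_Pi \<tau> p k \<Longrightarrow> L \<in> TPi \<tau> p k \<and> primitive_upto N (W L)"
proof (induction rule: lie_Pi.induct)
  case (gen x)
  have "W (embed_Bk \<tau> p k x) (a + b) = 0" if "a \<noteq> {#}" "b \<noteq> {#}" for a b
  proof -
    have "embed_Bk \<tau> p k x R * sw R (a + b) = 0" for R
    proof (cases "\<exists>r. R = [r]")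
      case True
      then obtain r where "R = [r]" ..
      moreover have "a + b \<noteq> {#\<tau> r#}" using that by (auto simp: union_is_single)
      ultimately show ?thesis by (simp add: star_word_Cons) (simp add: basis_def)
    next
      case False
      then have "elem_tensor [x] R = 0" by (auto simp: elem_tensor_single split: list.splits)
      then show ?thesis by (simp add: embed_Bk_def truncPi_def)
    qed
    then have "(\<lambda>R. embed_Bk \<tau> p k x R * sw R (a + b)) = (\<lambda>_. 0)" ..
    then show ?thesis unfolding word_to_H_def by (simp only: Sum_any.neutral)
  qed
  then show ?case
    by (simp add: embed_Bk_def primitive_upto_def) (simp add: truncPi_def elem_tensor_single)
next
  case (lin u v a b)
  then show ?case
    by (simp add: TPi_linear primitive_upto_def W_linear)
next
  case (bracket u v)
  have "(\<lambda>R. concPi \<tau> p k u v R - concPi \<tau> p k v u R) \<in> TPi \<tau> p k"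
    using concPi_TPi[of u v] concPi_TPi[of v u] unfolding mem_TPi by simp
  \<comment> \<open>The commutator is taken in the untruncated product. Truncation changes nothing
    within \<open>N\<close> nodes, which is all that \<open>primitive_upto N\<close> sees.\<close>
  moreover have "primitive_upto N (\<lambda>\<sigma>. star (W u) (W v) \<sigma> - star (W v) (W u) \<sigma>)"
    using bracket.IH by (intro primitive_upto_commutator) auto
  then have "primitive_upto N (W (\<lambda>R. concPi \<tau> p k u v R - concPi \<tau> p k v u R))"
    by (simp add: W_diff W_concPi starN_def rhoN_def primitive_upto_def)
  ultimately show ?case by simp
qed

section \<open>From primitive elements to Lie elements and logarithms\<close>

lemma zero_lie_Pi: "(\<lambda>_. 0) \<in> lie_Pi \<tau> p k"
proof -
  have "(\<lambda>_. 0) \<in> Bk k" by (simp add: Bk_def)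
  from lie_Pi.lin[OF lie_Pi.gen[OF this, of \<tau> p] lie_Pi.gen[OF this], of 0 0] show ?thesis by simp
qed

lemma sum_lie_Pi:
  assumes "finite F" "\<And>i. i \<in> F \<Longrightarrow> f i \<in> lie_Pi \<tau> p k"
  shows "(\<lambda>S. \<Sum>i\<in>F. c i * f i S) \<in> lie_Pi \<tau> p k"
  using assms
proof (induction F)
  case (insert i F)
  then have "(\<lambda>S. \<Sum>i\<in>F. c i * f i S) \<in> lie_Pi \<tau> p k" "f i \<in> lie_Pi \<tau> p k" by auto
  from lie_Pi.lin[OF this(2,1), of "c i" 1] show ?case using insert.hyps by simp
qed (simp add: zero_lie_Pi)

text \<open>The operator produces iterated commutators of letters. They may be taken in the
  truncated algebra, since bracketing keeps the weight of the word, here at most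
  \<open>N\<close>.\<close>

lemma dynkin_lie_Pi:
  assumes "wt R \<le> N" "R \<noteq> []"
  shows "dynkin R \<in> lie_Pi \<tau> p k"
  using assms
proof (induction R)
  case (Cons r R)
  have letter: "basis [r] \<in> lie_Pi \<tau> p k"
  proof -
    have r: "r < k" using letters_if_wt_le_N[OF Cons.prems(1)] by simp
    then have "basis r \<in> Bk k" by (auto simp: Bk_def basis_def)
    moreover have "embed_Bk \<tau> p k (basis r) = basis [r]"
      unfolding embed_Bk_def truncPi_eq_cut
      using Cons.prems(1) by (auto simp: cut_def elem_tensor_single basis_def split: list.splits)
    ultimately show ?thesis using lie_Pi.gen[of "basis r" k \<tau> p] by simp
  qed
  show ?case
  proof (cases "R = []")
    case False
    have "dynkin (r # R) S =
        concPi \<tau> p k (basis [r]) (dynkin R) S - concPi \<tau> p k (dynkin R) (basis [r]) S" for S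
    proof (cases "wt S \<le> N")
      case True
      then show ?thesis using False by (simp add: concPi_apply)
    next
      case S: False
      have "dynkin (r # R) S = 0"
        using dynkin_support[of "r # R" S] wt_mset[of S "r # R"] S Cons.prems(1) by force
      moreover have "concPi \<tau> p k u v S = 0" for u v
        using S by (simp add: concPi_def truncPi_def A1_eq)
      ultimately show ?thesis by simp
    qed
    then have "dynkin (r # R) =
        (\<lambda>S. concPi \<tau> p k (basis [r]) (dynkin R) S - concPi \<tau> p k (dynkin R) (basis [r]) S)" ..
    moreover have "dynkin R \<in> lie_Pi \<tau> p k" using Cons False by simp
    ultimately show ?thesis using lie_Pi.bracket[OF letter] by simp
  qed (use letter dynkin_single in simp)
qed simp

text \<open>Dividing the Dynkin identity by the length writes \<open>D\<close> as an explicit finite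
  combination of the Lie elements \<open>dynkin R\<close>. Primitivity is required on all forests
  here, not only up to \<open>N\<close> nodes.\<close>

lemma primitive_lie_Pi:
  assumes D: "D \<in> TPi \<tau> p k"
    and prim: "\<And>a b. W D (a + b) = W D a * one_H b + one_H a * W D b"
  shows "D \<in> lie_Pi \<tau> p k"
proof -
  have D0: "D [] = 0" using prim[of "{#}" "{#}"] by simp
  let ?A = "{R. wt R \<le> N}"
  have "D S = (\<Sum>R\<in>?A - {[]}. D R / real (length R) * dynkin R S)" for S
  proof (cases "S = []")
    case True
    then have "dynkin R S = 0" if "R \<noteq> []" for R
      using dynkin_support[of R S] that by force
    then show ?thesis using D0 True by simp
  next
    case False
    have "real (length S) * D S = (\<Sum>R\<in>?A. D R * dynkin R S)"
      by (rule primitive_dynkin[OF _ prim]) (use D in \<open>simp add: mem_TPi\<close>)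
    also have "\<dots> = (\<Sum>R\<in>?A - {[]}. D R * dynkin R S)"
      by (rule sum.mono_neutral_right) (auto simp: finite_words)
    \<comment> \<open>Where \<open>dynkin R S\<close> is nonzero, \<open>R\<close> and
      \<open>S\<close> have the same length, so the length of \<open>S\<close> can be exchanged for
      that of \<open>R\<close> in each term.\<close>
    also have "\<dots> = (\<Sum>R\<in>?A - {[]}. real (length S) * (D R / real (length R) * dynkin R S))"
    proof (intro sum.cong refl)
      fix R assume "R \<in> ?A - {[]}"
      moreover have "length S = length R" if "dynkin R S \<noteq> 0"
        using dynkin_support[OF that] by (rule mset_eq_length)
      ultimately show "D R * dynkin R S = real (length S) * (D R / real (length R) * dynkin R S)"
        by (cases "dynkin R S = 0") auto
    qed
    finally have "real (length S) * D S =
        real (length S) * (\<Sum>R\<in>?A - {[]}. D R / real (length R) * dynkin R S)"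
      by (simp only: sum_distrib_left)
    then show ?thesis using False by simp
  qed
  then have "D = (\<lambda>S. \<Sum>R\<in>?A - {[]}. D R / real (length R) * dynkin R S)" ..
  moreover have "(\<lambda>S. \<Sum>R\<in>?A - {[]}. D R / real (length R) * dynkin R S) \<in> lie_Pi \<tau> p k"
    by (intro sum_lie_Pi) (auto simp: finite_words dynkin_lie_Pi)
  ultimately show ?thesis by simp
qed

text \<open>Up to weight \<open>Suc n\<close> a product containing \<open>D\<close> and another
  factor without constant term is already too heavy. So \<open>D\<close> enters only through the
  first power and is added without distortion.\<close>

lemma exp_Pi_add:
  assumes L: "L \<in> TPi \<tau> p k" "L [] = 0" and D: "D \<in> TPi \<tau> p k" "\<And>R. D R \<noteq> 0 \<Longrightarrow> wt R = Suc n"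
    and R: "wt R \<le> Suc n"
  shows "exp_Pi \<tau> p k (\<lambda>R. L R + D R) R = exp_Pi \<tau> p k L R + D R"
proof -
  have D0: "D [] = 0" using D(2)[of "[]"] by auto
  have pow: "pow_Pi \<tau> p k (\<lambda>R. L R + D R) m R = pow_Pi \<tau> p k L m R + (if m = 1 then D R else 0)"
    if "wt R \<le> Suc n" for m R
    using that
  proof (induction m arbitrary: R)
    case (Suc m)
    show ?case
    proof (cases "wt R \<le> N")
      case False
      then show ?thesis using D(1) by (simp add: concPi_def truncPi_def A1_eq mem_TPi)
    next
      case True
      have "conc (\<lambda>R. L R + D R) (pow_Pi \<tau> p k (\<lambda>R. L R + D R) m) R =
          conc (\<lambda>R. L R + D R) (\<lambda>R. 1 * pow_Pi \<tau> p k L m R + (if m = 1 then 1 else 0) * D R) R"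
        by (rule conc_cong) (use Suc in auto)
      also have "\<dots> = conc L (pow_Pi \<tau> p k L m) R + conc D (pow_Pi \<tau> p k L m) R
          + (if m = 1 then 1 else 0) * conc (\<lambda>R. L R + D R) D R"
        using conc_linear_right[of "\<lambda>R. L R + D R" 1 "pow_Pi \<tau> p k L m" "if m = 1 then 1 else 0" D R]
        by (simp add: conc_add_left)
      also have "conc (\<lambda>R. L R + D R) D R = 0"
      proof (rule ccontr)
        assume "conc (\<lambda>R. L R + D R) D R \<noteq> 0"
        then obtain Q Q' where "R = Q @ Q'" "L Q + D Q \<noteq> 0" "D Q' \<noteq> 0" by (rule conc_support)
        with D(2)[of Q'] Suc.prems L(2) D0 show False by auto
      qed
      also have "conc D (pow_Pi \<tau> p k L m) R = (if m = 0 then D R else 0)"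
      proof (cases "m = 0")
        case False
        have "conc D (pow_Pi \<tau> p k L m) R = 0"
        proof (rule ccontr)
          assume "conc D (pow_Pi \<tau> p k L m) R \<noteq> 0"
          then obtain Q Q' where "R = Q @ Q'" "D Q \<noteq> 0" "pow_Pi \<tau> p k L m Q' \<noteq> 0"
            by (rule conc_support)
          with D(2)[of Q] Suc.prems pow_Pi_support[of L m Q', OF L(2)] False show False by auto
        qed
        with False show ?thesis by simp
      qed simp
      finally show ?thesis using True by (simp add: concPi_apply)
    qed
  qed simp
  have "exp_Pi \<tau> p k (\<lambda>R. L R + D R) R = (\<Sum>m\<le>N. 1 / fact m * pow_Pi \<tau> p k (\<lambda>R. L R + D R) m R)"
    by (rule exp_Pi_eq_sum) (simp add: L(2) D0)
  also have "\<dots> = (\<Sum>m\<le>N. 1 / fact m * pow_Pi \<tau> p k L m R) + (\<Sum>m\<le>N. if m = 1 then D R else 0)"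
    unfolding sum.distrib[symmetric] by (intro sum.cong refl) (simp add: pow[OF R])
  also have "(\<Sum>m\<le>N. if m = 1 then D R else 0) = D R"
    using N_ge_1 by simp
  finally show ?thesis by (simp add: exp_Pi_eq_sum[of L, OF L(2)])
qed

text \<open>The logarithm is built degree by degree: the lowest-order difference of two characters is primitive.\<close>

lemma character_exp_lie_Pi:
  assumes x: "x \<in> TPi \<tau> p k" and char: "character_upto N (W x)"
  shows "x \<in> GPi \<tau> p k"
proof -
  have "\<exists>L\<in>lie_Pi \<tau> p k. \<forall>R. wt R \<le> n \<longrightarrow> exp_Pi \<tau> p k L R = x R" if "n \<le> N" for n
    using that
  proof (induction n)
    case 0
    have "exp_Pi \<tau> p k (\<lambda>_. 0) [] = (\<Sum>n\<in>{0}. 1 / fact n * pow_Pi \<tau> p k (\<lambda>_. 0) n [])"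
      unfolding exp_Pi_eq_sum[of "\<lambda>_. 0", OF refl]
      by (rule sum.mono_neutral_right) (use pow_Pi_support[of "\<lambda>_. 0" _ "[]"] in fastforce)+
    moreover have "x [] = 1" using char by (simp add: character_upto_def)
    ultimately show ?case using zero_lie_Pi by (intro bexI[of _ "\<lambda>_. 0"]) simp_all
  next
    case (Suc n)
    then obtain L where L: "L \<in> lie_Pi \<tau> p k" and E: "\<And>R. wt R \<le> n \<Longrightarrow> exp_Pi \<tau> p k L R = x R"
      by auto
    define e where "e = exp_Pi \<tau> p k L"
    \<comment> \<open>The defect of the current exponential in the first degree where it can differ
      from \<open>x\<close>; it becomes the correction to the logarithm.\<close>
    define D where "D = (\<lambda>R. if wt R = Suc n then x R - e R else 0)"
    from lie_Pi_primitive[OF L] have LT: "L \<in> TPi \<tau> p k" and prim: "primitive_upto N (W L)" by auto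
    then have L0: "L [] = 0" by (simp add: primitive_upto_def)
    have DT: "D \<in> TPi \<tau> p k" using Suc.prems by (simp add: mem_TPi D_def)
    have e: "character_upto N (W e)" unfolding e_def by (rule character_exp_Pi[OF LT prim])
    have low: "W e \<sigma> = W x \<sigma>" if "fnodes \<sigma> \<le> n" for \<sigma>
      using that E by (intro W_cong) (simp add: e_def)
    have WD: "W D \<sigma> = (if fnodes \<sigma> = Suc n then W x \<sigma> - W e \<sigma> else 0)" for \<sigma>
    proof (cases "fnodes \<sigma> = Suc n")
      case True
      then have "W D \<sigma> = W (\<lambda>R. x R - e R) \<sigma>" by (intro W_cong) (simp add: D_def)
      then show ?thesis using True by (simp add: W_diff)
    next
      case False
      then have "W D \<sigma> = W (\<lambda>_. 0) \<sigma>" by (intro W_cong) (simp add: D_def)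
      then show ?thesis using False by simp
    qed
    have "W D (a + b) = W D a * one_H b + one_H a * W D b" for a b
    proof (cases "a = {#} \<or> b = {#}")
      case True
      moreover have "W D {#} = 0" unfolding WD by simp
      ultimately show ?thesis by (auto simp: basis_def)
    next
      case False
      then have pos: "fnodes a > 0" "fnodes b > 0" by (simp_all del: fnodes_eq_0_iff flip: fnodes_eq_0_iff)
      \<comment> \<open>Both parts are nonempty, so in total degree \<open>Suc n\<close> each has
        degree at most \<open>n\<close>, where the two characters agree; hence their products agree
        too.\<close>
      have "W D (a + b) = 0"
      proof (cases "fnodes (a + b) = Suc n")
        case True
        then have "fnodes (a + b) \<le> N" using Suc.prems by simp
        then have "W x (a + b) = W x a * W x b" "W e (a + b) = W e a * W e b"
          using char e by (simp_all add: character_upto_def)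
        moreover have "W e a = W x a" "W e b = W x b"
          using True pos by (auto intro!: low)
        ultimately show ?thesis by (simp add: WD)
      qed (simp add: WD)
      then show ?thesis using False by (simp add: basis_def)
    qed
    then have DL: "D \<in> lie_Pi \<tau> p k" by (rule primitive_lie_Pi[OF DT])
    have "exp_Pi \<tau> p k (\<lambda>R. L R + D R) R = x R" if "wt R \<le> Suc n" for R
    proof -
      have "exp_Pi \<tau> p k (\<lambda>R. L R + D R) R = e R + D R"
        unfolding e_def by (rule exp_Pi_add[OF LT L0 DT _ that]) (simp add: D_def split: if_splits)
      then show ?thesis using that E[of R] by (auto simp: D_def e_def)
    qed
    moreover have "(\<lambda>R. L R + D R) \<in> lie_Pi \<tau> p k"
      using lie_Pi.lin[OF L DL, of 1 1] by simp
    ultimately show ?case by blast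
  qed
  then obtain L where L: "L \<in> lie_Pi \<tau> p k" and E: "\<And>R. wt R \<le> N \<Longrightarrow> exp_Pi \<tau> p k L R = x R"
    by blast
  have "exp_Pi \<tau> p k L \<in> TPi \<tau> p k"
    using lie_Pi_primitive[OF L] by (intro exp_Pi_TPi) (simp add: primitive_upto_def)
  then have "exp_Pi \<tau> p k L R = x R" for R
    using E[of R] x by (cases "wt R \<le> N") (simp_all add: mem_TPi)
  then have "x = exp_Pi \<tau> p k L" by (simp add: fun_eq_iff)
  with L show ?thesis by (auto simp: GPi_def)
qed

lemma GPi_iff: "x \<in> GPi \<tau> p k \<longleftrightarrow> x \<in> TPi \<tau> p k \<and> character_upto N (W x)"
proof
  assume "x \<in> GPi \<tau> p k"
  then obtain L where L: "L \<in> lie_Pi \<tau> p k" "x = exp_Pi \<tau> p k L" by (auto simp: GPi_def)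
  from lie_Pi_primitive[OF L(1)] have "L \<in> TPi \<tau> p k" "primitive_upto N (W L)" "L [] = 0"
    by (auto simp: primitive_upto_def)
  then show "x \<in> TPi \<tau> p k \<and> character_upto N (W x)"
    unfolding L(2) using exp_Pi_TPi character_exp_Pi by blast
qed (use character_exp_lie_Pi in blast)

lemma Psi_GN_iff:
  assumes "is_Psi \<tau> p k \<Psi>" "h \<in> HN N"
  shows "\<Psi> h \<in> GPi \<tau> p k \<longleftrightarrow> h \<in> GN N"
  using is_Psi_HN[OF assms] assms(2) by (simp add: GPi_iff GN_iff)

end

section \<open>Comparison of norms\<close>

lemma elem_tensor_Nil: "elem_tensor [] = basis []"
  by (auto simp: elem_tensor_def basis_def)

lemma elem_tensor_Cons_Nil [simp]: "elem_tensor (x # xs) [] = 0"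
  by (simp add: elem_tensor_def)

lemma elem_tensor_Cons_Cons [simp]: "elem_tensor (x # xs) (r # R) = x r * elem_tensor xs R"
  unfolding elem_tensor_def by (auto simp del: prod.lessThan_Suc simp add: prod.lessThan_Suc_shift)

lemma elem_tensor_map_basis: "elem_tensor (map basis R) = basis R"
proof
  show "elem_tensor (map basis R) S = basis R S" for S
  proof (induction R arbitrary: S)
    case (Cons r R)
    then show ?case by (cases S) (simp_all, simp add: basis_def)
  qed (simp add: elem_tensor_Nil)
qed

context free_gens
begin

text \<open>\<open>\<xi> \<sigma>\<close> is a preimage of the single forest
  \<open>\<sigma>\<close>. The inverse of \<open>W\<close> becomes a finite sum with fixed
  coefficients in each degree, which yields both norm bounds and continuity.\<close>

lemma W_inverse_coeffs:
  obtains \<xi> :: "'a forest \<Rightarrow> wseries"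
  where "\<And>x R. x R = (\<Sum>\<sigma> | fnodes \<sigma> = wt R. W x \<sigma> * \<xi> \<sigma> R)"
proof -
  have "\<exists>x. W x = basis \<sigma>" for \<sigma> :: "'a forest"
  proof -
    have "basis \<sigma> \<in> HN (fnodes \<sigma>)" by (auto simp: HN_def basis_def)
    then show ?thesis by (rule W_surj) blast
  qed
  then obtain \<xi> where \<xi>: "\<And>\<sigma>. W (\<xi> \<sigma>) = basis \<sigma>" by metis
  have "x R = (\<Sum>\<sigma> | fnodes \<sigma> = wt R. W x \<sigma> * \<xi> \<sigma> R)" for x R
  proof (rule W_inj[where n = "wt R" and y = "\<lambda>S. \<Sum>\<sigma> | fnodes \<sigma> = wt R. W x \<sigma> * \<xi> \<sigma> S"])
    fix \<sigma> :: "'a forest" assume \<sigma>: "fnodes \<sigma> = wt R"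
    have "W (\<lambda>S. \<Sum>\<sigma> | fnodes \<sigma> = wt R. W x \<sigma> * \<xi> \<sigma> S) \<sigma> =
        (\<Sum>\<sigma>' | fnodes \<sigma>' = wt R. W x \<sigma>' * basis \<sigma>' \<sigma>)"
      by (simp add: W_sum \<xi>)
    also have "\<dots> = W x \<sigma>"
      using \<sigma> finite_forests_eq[of "wt R", where 'a = 'a]
      by (simp add: basis_def if_distrib[of "\<lambda>t. _ * t"] cong: if_cong)
    finally show "W x \<sigma> = W (\<lambda>S. \<Sum>\<sigma> | fnodes \<sigma> = wt R. W x \<sigma> * \<xi> \<sigma> S) \<sigma>" ..
  qed simp
  then show thesis by (rule that)
qed

lemma hnorm_level: "hnorm n (level n h) = L2_set h {\<sigma>. fnodes \<sigma> = n}" for h :: "'a series"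
proof -
  have "(\<Sum>\<sigma> | fnodes \<sigma> \<le> n. (level n h \<sigma>)\<^sup>2) = (\<Sum>\<sigma> | fnodes \<sigma> = n. (h \<sigma>)\<^sup>2)"
    by (intro sum.mono_neutral_cong_right) (auto simp: finite_forests level_def)
  then show ?thesis by (simp add: hnorm_def L2_set_def)
qed

end

locale Pi_norm_setting = Pi_setting +
  fixes \<nu> :: "(nat \<Rightarrow> real) \<Rightarrow> real"
  assumes norm_Bk: "is_norm_on (Bk k) \<nu>"
begin

text \<open>Each summand of \<open>Bk k\<close> is a line, so the projective norm on a tensor
  product of them is the absolute value of the single coefficient times this constant.\<close>

definition word_norm :: "nat list \<Rightarrow> real" where
  "word_norm R = (\<Prod>r\<leftarrow>R. \<nu> (basis r))"

text \<open>The restriction on letters is automatic for \<open>n\<close> up to \<lfloor>p\<rfloor>;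
  it matters in the higher degrees seen by extensions.\<close>

definition words :: "nat \<Rightarrow> nat list set" where
  "words n = {R. wt R = n \<and> set R \<subseteq> {..<k}}"

lemma finite_words_n: "finite (words n)"
  unfolding words_def by (rule finite_subset[OF _ finite_words_eq[of n]]) auto

lemma norm_basis_pos:
  assumes "r < k"
  shows "0 < \<nu> (basis r)"
proof -
  have "basis r \<in> Bk k" using assms by (auto simp: Bk_def basis_def)
  moreover have "basis r \<noteq> (\<lambda>_. 0 :: real)" by (metis basis_self zero_neq_one)
  ultimately show ?thesis using norm_Bk unfolding is_norm_on_def by (metis order_le_less)
qed

lemma norm_Bline:
  assumes "r < k" "x \<in> Bline r"
  shows "\<nu> x = \<bar>x r\<bar> * \<nu> (basis r)"
proof -
  have "basis r \<in> Bk k" using assms by (auto simp: Bk_def basis_def)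
  then have "\<nu> (\<lambda>i. x r * basis r i) = \<bar>x r\<bar> * \<nu> (basis r)"
    using norm_Bk unfolding is_norm_on_def by blast
  moreover have "(\<lambda>i. x r * basis r i) = x"
    using assms(2) by (auto simp: Bline_def basis_def)
  ultimately show ?thesis by simp
qed

lemma word_norm_pos: "set R \<subseteq> {..<k} \<Longrightarrow> 0 < word_norm R"
  by (induction R) (simp_all add: word_norm_def norm_basis_pos)

lemma prod_norm_elem_tensor:
  assumes "list_all2 (\<lambda>x r. x \<in> Bline r) xs R" "set R \<subseteq> {..<k}"
  shows "(\<Prod>x\<leftarrow>xs. \<nu> x) = \<bar>elem_tensor xs R\<bar> * word_norm R"
  using assms
proof (induction rule: list_all2_induct)
  case Nil
  then show ?case by (simp add: elem_tensor_Nil word_norm_def)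
next
  case (Cons x xs r R)
  then show ?case by (simp add: word_norm_def norm_Bline abs_mult)
qed

text \<open>Every elementary tensor of the given type has product of norms equal to its absolute
  coefficient times \<open>word_norm R\<close>. The triangle inequality gives the lower bound, and a
  single tensor attains it.\<close>

lemma proj_norm_piR:
  assumes R: "R \<noteq> []" "set R \<subseteq> {..<k}"
  shows "proj_norm \<nu> R (piR R v) = \<bar>v R\<bar> * word_norm R"
  unfolding proj_norm_def
proof (rule cInf_eq_minimum, goal_cases)
  case 1
  obtain r R' where RR: "R = r # R'" using R by (cases R) auto
  \<comment> \<open>The first factor carries the whole coefficient, which is possible because the
    word is nonempty.\<close>
  define xs where "xs = (\<lambda>i. v R * basis r i) # map basis R'"
  have Bl: "list_all2 (\<lambda>x r. x \<in> Bline r) xs R"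
    unfolding xs_def RR by (auto simp: Bline_def basis_def list_all2_map1 intro: list_all2_refl)
  have tensor: "elem_tensor xs = piR R v"
  proof
    show "elem_tensor xs w = piR R v w" for w
      by (cases w) (auto simp: xs_def RR piR_def elem_tensor_map_basis basis_def)
  qed
  have "\<bar>v R\<bar> * word_norm R = (\<Sum>xs\<leftarrow>[xs]. \<Prod>x\<leftarrow>xs. \<nu> x)"
    using prod_norm_elem_tensor[OF Bl R(2)] by (simp add: tensor piR_def)
  moreover have "piR R v = (\<lambda>w. \<Sum>xs\<leftarrow>[xs]. elem_tensor xs w)"
    by (simp add: tensor)
  ultimately show ?case using Bl by (intro CollectI exI[of _ "[xs]"]) simp
next
  case (2 c)
  then obtain xss where c: "c = (\<Sum>xs\<leftarrow>xss. \<Prod>x\<leftarrow>xs. \<nu> x)"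
    and Bl: "\<And>xs. xs \<in> set xss \<Longrightarrow> list_all2 (\<lambda>x r. x \<in> Bline r) xs R"
    and v: "piR R v = (\<lambda>w. \<Sum>xs\<leftarrow>xss. elem_tensor xs w)" by auto
  have "v R = (\<Sum>xs\<leftarrow>xss. elem_tensor xs R)"
    using fun_cong[OF v, of R] by (simp add: piR_def)
  then have "\<bar>v R\<bar> \<le> (\<Sum>xs\<leftarrow>xss. \<bar>elem_tensor xs R\<bar>)"
    using sum_list_abs[of "map (\<lambda>xs. elem_tensor xs R) xss"] by (simp add: o_def)
  then have "\<bar>v R\<bar> * word_norm R \<le> (\<Sum>xs\<leftarrow>xss. \<bar>elem_tensor xs R\<bar>) * word_norm R"
    using word_norm_pos[OF R(2)] by (intro mult_right_mono) auto
  also have "\<dots> = (\<Sum>xs\<leftarrow>xss. \<bar>elem_tensor xs R\<bar> * word_norm R)"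
    by (simp add: sum_list_mult_const)
  also have "\<dots> = c"
    unfolding c by (intro arg_cong[of _ _ sum_list] map_cong refl)
      (simp add: prod_norm_elem_tensor[OF Bl R(2)])
  finally show ?case .
qed

text \<open>In one degree \<open>W\<close> and its inverse are finite matrices, with entries
  \<open>sw R \<sigma>\<close> and \<open>\<xi> \<sigma> R\<close>. Degrees above
  \<lfloor>p\<rfloor> are included for the sake of extensions.\<close>

lemma norm_equiv:
  assumes "n \<ge> 1"
  obtains K where "K > 0"
    "\<And>x. x \<in> TBk k \<Longrightarrow> hnorm n (level n (W x)) \<le> K * (\<Sum>R\<in>words n. proj_norm \<nu> R (piR R x))"
    "\<And>x R. R \<in> words n \<Longrightarrow> proj_norm \<nu> R (piR R x) \<le> K * hnorm n (level n (W x))"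
proof -
  let ?F = "{\<sigma> :: 'a forest. fnodes \<sigma> = n}"
  obtain \<xi> :: "'a forest \<Rightarrow> wseries"
    where \<xi>: "\<And>x R. x R = (\<Sum>\<sigma> | fnodes \<sigma> = wt R. W x \<sigma> * \<xi> \<sigma> R)" by (rule W_inverse_coeffs) (rule that)
  have words: "R \<noteq> []" "set R \<subseteq> {..<k}" "wt R = n" if "R \<in> words n" for R
    using that assms by (auto simp: words_def)
  define K1 where "K1 = (\<Sum>R\<in>words n. \<Sum>\<sigma>\<in>?F. \<bar>sw R \<sigma>\<bar> / word_norm R)"
  define K2 where "K2 = (\<Sum>R\<in>words n. \<Sum>\<sigma>\<in>?F. \<bar>\<xi> \<sigma> R\<bar> * word_norm R)"
  \<comment> \<open>\<open>K1\<close> bounds \<open>W\<close> and \<open>K2\<close> its inverse; the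
    1 keeps \<open>K\<close> positive even when there is no word of weight \<open>n\<close>.\<close>
  define K where "K = K1 + K2 + 1"
  have pos: "0 < word_norm R" if "R \<in> words n" for R using words[OF that] word_norm_pos by blast
  have K12: "K1 \<ge> 0" "K2 \<ge> 0" using pos unfolding K1_def K2_def
    by (auto intro!: sum_nonneg divide_nonneg_nonneg mult_nonneg_nonneg simp: less_imp_le)
  have pn: "proj_norm \<nu> R (piR R x) = \<bar>x R\<bar> * word_norm R" if "R \<in> words n" for R x
    using proj_norm_piR words[OF that] by blast
  have "hnorm n (level n (W x)) \<le> K * (\<Sum>R\<in>words n. proj_norm \<nu> R (piR R x))" if "x \<in> TBk k" for x
  proof -
    have "hnorm n (level n (W x)) \<le> (\<Sum>\<sigma>\<in>?F. \<bar>W x \<sigma>\<bar>)"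
      unfolding hnorm_level by (rule L2_set_le_sum_abs)
    also have "\<dots> \<le> (\<Sum>\<sigma>\<in>?F. \<Sum>R\<in>words n. \<bar>x R\<bar> * \<bar>sw R \<sigma>\<bar>)"
    proof (rule sum_mono)
      fix \<sigma> assume "\<sigma> \<in> ?F"
      then have "W x \<sigma> = (\<Sum>R\<in>words n. x R * sw R \<sigma>)"
        using that by (intro W_eq_sum finite_words_n) (auto simp: words_def TBk_def)
      then show "\<bar>W x \<sigma>\<bar> \<le> (\<Sum>R\<in>words n. \<bar>x R\<bar> * \<bar>sw R \<sigma>\<bar>)"
        using sum_abs[of "\<lambda>R. x R * sw R \<sigma>" "words n"] by (simp add: abs_mult)
    qed
    also have "\<dots> = (\<Sum>R\<in>words n. (\<Sum>\<sigma>\<in>?F. \<bar>sw R \<sigma>\<bar> / word_norm R) * proj_norm \<nu> R (piR R x))"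
      unfolding sum.swap[of _ ?F] sum_distrib_right
      by (intro sum.cong refl) (use pos in \<open>force simp: pn\<close>)
    also have "\<dots> \<le> (\<Sum>R\<in>words n. K * proj_norm \<nu> R (piR R x))"
    proof (intro sum_mono mult_right_mono)
      fix R assume R: "R \<in> words n"
      show "0 \<le> proj_norm \<nu> R (piR R x)" using pos[OF R] by (simp add: pn[OF R])
      have "(\<Sum>\<sigma>\<in>?F. \<bar>sw R \<sigma>\<bar> / word_norm R) \<le> K1"
        unfolding K1_def
        by (rule member_le_sum[OF R]) (auto simp: finite_words_n intro!: sum_nonneg divide_nonneg_pos pos)
      then show "(\<Sum>\<sigma>\<in>?F. \<bar>sw R \<sigma>\<bar> / word_norm R) \<le> K" using K12 by (simp add: K_def)
    qed
    finally show ?thesis by (simp add: sum_distrib_left)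
  qed
  moreover have "proj_norm \<nu> R (piR R x) \<le> K * hnorm n (level n (W x))" if R: "R \<in> words n" for R x
  proof -
    have "\<bar>x R\<bar> \<le> (\<Sum>\<sigma>\<in>?F. \<bar>W x \<sigma>\<bar> * \<bar>\<xi> \<sigma> R\<bar>)"
      using sum_abs[of "\<lambda>\<sigma>. W x \<sigma> * \<xi> \<sigma> R" ?F] \<xi>[of x R] words(3)[OF R] by (simp add: abs_mult)
    also have "\<dots> \<le> (\<Sum>\<sigma>\<in>?F. hnorm n (level n (W x)) * \<bar>\<xi> \<sigma> R\<bar>)"
    proof (intro sum_mono mult_right_mono)
      fix \<sigma> assume "\<sigma> \<in> ?F"
      then show "\<bar>W x \<sigma>\<bar> \<le> hnorm n (level n (W x))"
        using member_le_L2_set[OF finite_forests_eq[of n], of \<sigma> "\<lambda>\<sigma>. \<bar>W x \<sigma>\<bar>"]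
        by (simp add: hnorm_level L2_set_def)
    qed simp
    finally have "\<bar>x R\<bar> * word_norm R \<le> (\<Sum>\<sigma>\<in>?F. hnorm n (level n (W x)) * \<bar>\<xi> \<sigma> R\<bar>) * word_norm R"
      using pos[OF R] by (intro mult_right_mono) auto
    also have "\<dots> = (\<Sum>\<sigma>\<in>?F. \<bar>\<xi> \<sigma> R\<bar> * word_norm R) * hnorm n (level n (W x))"
      by (simp add: sum_distrib_left sum_distrib_right ac_simps)
    also have "\<dots> \<le> K * hnorm n (level n (W x))"
    proof (rule mult_right_mono)
      have "(\<Sum>\<sigma>\<in>?F. \<bar>\<xi> \<sigma> R\<bar> * word_norm R) \<le> K2"
        unfolding K2_def
        by (rule member_le_sum[OF R]) (auto simp: finite_words_n less_imp_le[OF pos] intro!: sum_nonneg mult_nonneg_nonneg)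
      then show "(\<Sum>\<sigma>\<in>?F. \<bar>\<xi> \<sigma> R\<bar> * word_norm R) \<le> K" using K12 by (simp add: K_def)
    qed (simp add: hnorm_level)
    finally show ?thesis by (simp add: pn[OF R])
  qed
  moreover have "K > 0" using K12 by (simp add: K_def)
  ultimately show thesis using that by blast
qed

end

section \<open>Variation distances and controls\<close>

lemma partition_in_time_simplex:
  assumes ts: "ts \<in> partitions" and i: "i < length ts - 1"
  shows "(ts ! i, ts ! Suc i) \<in> time_simplex"
proof -
  have le: "ts ! a \<le> ts ! b" if "a \<le> b" "b < length ts" for a b
    using ts that sorted_wrt_nth_less[of "(<)" ts a b]
    by (cases "a = b") (auto simp: partitions_def)
  have "ts \<noteq> []" "ts ! 0 = 0" "ts ! (length ts - 1) = 1"
    using ts by (auto simp: partitions_def hd_conv_nth last_conv_nth)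
  then show ?thesis
    using le[of 0 i] le[of i "Suc i"] le[of "Suc i" "length ts - 1"] i
    by (simp add: time_simplex_def)
qed

lemma epowr_le_iff:
  assumes q: "q > 0" and m: "m \<ge> 0"
  shows "epowr V (1 / q) \<le> ennreal m \<longleftrightarrow> V \<le> ennreal (m powr q)"
proof (cases V)
  case (real v)
  have "v powr (1 / q) \<le> m \<longleftrightarrow> v \<le> m powr q"
  proof
    assume "v powr (1 / q) \<le> m"
    then have "(v powr (1 / q)) powr q \<le> m powr q" using q by (intro powr_mono2) auto
    then show "v \<le> m powr q" using q real(1) by (simp add: powr_powr)
  next
    assume "v \<le> m powr q"
    then have "v powr (1 / q) \<le> (m powr q) powr (1 / q)" using q real(1) by (intro powr_mono2) auto
    then show "v powr (1 / q) \<le> m" using q m by (simp add: powr_powr)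
  qed
  then show ?thesis using real m by (simp add: epowr_def)
qed (simp add: epowr_def top_unique)

text \<open>A finite bound on the variation is a family of real inequalities, one per partition, so
  neither the supremum nor the outer power has to be handled again.\<close>

lemma var_power_le_iff:
  assumes "q > 0" "m \<ge> 0"
  shows "var_power q f \<le> ennreal m \<longleftrightarrow>
    (\<forall>ts\<in>partitions. (\<Sum>i<length ts - 1. \<bar>f (ts ! i, ts ! Suc i)\<bar> powr q) \<le> m powr q)"
  unfolding var_power_def epowr_le_iff[OF assms] by (simp add: SUP_le_iff)

lemma sum_powr_le:
  assumes "finite I" "q > 0" "\<And>i. i \<in> I \<Longrightarrow> 0 \<le> a i"
  shows "(\<Sum>i\<in>I. a i) powr q \<le> real (card I) powr q * (\<Sum>i\<in>I. a i powr q)"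
proof (cases "I = {}")
  case False
  define m where "m = Max (a ` I)"
  have "m \<in> a ` I" using assms(1) False by (simp add: m_def)
  then obtain j where j: "j \<in> I" "m = a j" by auto
  have "(\<Sum>i\<in>I. a i) \<le> real (card I) * m"
    using assms(1) by (intro sum_bounded_above) (simp add: m_def)
  then have "(\<Sum>i\<in>I. a i) powr q \<le> (real (card I) * m) powr q"
    using assms by (intro powr_mono2) (auto intro: sum_nonneg)
  also have "\<dots> = real (card I) powr q * a j powr q"
    using assms(3) j by (simp add: powr_mult)
  also have "\<dots> \<le> real (card I) powr q * (\<Sum>i\<in>I. a i powr q)"
    using assms(1) j(1) by (intro mult_left_mono member_le_sum) auto
  finally show ?thesis .
qed (use assms in simp)

text \<open>One factor \<open>card I\<close> comes from taking the q-th power of a sum, the other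
  from adding up \<open>card I\<close> variations, where q \<ge> 1 allows \<open>card I\<close> to
  be bounded by its q-th power. An infinite \<open>M\<close> is harmless since \<open>C\<close> is
  positive.\<close>

lemma var_power_mono:
  fixes g :: "'i \<Rightarrow> real \<times> real \<Rightarrow> real"
  assumes I: "finite I" and q: "q \<ge> 1" and K: "K \<ge> 0"
    and f: "\<And>z. z \<in> time_simplex \<Longrightarrow> \<bar>f z\<bar> \<le> K * (\<Sum>i\<in>I. \<bar>g i z\<bar>)"
    and M: "\<And>i. i \<in> I \<Longrightarrow> var_power q (g i) \<le> M"
    and C: "C > 0" "K * (real (card I))\<^sup>2 \<le> C"
  shows "var_power q f \<le> ennreal C * M"
proof (cases "M = top")
  case True
  then show ?thesis using C(1) by (simp add: ennreal_mult_top)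
next
  case False
  then obtain m where m: "m \<ge> 0" "M = ennreal m"
    by (cases M) auto
  have g: "(\<Sum>j<length ts - 1. \<bar>g i (ts ! j, ts ! Suc j)\<bar> powr q) \<le> m powr q"
    if "ts \<in> partitions" "i \<in> I" for ts i
    using M[OF that(2)] q that(1) by (simp add: m var_power_le_iff)
  have "(\<Sum>j<length ts - 1. \<bar>f (ts ! j, ts ! Suc j)\<bar> powr q) \<le> (C * m) powr q"
    if ts: "ts \<in> partitions" for ts
  proof -
    let ?z = "\<lambda>j. (ts ! j, ts ! Suc j)"
    let ?c = "real (card I)"
    have "(\<Sum>j<length ts - 1. \<bar>f (?z j)\<bar> powr q) \<le>
        (\<Sum>j<length ts - 1. K powr q * (?c powr q * (\<Sum>i\<in>I. \<bar>g i (?z j)\<bar> powr q)))"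
    proof (rule sum_mono)
      fix j assume "j \<in> {..<length ts - 1}"
      then have "\<bar>f (?z j)\<bar> powr q \<le> (K * (\<Sum>i\<in>I. \<bar>g i (?z j)\<bar>)) powr q"
        using f[OF partition_in_time_simplex[OF ts]] q by (intro powr_mono2) auto
      also have "\<dots> = K powr q * (\<Sum>i\<in>I. \<bar>g i (?z j)\<bar>) powr q"
        using K by (simp add: powr_mult sum_nonneg)
      also have "\<dots> \<le> K powr q * (?c powr q * (\<Sum>i\<in>I. \<bar>g i (?z j)\<bar> powr q))"
        using q by (intro mult_left_mono sum_powr_le I) auto
      finally show "\<bar>f (?z j)\<bar> powr q \<le> K powr q * (?c powr q * (\<Sum>i\<in>I. \<bar>g i (?z j)\<bar> powr q))" .
    qed
    also have "\<dots> = K powr q * ?c powr q * (\<Sum>i\<in>I. \<Sum>j<length ts - 1. \<bar>g i (?z j)\<bar> powr q)"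
      by (subst sum.swap) (simp add: sum_distrib_left mult.assoc)
    also have "\<dots> \<le> K powr q * ?c powr q * (?c * m powr q)"
      using g[OF ts] by (intro mult_left_mono sum_bounded_above) auto
    also have "\<dots> \<le> K powr q * ?c powr q * (?c powr q * m powr q)"
    proof -
      have "?c \<le> ?c powr q"
        using powr_mono[OF q, of ?c] by (cases "card I = 0") auto
      then show ?thesis by (intro mult_left_mono mult_right_mono) auto
    qed
    also have "\<dots> = (K * ?c\<^sup>2 * m) powr q"
      using K m by (simp add: powr_mult power2_eq_square mult_nonneg_nonneg)
    also have "\<dots> \<le> (C * m) powr q"
      using q C K m by (intro powr_mono2 mult_right_mono) auto
    finally show ?thesis .
  qed
  then have "var_power q f \<le> ennreal (C * m)"
    using q C(1) m(1) by (subst var_power_le_iff) auto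
  then show ?thesis using C(1) m by (simp add: ennreal_mult)
qed

section \<open>Operations on controls\<close>

lemma is_control_scale: "is_control \<omega> \<Longrightarrow> c \<ge> 0 \<Longrightarrow> is_control (\<lambda>z. c * \<omega> z)"
  unfolding is_control_def
  by (auto intro!: continuous_intros simp flip: distrib_left intro: mult_left_mono)

lemma is_control_sum:
  assumes "\<And>i. i \<in> I \<Longrightarrow> is_control (\<omega> i)"
  shows "is_control (\<lambda>z. \<Sum>i\<in>I. \<omega> i z)"
  using assms unfolding is_control_def
  by (auto intro!: continuous_intros sum_nonneg sum_mono simp flip: sum.distrib)

lemma is_control_nonneg: "is_control \<omega> \<Longrightarrow> z \<in> time_simplex \<Longrightarrow> 0 \<le> \<omega> z"
  by (simp add: is_control_def)

text \<open>The scaling factor does not depend on \<open>n\<close>, so one rescaled control absorbs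
  the constant in all degrees n \<ge> 1 at once.\<close>

lemma powr_absorb_constant:
  assumes "K \<ge> 0" "w \<ge> 0" "n \<ge> 1" "p > 0"
  shows "K * w powr (real n / p) \<le> ((1 + K) powr p * w) powr (real n / p)"
proof -
  have "K \<le> (1 + K) powr 1" using assms by simp
  also have "\<dots> \<le> (1 + K) powr real n" using assms by (intro powr_mono) auto
  finally have "K * w powr (real n / p) \<le> (1 + K) powr real n * w powr (real n / p)"
    by (intro mult_right_mono) auto
  also have "\<dots> = ((1 + K) powr p * w) powr (real n / p)"
    using assms by (simp add: powr_mult powr_powr)
  finally show ?thesis .
qed

section \<open>Uniqueness of extensions\<close>

lemma time_simplex_eq_Int:
  "time_simplex = {z. 0 \<le> fst z} \<inter> {z. fst z \<le> snd z} \<inter> {z. snd z \<le> 1}"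
  by (auto simp: time_simplex_def)

lemma compact_time_simplex: "compact time_simplex"
proof (rule compact_eq_bounded_closed[THEN iffD2], intro conjI)
  have "time_simplex \<subseteq> cbox (0, 0) (1, 1)"
    by (auto simp: time_simplex_def cbox_Pair_eq)
  then show "bounded time_simplex" using bounded_cbox bounded_subset by blast
  show "closed time_simplex"
    unfolding time_simplex_eq_Int
    by (intro closed_Int closed_Collect_le continuous_intros)
qed

lemma is_control_diag:
  assumes "is_control \<omega>" "0 \<le> t" "t \<le> 1"
  shows "\<omega> (t, t) = 0"
proof -
  have "\<omega> (t, t) + \<omega> (t, t) \<le> \<omega> (t, t)" using assms unfolding is_control_def by blast
  moreover have "0 \<le> \<omega> (t, t)"
    using assms by (intro is_control_nonneg) (auto simp: time_simplex_def)
  ultimately show ?thesis by simp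
qed

text \<open>A control vanishes on the diagonal and is uniformly continuous on the compact
  simplex.\<close>

lemma is_control_small:
  assumes \<omega>: "is_control \<omega>" and "\<epsilon> > 0"
  obtains \<delta> where "\<delta> > 0"
    "\<And>s t. (s, t) \<in> time_simplex \<Longrightarrow> t - s < \<delta> \<Longrightarrow> \<omega> (s, t) < \<epsilon>"
proof -
  have "uniformly_continuous_on time_simplex \<omega>"
    using \<omega> compact_time_simplex by (auto intro: compact_uniformly_continuous simp: is_control_def)
  then obtain \<delta> where \<delta>: "\<delta> > 0"
    "\<And>z z'. z \<in> time_simplex \<Longrightarrow> z' \<in> time_simplex \<Longrightarrow> dist z' z < \<delta> \<Longrightarrow> dist (\<omega> z') (\<omega> z) < \<epsilon>"
    unfolding uniformly_continuous_on_def using \<open>\<epsilon> > 0\<close> by metis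
  have "\<omega> (s, t) < \<epsilon>" if st: "(s, t) \<in> time_simplex" "t - s < \<delta>" for s t
  proof -
    have "(s, s) \<in> time_simplex" "dist (s, t) (s, s) < \<delta>"
      using st by (auto simp: time_simplex_def dist_Pair_Pair dist_real_def)
    then have "dist (\<omega> (s, t)) (\<omega> (s, s)) < \<epsilon>" using \<delta>(2)[of "(s, s)" "(s, t)"] st(1) by blast
    then show ?thesis
      using is_control_diag[OF \<omega>, of s] st(1) by (auto simp: time_simplex_def dist_real_def)
  qed
  with \<delta>(1) that show thesis by blast
qed

text \<open>Refining a partition, the sum of \<open>\<omega>\<^sup>\<theta>\<close> with \<open>\<theta> > 1\<close> tends to \<open>0\<close>.\<close>

lemma additive_eq_0:
  fixes D :: "real \<times> real \<Rightarrow> real"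
  assumes \<omega>: "is_control \<omega>" and "\<theta> > 1" "C \<ge> 0"
    and add: "\<And>s u t. 0 \<le> s \<Longrightarrow> s \<le> u \<Longrightarrow> u \<le> t \<Longrightarrow> t \<le> 1 \<Longrightarrow> D (s, t) = D (s, u) + D (u, t)"
    and bound: "\<And>z. z \<in> time_simplex \<Longrightarrow> \<bar>D z\<bar> \<le> C * \<omega> z powr \<theta>"
    and z: "z \<in> time_simplex"
  shows "D z = 0"
proof (rule ccontr)
  assume D: "D z \<noteq> 0"
  obtain s t where st: "z = (s, t)" "0 \<le> s" "s \<le> t" "t \<le> 1" using z by (auto simp: time_simplex_def)
  \<comment> \<open>The 1 makes \<open>M\<close> positive even if the control vanishes at
    \<open>z\<close>.\<close>
  define M where "M = C * \<omega> z + 1"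
  have M: "M > 0" using is_control_nonneg[OF \<omega> z] \<open>C \<ge> 0\<close> by (simp add: M_def add_nonneg_pos)
  \<comment> \<open>Chosen so that C * \<omega> z * \<epsilon> powr (\<theta> - 1) is at most half
    of \<bar>D z\<bar>, which contradicts the estimate below.\<close>
  define \<epsilon> where "\<epsilon> = (\<bar>D z\<bar> / (2 * M)) powr (1 / (\<theta> - 1))"
  have \<epsilon>: "\<epsilon> > 0" "\<epsilon> powr (\<theta> - 1) = \<bar>D z\<bar> / (2 * M)"
    using D M \<open>\<theta> > 1\<close> by (simp_all add: \<epsilon>_def powr_powr)
  obtain \<delta> where \<delta>: "\<delta> > 0"
    "\<And>s t. (s, t) \<in> time_simplex \<Longrightarrow> t - s < \<delta> \<Longrightarrow> \<omega> (s, t) < \<epsilon>"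
    using is_control_small[OF \<omega> \<epsilon>(1)] by blast
  obtain m :: nat where m: "1 / \<delta> < real m" using reals_Archimedean2 by blast
  have "m > 0" using m \<delta>(1) by (cases m) (auto simp: divide_less_0_iff)
  define u where "u = (\<lambda>i. s + (t - s) * (real i / real m))"
  have u0: "u 0 = s" and um: "u m = t" using \<open>m > 0\<close> by (simp_all add: u_def)
  have mono: "u i \<le> u j" if "i \<le> j" for i j
    using that st \<open>m > 0\<close> by (auto simp: u_def intro!: mult_left_mono divide_right_mono)
  have step: "u (Suc i) - u i < \<delta>" for i
  proof -
    have "u (Suc i) - u i = (t - s) * (1 / real m)" by (simp add: u_def diff_divide_distrib add_divide_distrib algebra_simps)
    also have "\<dots> \<le> 1 * (1 / real m)" using st by (intro mult_right_mono) auto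
    also have "\<dots> < \<delta>" using m \<delta>(1) \<open>m > 0\<close> by (simp add: field_simps)
    finally show ?thesis .
  qed
  have simplex: "(u i, u j) \<in> time_simplex" if "i \<le> j" "j \<le> m" for i j
    using mono[of 0 i] mono[of i j] mono[of j m] that st by (simp add: u0 um time_simplex_def)
  have sums: "D (s, u i) = (\<Sum>j<i. D (u j, u (Suc j))) \<and> (\<Sum>j<i. \<omega> (u j, u (Suc j))) \<le> \<omega> (s, u i)"
    if "i \<le> m" for i
    using that
  proof (induction i)
    case 0
    have "D (s, s) = 0" using add[of s s s] st by simp
    then show ?case using is_control_diag[OF \<omega>, of s] st by (simp add: u0)
  next
    case (Suc i)
    have le: "0 \<le> s" "s \<le> u i" "u i \<le> u (Suc i)" "u (Suc i) \<le> 1"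
      using simplex[of i "Suc i"] simplex[of 0 i] Suc.prems by (auto simp: time_simplex_def u0)
    have "\<omega> (s, u i) + \<omega> (u i, u (Suc i)) \<le> \<omega> (s, u (Suc i))"
      using \<omega> le unfolding is_control_def by blast
    then show ?case using Suc add[OF le] by simp
  qed
  have "\<bar>D z\<bar> \<le> (\<Sum>j<m. \<bar>D (u j, u (Suc j))\<bar>)"
    using sums[of m] st(1) um sum_abs[of "\<lambda>j. D (u j, u (Suc j))" "{..<m}"] by simp
  also have "\<dots> \<le> (\<Sum>j<m. C * \<epsilon> powr (\<theta> - 1) * \<omega> (u j, u (Suc j)))"
  proof (rule sum_mono)
    fix j assume "j \<in> {..<m}"
    then have z': "(u j, u (Suc j)) \<in> time_simplex" (is "?z \<in> _") by (intro simplex) auto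
    have w: "0 \<le> \<omega> ?z" "\<omega> ?z < \<epsilon>" using is_control_nonneg[OF \<omega> z'] \<delta>(2)[OF z' step] by auto
    \<comment> \<open>One factor \<omega> is kept for superadditivity; the remaining power is small
      uniformly over the partition, since \<theta> > 1.\<close>
    have "\<omega> ?z powr \<theta> = \<omega> ?z powr (\<theta> - 1) * \<omega> ?z"
      using w(1) powr_add[of "\<omega> ?z" "\<theta> - 1" 1] by (cases "\<omega> ?z = 0") auto
    also have "\<dots> \<le> \<epsilon> powr (\<theta> - 1) * \<omega> ?z"
      using w \<open>\<theta> > 1\<close> by (intro mult_right_mono powr_mono2) auto
    finally have "C * \<omega> ?z powr \<theta> \<le> C * (\<epsilon> powr (\<theta> - 1) * \<omega> ?z)"
      using \<open>C \<ge> 0\<close> by (rule mult_left_mono)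
    then show "\<bar>D ?z\<bar> \<le> C * \<epsilon> powr (\<theta> - 1) * \<omega> ?z" using bound[OF z'] by (simp add: mult.assoc)
  qed
  also have "\<dots> = C * \<epsilon> powr (\<theta> - 1) * (\<Sum>j<m. \<omega> (u j, u (Suc j)))"
    by (simp add: sum_distrib_left)
  also have "\<dots> \<le> C * \<epsilon> powr (\<theta> - 1) * \<omega> z"
    using sums[of m] st(1) um \<open>C \<ge> 0\<close> by (intro mult_left_mono) auto
  also have "\<dots> = (C * \<omega> z) * (\<bar>D z\<bar> / (2 * M))" by (simp add: \<epsilon>(2))
  also have "\<dots> \<le> M * (\<bar>D z\<bar> / (2 * M))" using M by (intro mult_right_mono) (auto simp: M_def)
  also have "\<dots> = \<bar>D z\<bar> / 2" using M by simp
  finally show False using D by simp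
qed

context free_gens
begin

text \<open>If \<open>g\<close> vanishes below the degree of the forest, only terms of
  \<open>ck\<close> with an empty right factor survive. There \<open>h\<close> and the unit agree,
  so the unit law gives the value.\<close>

lemma star_top_left:
  fixes g h :: "'a series"
  assumes "\<And>a. fnodes a < fnodes \<sigma> \<Longrightarrow> g a = 0" "h {#} = 1"
  shows "star g h \<sigma> = g \<sigma>"
proof -
  have "star g h \<sigma> = star g one_H \<sigma>"
    unfolding star_def
  proof (intro sum.cong refl, clarify)
    fix a b assume ab: "(a, b) \<in> Poly_Mapping.keys (ck \<sigma>)"
    have "g a * h b = g a * one_H b"
    proof (cases "b = {#}")
      case False
      then have "fnodes a < fnodes \<sigma>"
        using keys_ck[OF ab] fnodes_eq_0_iff[of b] by linarith
      then show ?thesis using assms(1) by simp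
    qed (simp add: assms(2))
    then show "g a * h b * Poly_Mapping.lookup (ck \<sigma>) (a, b) =
        g a * one_H b * Poly_Mapping.lookup (ck \<sigma>) (a, b)" by simp
  qed
  then show ?thesis by simp
qed

lemma star_top_right:
  fixes g h :: "'a series"
  assumes "\<And>b. fnodes b < fnodes \<sigma> \<Longrightarrow> h b = 0" "g {#} = 1"
  shows "star g h \<sigma> = h \<sigma>"
proof -
  have "star g h \<sigma> = star one_H h \<sigma>"
    unfolding star_def
  proof (intro sum.cong refl, clarify)
    fix a b assume ab: "(a, b) \<in> Poly_Mapping.keys (ck \<sigma>)"
    have "g a * h b = one_H a * h b"
    proof (cases "a = {#}")
      case False
      then have "fnodes b < fnodes \<sigma>"
        using keys_ck[OF ab] fnodes_eq_0_iff[of a] by linarith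
      then show ?thesis using assms(1) by simp
    qed (simp add: assms(2))
    then show "g a * h b * Poly_Mapping.lookup (ck \<sigma>) (a, b) =
        one_H a * h b * Poly_Mapping.lookup (ck \<sigma>) (a, b)" by simp
  qed
  then show ?thesis by simp
qed

lemma abs_le_hnorm:
  fixes h :: "'a series"
  assumes "fnodes \<sigma> = n"
  shows "\<bar>h \<sigma>\<bar> \<le> hnorm n (level n h)"
  using member_le_L2_set[OF finite_forests_eq[of n], of \<sigma> "\<lambda>\<sigma>. \<bar>h \<sigma>\<bar>"] assms
  by (simp add: hnorm_level L2_set_def)

text \<open>Induction on the degree: once all lower degrees agree, the difference in degree n is
  additive in time. Above \<open>N\<close> it is bounded by a control to the power n / p > 1, which
  forces it to vanish.\<close>

lemma multiplicative_extension_unique: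
  fixes S T :: "real \<times> real \<Rightarrow> 'a series"
  assumes "p > 0" and N: "p < real (Suc N)"
    and one: "\<And>z. z \<in> time_simplex \<Longrightarrow> S z {#} = 1"
    and agree: "\<And>z \<sigma>. z \<in> time_simplex \<Longrightarrow> fnodes \<sigma> \<le> N \<Longrightarrow> S z \<sigma> = T z \<sigma>"
    and S: "multiplicative star S" and T: "multiplicative star T"
    and S_bound: "\<And>n. n \<ge> 1 \<Longrightarrow> \<exists>\<omega>. is_control \<omega> \<and>
      (\<forall>z\<in>time_simplex. hnorm n (level n (S z)) \<le> \<omega> z powr (real n / p))"
    and T_bound: "\<And>n. n \<ge> 1 \<Longrightarrow> \<exists>\<omega>. is_control \<omega> \<and>
      (\<forall>z\<in>time_simplex. hnorm n (level n (T z)) \<le> \<omega> z powr (real n / p))"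
    and z: "z \<in> time_simplex"
  shows "S z = T z"
proof -
  have "S z \<sigma> = T z \<sigma>" if "fnodes \<sigma> = n" "z \<in> time_simplex" for z \<sigma> n
    using that
  proof (induction n arbitrary: z \<sigma> rule: less_induct)
    case (less n)
    show ?case
    proof (cases "n \<le> N")
      case False
      then have n: "n \<ge> 1" "real n / p > 1" using N \<open>p > 0\<close> by auto
      define D where "D = (\<lambda>z. S z \<sigma> - T z \<sigma>)"
      obtain \<omega> where \<omega>: "is_control \<omega>"
        "\<And>z. z \<in> time_simplex \<Longrightarrow> hnorm n (level n (S z)) \<le> \<omega> z powr (real n / p)"
        using S_bound[OF n(1)] by blast
      obtain \<omega>' where \<omega>': "is_control \<omega>'"
        "\<And>z. z \<in> time_simplex \<Longrightarrow> hnorm n (level n (T z)) \<le> \<omega>' z powr (real n / p)"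
        using T_bound[OF n(1)] by blast
      have sum_control: "is_control (\<lambda>z. \<omega> z + \<omega>' z)"
        using is_control_sum[of UNIV "case_bool \<omega> \<omega>'"] \<omega>(1) \<omega>'(1)
        by (simp add: UNIV_bool add.commute split: bool.split)
      have "D z = 0"
      proof (rule additive_eq_0[OF sum_control n(2), of 2 D])
        fix z assume z: "z \<in> time_simplex"
        note nn = is_control_nonneg[OF \<omega>(1) z] is_control_nonneg[OF \<omega>'(1) z]
        have "\<bar>D z\<bar> \<le> \<bar>S z \<sigma>\<bar> + \<bar>T z \<sigma>\<bar>" by (simp add: D_def)
        also have "\<dots> \<le> \<omega> z powr (real n / p) + \<omega>' z powr (real n / p)"
          using abs_le_hnorm[OF less.prems(1)] \<omega>(2)[OF z] \<omega>'(2)[OF z]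
          by (intro add_mono) (blast intro: order_trans)+
        also have "\<dots> \<le> (\<omega> z + \<omega>' z) powr (real n / p) + (\<omega> z + \<omega>' z) powr (real n / p)"
          using nn n by (intro add_mono powr_mono2) auto
        finally show "\<bar>D z\<bar> \<le> 2 * (\<omega> z + \<omega>' z) powr (real n / p)" by simp
      next
        fix s u t :: real assume le: "0 \<le> s" "s \<le> u" "u \<le> t" "t \<le> 1"
        then have simplex: "(s, u) \<in> time_simplex" "(u, t) \<in> time_simplex"
          by (auto simp: time_simplex_def)
        have "D (s, t) = star (S (s, u)) (S (u, t)) \<sigma> - star (T (s, u)) (T (u, t)) \<sigma>"
          using S T le unfolding multiplicative_def D_def by metis
        \<comment> \<open>The difference of products is telescoped. Each difference vanishes below
          the degree of \<open>\<sigma>\<close>, and the other factor has constant term 1.\<close>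
        also have "\<dots> = star (\<lambda>\<sigma>. S (s, u) \<sigma> - T (s, u) \<sigma>) (S (u, t)) \<sigma>
            + star (T (s, u)) (\<lambda>\<sigma>. S (u, t) \<sigma> - T (u, t) \<sigma>) \<sigma>"
          by (simp add: star_diff_left star_diff_right)
        also have "star (\<lambda>\<sigma>. S (s, u) \<sigma> - T (s, u) \<sigma>) (S (u, t)) \<sigma> = D (s, u)"
          unfolding D_def by (rule star_top_left) (use less simplex one in auto)
        also have "star (T (s, u)) (\<lambda>\<sigma>. S (u, t) \<sigma> - T (u, t) \<sigma>) \<sigma> = D (u, t)"
          unfolding D_def by (rule star_top_right) (use less simplex one agree[of _ "{#}"] in auto)
        finally show "D (s, t) = D (s, u) + D (u, t)" .
      qed (use less.prems in simp_all)
      then show ?thesis by (simp add: D_def)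
    qed (use less.prems agree in simp)
  qed
  with z show ?thesis by (intro ext) simp
qed

end

section \<open>Transfer along the isomorphism\<close>

context Pi_norm_setting
begin

lemma TPi_subset_TBk: "x \<in> TPi \<tau> p k \<Longrightarrow> x \<in> TBk k"
  using letters_if_wt_le_N by (force simp: mem_TPi TBk_def not_le[symmetric])

text \<open>Groups the index set of the inhomogeneous distance by degree, to match the index set
  {1..N} of the branched one.\<close>

lemma mem_A1_nonempty: "R \<in> A1 \<tau> p k - {[]} \<longleftrightarrow> wt R \<in> {1..N} \<and> R \<in> words (wt R)"
proof -
  have "1 \<le> wt R \<longleftrightarrow> R \<noteq> []" using wt_eq_0_iff[of R] by linarith
  then show ?thesis using letters_if_wt_le_N[of R] by (auto simp: A1_eq words_def)
qed

lemma words_A1: "n \<in> {1..N} \<Longrightarrow> R \<in> words n \<Longrightarrow> R \<in> A1 \<tau> p k - {[]}"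
  unfolding mem_A1_nonempty by (auto simp: words_def)

lemma finite_A1: "finite (A1 \<tau> p k)"
  by (simp add: A1_eq finite_words)

lemma inverse_deg_Pi: "R \<in> words n \<Longrightarrow> 1 / deg_Pi \<tau> p R = p / real n"
  by (simp add: deg_Pi_eq words_def)

text \<open>Guards the \<open>Max\<close> in \<open>rho_Pivar\<close> against an empty index set:
  the first generator, letter 0, has at most \<open>p\<close> nodes.\<close>

lemma A1_minus_Nil_nonempty: "k \<ge> 1 \<Longrightarrow> A1 \<tau> p k - {[]} \<noteq> {}"
proof -
  assume "k \<ge> 1"
  then have "[0] \<in> A1 \<tau> p k - {[]}" using letter_iff[of 0] by (simp add: A1_eq le_N_iff)
  then show ?thesis by blast
qed

lemma uniform_norm_equiv:
  obtains K where "K > 0"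
    "\<And>n x. n \<in> {1..N} \<Longrightarrow> x \<in> TPi \<tau> p k \<Longrightarrow>
      hnorm n (level n (W x)) \<le> K * (\<Sum>R\<in>words n. proj_norm \<nu> R (piR R x))"
    "\<And>n x R. n \<in> {1..N} \<Longrightarrow> R \<in> words n \<Longrightarrow> proj_norm \<nu> R (piR R x) \<le> K * hnorm n (level n (W x))"
proof -
  define P where "P = (\<lambda>n K. K > 0 \<and>
    (\<forall>x\<in>TBk k. hnorm n (level n (W x)) \<le> K * (\<Sum>R\<in>words n. proj_norm \<nu> R (piR R x))) \<and>
    (\<forall>R\<in>words n. \<forall>x. proj_norm \<nu> R (piR R x) \<le> K * hnorm n (level n (W x))))"
  have "\<exists>K. n \<ge> 1 \<longrightarrow> P n K" for n
  proof (cases "n \<ge> 1")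
    case True
    then show ?thesis unfolding P_def by (rule norm_equiv) blast
  qed simp
  then obtain K where "\<And>n. n \<ge> 1 \<Longrightarrow> P n (K n)" by metis
  then have K: "\<And>n. n \<ge> 1 \<Longrightarrow> 0 < K n"
    "\<And>n x. n \<ge> 1 \<Longrightarrow> x \<in> TBk k \<Longrightarrow> hnorm n (level n (W x)) \<le> K n * (\<Sum>R\<in>words n. proj_norm \<nu> R (piR R x))"
    "\<And>n R x. n \<ge> 1 \<Longrightarrow> R \<in> words n \<Longrightarrow> proj_norm \<nu> R (piR R x) \<le> K n * hnorm n (level n (W x))"
    unfolding P_def by blast+
  \<comment> \<open>The sum of the positive constants of the finitely many degrees dominates each of
    them.\<close>
  define C where "C = (\<Sum>n\<in>{1..N}. K n)"
  have le: "K n \<le> C" if "n \<in> {1..N}" for n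
    unfolding C_def using that K(1) by (intro member_le_sum) (auto simp: less_imp_le)
  have pos: "C > 0" using N_ge_1 K(1)[of 1] le[of 1] by simp
  have nonneg: "0 \<le> proj_norm \<nu> R (piR R x)" if "n \<in> {1..N}" "R \<in> words n" for n R x
  proof -
    have "R \<noteq> []" "set R \<subseteq> {..<k}" using that by (auto simp: words_def)
    then show ?thesis using word_norm_pos[of R] by (simp add: proj_norm_piR)
  qed
  show thesis
  proof (rule that[OF pos])
    fix n x assume n: "n \<in> {1..N}" and x: "x \<in> TPi \<tau> p k"
    have "hnorm n (level n (W x)) \<le> K n * (\<Sum>R\<in>words n. proj_norm \<nu> R (piR R x))"
      using K(2) n TPi_subset_TBk[OF x] by simp
    also have "\<dots> \<le> C * (\<Sum>R\<in>words n. proj_norm \<nu> R (piR R x))"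
      by (intro mult_right_mono sum_nonneg nonneg[OF n] le[OF n])
    finally show "hnorm n (level n (W x)) \<le> C * (\<Sum>R\<in>words n. proj_norm \<nu> R (piR R x))" .
  next
    fix n x R assume n: "n \<in> {1..N}" and R: "R \<in> words n"
    have "proj_norm \<nu> R (piR R x) \<le> K n * hnorm n (level n (W x))" using K(3) n R by simp
    also have "\<dots> \<le> C * hnorm n (level n (W x))"
      by (intro mult_right_mono le[OF n]) (simp add: hnorm_level)
    finally show "proj_norm \<nu> R (piR R x) \<le> C * hnorm n (level n (W x))" .
  qed
qed

lemma proj_norm_nonneg: "R \<in> A1 \<tau> p k - {[]} \<Longrightarrow> 0 \<le> proj_norm \<nu> R (piR R x)"
  unfolding mem_A1_nonempty using word_norm_pos[of R]
  by (cases "R = []") (auto simp: words_def proj_norm_piR)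

lemma Psi_diff:
  assumes "is_Psi \<tau> p k \<Psi>" "g \<in> HN N" "h \<in> HN N"
  shows "(\<lambda>R. \<Psi> g R - \<Psi> h R) \<in> TPi \<tau> p k" "W (\<lambda>R. \<Psi> g R - \<Psi> h R) = (\<lambda>\<sigma>. g \<sigma> - h \<sigma>)"
proof -
  note g = is_Psi_HN[OF assms(1,2)] and h = is_Psi_HN[OF assms(1,3)]
  show "(\<lambda>R. \<Psi> g R - \<Psi> h R) \<in> TPi \<tau> p k" using g(1) h(1) by (simp add: mem_TPi)
  show "W (\<lambda>R. \<Psi> g R - \<Psi> h R) = (\<lambda>\<sigma>. g \<sigma> - h \<sigma>)"
    using W_diff[of "\<Psi> g" "\<Psi> h"] g(2) h(2) by (intro ext) simp
qed

lemma distance_equiv: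
  assumes "k \<ge> 1" and Psi: "is_Psi \<tau> p k \<Psi>"
  shows "\<exists>C>0. \<forall>X Y. (\<forall>z\<in>time_simplex. X z \<in> HN N) \<longrightarrow> (\<forall>z\<in>time_simplex. Y z \<in> HN N) \<longrightarrow>
    ennreal (1 / C) * rho_Pivar \<tau> p k \<nu> (\<Psi> \<circ> X) (\<Psi> \<circ> Y) \<le> rho_pvar p X Y \<and>
    rho_pvar p X Y \<le> ennreal C * rho_Pivar \<tau> p k \<nu> (\<Psi> \<circ> X) (\<Psi> \<circ> Y)"
proof -
  obtain K where K: "K > 0"
    "\<And>n x. n \<in> {1..N} \<Longrightarrow> x \<in> TPi \<tau> p k \<Longrightarrow>
      hnorm n (level n (W x)) \<le> K * (\<Sum>R\<in>words n. proj_norm \<nu> R (piR R x))"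
    "\<And>n x R. n \<in> {1..N} \<Longrightarrow> R \<in> words n \<Longrightarrow> proj_norm \<nu> R (piR R x) \<le> K * hnorm n (level n (W x))"
    by (rule uniform_norm_equiv) (rule that)
  \<comment> \<open>The summand \<open>K\<close> serves the bound on words by forests, the other one
    the bound on forests by words, where the number of words enters squared.\<close>
  define C where "C = K + K * (\<Sum>n\<in>{1..N}. (real (card (words n)))\<^sup>2)"
  have C: "C > 0" "K \<le> C" using K(1) by (auto simp: C_def intro!: add_pos_nonneg mult_nonneg_nonneg sum_nonneg)
  have C_words: "K * (real (card (words n)))\<^sup>2 \<le> C" if "n \<in> {1..N}" for n
  proof -
    have "(real (card (words n)))\<^sup>2 \<le> (\<Sum>n\<in>{1..N}. (real (card (words n)))\<^sup>2)"
      using that by (intro member_le_sum) auto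
    then have "K * (real (card (words n)))\<^sup>2 \<le> K * (\<Sum>n\<in>{1..N}. (real (card (words n)))\<^sup>2)"
      using K(1) by (intro mult_left_mono) auto
    then show ?thesis unfolding C_def using K(1) by linarith
  qed
  have exponent: "1 \<le> p / real n" if "n \<in> {1..N}" for n using that by (simp add: le_N_iff)
  have "ennreal (1 / C) * rho_Pivar \<tau> p k \<nu> (\<Psi> \<circ> X) (\<Psi> \<circ> Y) \<le> rho_pvar p X Y"
    "rho_pvar p X Y \<le> ennreal C * rho_Pivar \<tau> p k \<nu> (\<Psi> \<circ> X) (\<Psi> \<circ> Y)"
    if X: "\<forall>z\<in>time_simplex. X z \<in> HN N" and Y: "\<forall>z\<in>time_simplex. Y z \<in> HN N" for X Y
  proof -
    define f where "f = (\<lambda>n z. hnorm n (level n (\<lambda>\<sigma>. X z \<sigma> - Y z \<sigma>)))"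
    define g where "g = (\<lambda>R z. proj_norm \<nu> R (piR R (\<lambda>w. \<Psi> (X z) w - \<Psi> (Y z) w)))"
    have rp: "rho_pvar p X Y = (MAX n\<in>{1..N}. var_power (p / real n) (f n))"
      by (simp add: rho_pvar_def f_def)
    have rPi: "rho_Pivar \<tau> p k \<nu> (\<Psi> \<circ> X) (\<Psi> \<circ> Y) =
        (MAX R\<in>A1 \<tau> p k - {[]}. var_power (1 / deg_Pi \<tau> p R) (g R))"
      by (simp add: rho_Pivar_def g_def)
    have f_nonneg: "0 \<le> f n z" for n z by (simp add: f_def hnorm_level)
    have fg: "f n z \<le> K * (\<Sum>R\<in>words n. g R z)" if "n \<in> {1..N}" "z \<in> time_simplex" for n z
      using K(2)[OF that(1) Psi_diff(1)[OF Psi, of "X z" "Y z"]] Psi_diff(2)[OF Psi, of "X z" "Y z"] X Y that(2)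
      by (simp add: f_def g_def)
    have gf: "g R z \<le> K * f n z" if "n \<in> {1..N}" "R \<in> words n" "z \<in> time_simplex" for n R z
      using K(3)[OF that(1,2), of "\<lambda>w. \<Psi> (X z) w - \<Psi> (Y z) w"] Psi_diff(2)[OF Psi, of "X z" "Y z"] X Y that(3)
      by (simp add: f_def g_def)
    show "rho_pvar p X Y \<le> ennreal C * rho_Pivar \<tau> p k \<nu> (\<Psi> \<circ> X) (\<Psi> \<circ> Y)"
      unfolding rp
    proof (rule Max.boundedI)
      fix v assume "v \<in> (\<lambda>n. var_power (p / real n) (f n)) ` {1..N}"
      then obtain n where n: "n \<in> {1..N}" and v: "v = var_power (p / real n) (f n)" by blast
      show "v \<le> ennreal C * rho_Pivar \<tau> p k \<nu> (\<Psi> \<circ> X) (\<Psi> \<circ> Y)"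
        unfolding v
      proof (rule var_power_mono[OF finite_words_n exponent[OF n] _ _ _ C(1) C_words[OF n]])
        fix z :: "real \<times> real" assume "z \<in> time_simplex"
        have "(\<Sum>R\<in>words n. g R z) \<le> (\<Sum>R\<in>words n. \<bar>g R z\<bar>)" by (intro sum_mono) simp
        then have "K * (\<Sum>R\<in>words n. g R z) \<le> K * (\<Sum>R\<in>words n. \<bar>g R z\<bar>)"
          using K(1) by (intro mult_left_mono) auto
        then show "\<bar>f n z\<bar> \<le> K * (\<Sum>R\<in>words n. \<bar>g R z\<bar>)"
          using fg[OF n \<open>z \<in> time_simplex\<close>] f_nonneg[of n z] by simp
      next
        fix R assume R: "R \<in> words n"
        show "var_power (p / real n) (g R) \<le> rho_Pivar \<tau> p k \<nu> (\<Psi> \<circ> X) (\<Psi> \<circ> Y)"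
          unfolding rPi inverse_deg_Pi[OF R, symmetric] using finite_A1 words_A1[OF n R]
          by (intro Max_ge) auto
      qed (use K(1) in simp)
    qed (use N_ge_1 in auto)
    have "rho_Pivar \<tau> p k \<nu> (\<Psi> \<circ> X) (\<Psi> \<circ> Y) \<le> ennreal C * rho_pvar p X Y"
      unfolding rPi
    proof (rule Max.boundedI)
      fix v assume "v \<in> (\<lambda>R. var_power (1 / deg_Pi \<tau> p R) (g R)) ` (A1 \<tau> p k - {[]})"
      then obtain R where R: "R \<in> A1 \<tau> p k - {[]}" and v: "v = var_power (1 / deg_Pi \<tau> p R) (g R)" by blast
      define n where "n = wt R"
      have n: "n \<in> {1..N}" "R \<in> words n" using R unfolding mem_A1_nonempty n_def by blast+
      show "v \<le> ennreal C * rho_pvar p X Y"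
        unfolding v inverse_deg_Pi[OF n(2)]
      \<comment> \<open>A single word is controlled by a single level, so the index set is a
        singleton and the constant is just \<open>K\<close>.\<close>
      proof (rule var_power_mono[of "{()}" "p / real n" K "g R" "\<lambda>_. f n"])
        fix z :: "real \<times> real" assume "z \<in> time_simplex"
        then show "\<bar>g R z\<bar> \<le> K * (\<Sum>i\<in>{()}. \<bar>f n z\<bar>)"
          using gf[OF n] f_nonneg[of n z] proj_norm_nonneg[OF R] by (simp add: g_def)
      next
        show "var_power (p / real n) (f n) \<le> rho_pvar p X Y"
          unfolding rp using n(1) by (intro Max_ge) auto
      qed (use K(1) C exponent[OF n(1)] in auto)
    qed (use finite_A1 A1_minus_Nil_nonempty[OF assms(1)] in auto)
    then have "ennreal (1 / C) * rho_Pivar \<tau> p k \<nu> (\<Psi> \<circ> X) (\<Psi> \<circ> Y)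
        \<le> ennreal (1 / C) * (ennreal C * rho_pvar p X Y)"
      by (rule mult_left_mono) simp
    also have "\<dots> = rho_pvar p X Y"
      using C(1) by (simp flip: mult.assoc ennreal_mult)
    finally show "ennreal (1 / C) * rho_Pivar \<tau> p k \<nu> (\<Psi> \<circ> X) (\<Psi> \<circ> Y) \<le> rho_pvar p X Y" .
  qed
  with C(1) show ?thesis by blast
qed

text \<open>Continuity is coordinatewise, and in each direction a coordinate is a finite linear
  combination of coordinates with coefficients independent of time.\<close>

lemma Psi_continuous_iff:
  assumes Psi: "is_Psi \<tau> p k \<Psi>" and X: "\<forall>z\<in>time_simplex. X z \<in> HN N"
  shows "continuous_on time_simplex X \<longleftrightarrow> continuous_on time_simplex (\<Psi> \<circ> X)"
proof
  assume "continuous_on time_simplex X"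
  then have cont: "continuous_on time_simplex (\<lambda>z. X z \<sigma>)" for \<sigma>
    by (rule continuous_on_product_then_coordinatewise)
  obtain \<xi> :: "'a forest \<Rightarrow> wseries"
    where \<xi>: "\<And>x R. x R = (\<Sum>\<sigma> | fnodes \<sigma> = wt R. W x \<sigma> * \<xi> \<sigma> R)" by (rule W_inverse_coeffs) (rule that)
  show "continuous_on time_simplex (\<Psi> \<circ> X)"
  proof (rule continuous_on_coordinatewise_then_product)
    fix R
    have "continuous_on time_simplex (\<lambda>z. \<Sum>\<sigma> | fnodes \<sigma> = wt R. X z \<sigma> * \<xi> \<sigma> R)"
      by (intro continuous_intros cont)
    then show "continuous_on time_simplex (\<lambda>z. (\<Psi> \<circ> X) z R)"
    proof (rule continuous_on_eq)
      fix z :: "real \<times> real" assume "z \<in> time_simplex"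
      then show "(\<Sum>\<sigma> | fnodes \<sigma> = wt R. X z \<sigma> * \<xi> \<sigma> R) = (\<Psi> \<circ> X) z R"
        using \<xi>[of "\<Psi> (X z)" R] is_Psi_HN(2)[OF Psi, of "X z"] X by simp
    qed
  qed
next
  assume "continuous_on time_simplex (\<Psi> \<circ> X)"
  then have cont: "continuous_on time_simplex (\<lambda>z. (\<Psi> \<circ> X) z R)" for R
    by (rule continuous_on_product_then_coordinatewise)
  show "continuous_on time_simplex X"
  proof (rule continuous_on_coordinatewise_then_product)
    fix \<sigma> :: "'a forest"
    have "continuous_on time_simplex (\<lambda>z. \<Sum>R | wt R = fnodes \<sigma>. (\<Psi> \<circ> X) z R * sw R \<sigma>)"
      by (intro continuous_intros cont)
    then show "continuous_on time_simplex (\<lambda>z. X z \<sigma>)"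
    proof (rule continuous_on_eq)
      fix z :: "real \<times> real" assume "z \<in> time_simplex"
      then have "X z \<sigma> = W (\<Psi> (X z)) \<sigma>" using is_Psi_HN(2)[OF Psi] X by simp
      also have "\<dots> = (\<Sum>R | wt R = fnodes \<sigma>. \<Psi> (X z) R * sw R \<sigma>)"
        by (rule W_eq_sum) (simp_all add: finite_words_eq)
      finally show "(\<Sum>R | wt R = fnodes \<sigma>. (\<Psi> \<circ> X) z R * sw R \<sigma>) = X z \<sigma>" by simp
    qed
  qed
qed

text \<open>The controls of the finitely many words of weight \<open>n\<close> are added, and the
  norm constant is absorbed by rescaling. It applies in every degree, so it serves rough paths and
  extensions alike.\<close>

lemma hnorm_control_from_words:
  assumes "n \<ge> 1" and x: "\<And>z. z \<in> time_simplex \<Longrightarrow> x z \<in> TBk k"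
    and R: "\<And>R. R \<in> words n \<Longrightarrow> \<exists>\<omega>. is_control \<omega> \<and>
      (\<forall>z\<in>time_simplex. proj_norm \<nu> R (piR R (x z)) \<le> \<omega> z powr deg_Pi \<tau> p R)"
  shows "\<exists>\<omega>. is_control \<omega> \<and>
    (\<forall>z\<in>time_simplex. hnorm n (level n (W (x z))) \<le> \<omega> z powr (real n / p))"
proof -
  obtain K where K: "K > 0"
    "\<And>x. x \<in> TBk k \<Longrightarrow> hnorm n (level n (W x)) \<le> K * (\<Sum>R\<in>words n. proj_norm \<nu> R (piR R x))"
    by (rule norm_equiv[OF assms(1)]) (rule that)
  obtain \<omega> where \<omega>: "\<And>R. R \<in> words n \<Longrightarrow> is_control (\<omega> R)"
    "\<And>R z. R \<in> words n \<Longrightarrow> z \<in> time_simplex \<Longrightarrow> proj_norm \<nu> R (piR R (x z)) \<le> \<omega> R z powr deg_Pi \<tau> p R"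
    using R by metis
  define \<Omega> where "\<Omega> = (\<lambda>z. \<Sum>R\<in>words n. \<omega> R z)"
  let ?K = "K * real (card (words n))"
  have \<Omega>: "is_control \<Omega>" unfolding \<Omega>_def by (rule is_control_sum) (rule \<omega>(1))
  have "hnorm n (level n (W (x z))) \<le> ((1 + ?K) powr p * \<Omega> z) powr (real n / p)"
    if z: "z \<in> time_simplex" for z
  proof -
    have "proj_norm \<nu> R (piR R (x z)) \<le> \<Omega> z powr (real n / p)" if R: "R \<in> words n" for R
    proof -
      have "\<omega> R z \<le> \<Omega> z"
        unfolding \<Omega>_def using z \<omega>(1) by (intro member_le_sum R finite_words_n is_control_nonneg) auto
      then have "\<omega> R z powr (real n / p) \<le> \<Omega> z powr (real n / p)"
        using is_control_nonneg[OF \<omega>(1)[OF R] z] p_ge_1 by (intro powr_mono2) auto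
      moreover have "deg_Pi \<tau> p R = real n / p" using R by (simp add: deg_Pi_eq words_def)
      ultimately show ?thesis using \<omega>(2)[OF R z] by simp
    qed
    then have "(\<Sum>R\<in>words n. proj_norm \<nu> R (piR R (x z))) \<le> real (card (words n)) * \<Omega> z powr (real n / p)"
      by (rule sum_bounded_above)
    then have "hnorm n (level n (W (x z))) \<le> ?K * \<Omega> z powr (real n / p)"
      using K(2)[OF x[OF z]] K(1) by (smt (verit) mult.assoc mult_left_mono)
    also have "\<dots> \<le> ((1 + ?K) powr p * \<Omega> z) powr (real n / p)"
      using K(1) p_ge_1 assms(1) is_control_nonneg[OF \<Omega> z] by (intro powr_absorb_constant) auto
    finally show ?thesis .
  qed
  then show ?thesis using is_control_scale[OF \<Omega>, of "(1 + ?K) powr p"] by fastforce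
qed

text \<open>Both sides ask for one control valid in all degrees. From forests to words one rescaling
  is enough; from words to forests the controls of the separate degrees are added.\<close>

lemma rough_bounds_iff:
  assumes x: "\<And>z. z \<in> time_simplex \<Longrightarrow> x z \<in> TPi \<tau> p k"
  shows "(\<exists>\<omega>. is_control \<omega> \<and> (\<forall>n\<in>{1..N}. \<forall>z\<in>time_simplex.
      hnorm n (level n (W (x z))) \<le> \<omega> z powr (real n / p))) \<longleftrightarrow>
    (\<exists>\<omega>. is_control \<omega> \<and> (\<forall>R\<in>A1 \<tau> p k - {[]}. \<forall>z\<in>time_simplex.
      proj_norm \<nu> R (piR R (x z)) \<le> \<omega> z powr deg_Pi \<tau> p R))"
proof
  assume "\<exists>\<omega>. is_control \<omega> \<and> (\<forall>n\<in>{1..N}. \<forall>z\<in>time_simplex.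
      hnorm n (level n (W (x z))) \<le> \<omega> z powr (real n / p))"
  then obtain \<omega> where \<omega>: "is_control \<omega>"
    "\<And>n z. n \<in> {1..N} \<Longrightarrow> z \<in> time_simplex \<Longrightarrow> hnorm n (level n (W (x z))) \<le> \<omega> z powr (real n / p)"
    by blast
  obtain K where K: "K > 0"
    "\<And>n x R. n \<in> {1..N} \<Longrightarrow> R \<in> words n \<Longrightarrow> proj_norm \<nu> R (piR R x) \<le> K * hnorm n (level n (W x))"
    by (rule uniform_norm_equiv) (rule that)
  have "proj_norm \<nu> R (piR R (x z)) \<le> ((1 + K) powr p * \<omega> z) powr deg_Pi \<tau> p R"
    if R: "R \<in> A1 \<tau> p k - {[]}" and z: "z \<in> time_simplex" for R z
  proof -
    have n: "wt R \<in> {1..N}" "R \<in> words (wt R)" using R unfolding mem_A1_nonempty by blast+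
    have "proj_norm \<nu> R (piR R (x z)) \<le> K * hnorm (wt R) (level (wt R) (W (x z)))"
      by (rule K(2)[OF n])
    also have "\<dots> \<le> K * \<omega> z powr (real (wt R) / p)"
      using \<omega>(2)[OF n(1) z] K(1) by (intro mult_left_mono) auto
    also have "\<dots> \<le> ((1 + K) powr p * \<omega> z) powr (real (wt R) / p)"
      using K(1) p_ge_1 n(1) is_control_nonneg[OF \<omega>(1) z] by (intro powr_absorb_constant) auto
    finally show ?thesis by (simp add: deg_Pi_eq)
  qed
  then show "\<exists>\<omega>. is_control \<omega> \<and> (\<forall>R\<in>A1 \<tau> p k - {[]}. \<forall>z\<in>time_simplex.
      proj_norm \<nu> R (piR R (x z)) \<le> \<omega> z powr deg_Pi \<tau> p R)"
    using is_control_scale[OF \<omega>(1), of "(1 + K) powr p"] by fastforce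
next
  assume "\<exists>\<omega>. is_control \<omega> \<and> (\<forall>R\<in>A1 \<tau> p k - {[]}. \<forall>z\<in>time_simplex.
      proj_norm \<nu> R (piR R (x z)) \<le> \<omega> z powr deg_Pi \<tau> p R)"
  then have "\<exists>\<omega>. is_control \<omega> \<and> (\<forall>z\<in>time_simplex. hnorm n (level n (W (x z))) \<le> \<omega> z powr (real n / p))"
    if "n \<in> {1..N}" for n
    using that TPi_subset_TBk x words_A1[OF that] by (intro hnorm_control_from_words) auto
  then obtain \<omega> where \<omega>: "\<And>n. n \<in> {1..N} \<Longrightarrow> is_control (\<omega> n)"
    "\<And>n z. n \<in> {1..N} \<Longrightarrow> z \<in> time_simplex \<Longrightarrow> hnorm n (level n (W (x z))) \<le> \<omega> n z powr (real n / p)"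
    by metis
  have "hnorm n (level n (W (x z))) \<le> (\<Sum>n\<in>{1..N}. \<omega> n z) powr (real n / p)"
    if n: "n \<in> {1..N}" and z: "z \<in> time_simplex" for n z
  proof -
    have "\<omega> n z \<le> (\<Sum>n\<in>{1..N}. \<omega> n z)"
      using z \<omega>(1) by (intro member_le_sum n is_control_nonneg) auto
    then have "\<omega> n z powr (real n / p) \<le> (\<Sum>n\<in>{1..N}. \<omega> n z) powr (real n / p)"
      using is_control_nonneg[OF \<omega>(1)[OF n] z] p_ge_1 by (intro powr_mono2) auto
    with \<omega>(2)[OF n z] show ?thesis by simp
  qed
  moreover have "is_control (\<lambda>z. \<Sum>n\<in>{1..N}. \<omega> n z)" by (rule is_control_sum) (rule \<omega>(1))
  ultimately show "\<exists>\<omega>. is_control \<omega> \<and> (\<forall>n\<in>{1..N}. \<forall>z\<in>time_simplex.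
      hnorm n (level n (W (x z))) \<le> \<omega> z powr (real n / p))" by blast
qed

lemma multiplicative_Psi_iff:
  assumes Psi: "is_Psi \<tau> p k \<Psi>" and X: "\<forall>z\<in>time_simplex. X z \<in> HN N"
  shows "multiplicative (starN N) X \<longleftrightarrow> multiplicative (concPi \<tau> p k) (\<Psi> \<circ> X)"
proof -
  have "starN N (X (s, u)) (X (u, t)) = X (s, t) \<longleftrightarrow>
      concPi \<tau> p k (\<Psi> (X (s, u))) (\<Psi> (X (u, t))) = \<Psi> (X (s, t))"
    if "0 \<le> s \<and> s \<le> u \<and> u \<le> t \<and> t \<le> 1" for s u t
  proof -
    have HN: "X (s, u) \<in> HN N" "X (u, t) \<in> HN N" "X (s, t) \<in> HN N"
      using X that by (auto simp: time_simplex_def)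
    have "\<Psi> (starN N (X (s, u)) (X (u, t))) = concPi \<tau> p k (\<Psi> (X (s, u))) (\<Psi> (X (u, t)))"
      using Psi HN by (simp add: is_Psi_def Let_def)
    moreover have "inj_on \<Psi> (HN N)"
      using Psi by (simp add: is_Psi_def Let_def bij_betw_def)
    ultimately show ?thesis using HN by (metis inj_on_eq_iff starN_HN)
  qed
  then show ?thesis by (auto simp: multiplicative_def)
qed

lemma rough_path_Psi_iff:
  assumes Psi: "is_Psi \<tau> p k \<Psi>" and X: "\<forall>z\<in>time_simplex. X z \<in> HN N"
  shows "branched_rough_path p X \<longleftrightarrow>
    Pi_rough_path \<tau> p k \<nu> (\<Psi> \<circ> X) \<and> weakly_geometric \<tau> p k (\<Psi> \<circ> X)"
proof -
  have T: "\<Psi> (X z) \<in> TPi \<tau> p k" "W (\<Psi> (X z)) = X z" if "z \<in> time_simplex" for z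
    using is_Psi_HN[OF Psi] X that by auto
  have "(\<forall>z\<in>time_simplex. X z \<in> GN N) \<longleftrightarrow> weakly_geometric \<tau> p k (\<Psi> \<circ> X)"
    using Psi_GN_iff[OF Psi] X by (auto simp: weakly_geometric_def)
  moreover have "(\<exists>\<omega>. is_control \<omega> \<and> (\<forall>n\<in>{1..N}. \<forall>z\<in>time_simplex.
      hnorm n (level n (X z)) \<le> \<omega> z powr (real n / p))) \<longleftrightarrow>
    (\<exists>\<omega>. is_control \<omega> \<and> (\<forall>R\<in>A1 \<tau> p k - {[]}. \<forall>z\<in>time_simplex.
      proj_norm \<nu> R (piR R ((\<Psi> \<circ> X) z)) \<le> \<omega> z powr deg_Pi \<tau> p R))"
    using rough_bounds_iff[of "\<Psi> \<circ> X"] T by simp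
  ultimately show ?thesis
    unfolding branched_rough_path_def Pi_rough_path_def Let_def
    using multiplicative_Psi_iff[OF assms] Psi_continuous_iff[OF assms] T by (simp add: conj_ac)
qed

text \<open>The image under \<open>W\<close> of the word extension is again a multiplicative
  extension of \<open>X\<close> with controls in every degree, so uniqueness among forest series
  applies. It follows that the extension of \<open>X\<close> involves only the first
  \<open>k\<close> generators.\<close>

lemma extension_Psi:
  assumes Psi: "is_Psi \<tau> p k \<Psi>" and X: "\<forall>z\<in>time_simplex. X z \<in> HN N"
    and brp: "branched_rough_path p X"
    and S: "branched_extension p X S" and S': "Pi_extension \<tau> p k \<nu> (\<Psi> \<circ> X) S'"
    and z: "z \<in> time_simplex"
  shows "S z = W (S' z)"
proof (rule multiplicative_extension_unique[of p N S "\<lambda>z. W (S' z)"])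
  show "p > 0" using p_ge_1 by simp
  show "p < real (Suc N)" using le_N_iff[of "Suc N"] by simp
  have rho: "rhoN N (S z) = X z" if "z \<in> time_simplex" for z
    using S that by (simp add: branched_extension_def)
  have rho': "rhoN N (W (S' z)) = X z" if "z \<in> time_simplex" for z
  proof -
    have "truncPi \<tau> p k (S' z) = \<Psi> (X z)" using S' that by (simp add: Pi_extension_def)
    then show ?thesis using is_Psi_HN(2)[OF Psi] X that by (simp flip: W_truncPi)
  qed
  show "S z {#} = 1" if "z \<in> time_simplex" for z
  proof -
    have "X z {#} = 1"
      using brp that by (simp add: branched_rough_path_def Let_def GN_iff character_upto_def)
    moreover have "rhoN N (S z) {#} = S z {#}" by (simp add: rhoN_def)
    ultimately show ?thesis using rho[OF that] by simp
  qed
  show "S z \<sigma> = W (S' z) \<sigma>" if "z \<in> time_simplex" "fnodes \<sigma> \<le> N" for z \<sigma>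
  proof -
    have "rhoN N (S z) \<sigma> = rhoN N (W (S' z)) \<sigma>" using rho rho' that(1) by simp
    then show ?thesis using that(2) by (simp add: rhoN_def)
  qed
  show "multiplicative star S" using S by (simp add: branched_extension_def)
  have "multiplicative conc S'" using S' by (simp add: Pi_extension_def)
  then show "multiplicative star (\<lambda>z. W (S' z))"
    by (simp add: multiplicative_def flip: W_conc)
  show "\<exists>\<omega>. is_control \<omega> \<and> (\<forall>z\<in>time_simplex. hnorm n (level n (S z)) \<le> \<omega> z powr (real n / p))"
    if "n \<ge> 1" for n
    using S that by (simp add: branched_extension_def)
  show "\<exists>\<omega>. is_control \<omega> \<and> (\<forall>z\<in>time_simplex. hnorm n (level n (W (S' z))) \<le> \<omega> z powr (real n / p))"
    if "n \<ge> 1" for n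
  proof (rule hnorm_control_from_words[OF that])
    show "S' z \<in> TBk k" if "z \<in> time_simplex" for z
      using S' that by (simp add: Pi_extension_def)
    fix R assume "R \<in> words n"
    then have "R \<noteq> [] \<and> set R \<subseteq> {..<k}" using that by (auto simp: words_def)
    then show "\<exists>\<omega>. is_control \<omega> \<and>
        (\<forall>z\<in>time_simplex. proj_norm \<nu> R (piR R (S' z)) \<le> \<omega> z powr deg_Pi \<tau> p R)"
      using S' unfolding Pi_extension_def by blast
  qed
qed (rule z)

end

theorem theorem4p3:
  fixes \<tau> :: "nat \<Rightarrow> 'a::finite rtree" and p :: real and k :: nat
    and \<nu> :: "(nat \<Rightarrow> real) \<Rightarrow> real"
  assumes "inj \<tau>" and "free_generators \<tau>"
    and "\<forall>i j. i < j \<longrightarrow> tnodes (\<tau> i) \<le> tnodes (\<tau> j)"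
    and "p \<ge> 1"
    and "k \<ge> 1" and "real (tnodes (\<tau> (k - 1))) \<le> p"
    and "\<forall>j\<ge>1. real (tnodes (\<tau> (j - 1))) \<le> p \<longrightarrow> j \<le> k"
    and "is_norm_on (Bk k) \<nu>"
  shows "(\<exists>\<Psi>. is_Psi \<tau> p k \<Psi>) \<and>
    (\<forall>\<Psi>. is_Psi \<tau> p k \<Psi> \<longrightarrow>
      (\<forall>X. (\<forall>z\<in>time_simplex. X z \<in> HN (nat \<lfloor>p\<rfloor>)) \<longrightarrow>
         (multiplicative (starN (nat \<lfloor>p\<rfloor>)) X \<longleftrightarrow> multiplicative (concPi \<tau> p k) (\<Psi> \<circ> X)) \<and>
         ((\<forall>z\<in>time_simplex. X z \<in> GN (nat \<lfloor>p\<rfloor>)) \<longleftrightarrow>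
            (\<forall>z\<in>time_simplex. (\<Psi> \<circ> X) z \<in> GPi \<tau> p k)) \<and>
         (branched_rough_path p X \<longleftrightarrow>
            Pi_rough_path \<tau> p k \<nu> (\<Psi> \<circ> X) \<and> weakly_geometric \<tau> p k (\<Psi> \<circ> X)) \<and>
         (branched_rough_path p X \<longrightarrow>
            (\<forall>S Sbar. branched_extension p X S \<longrightarrow> Pi_extension \<tau> p k \<nu> (\<Psi> \<circ> X) Sbar \<longrightarrow>
               (\<forall>z\<in>time_simplex. S z = word_to_H \<tau> (Sbar z))))) \<and>
      (\<exists>C>0. \<forall>X Y. (\<forall>z\<in>time_simplex. X z \<in> HN (nat \<lfloor>p\<rfloor>)) \<longrightarrow>
         (\<forall>z\<in>time_simplex. Y z \<in> HN (nat \<lfloor>p\<rfloor>)) \<longrightarrow>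
         ennreal (1 / C) * rho_Pivar \<tau> p k \<nu> (\<Psi> \<circ> X) (\<Psi> \<circ> Y) \<le> rho_pvar p X Y \<and>
         rho_pvar p X Y \<le> ennreal C * rho_Pivar \<tau> p k \<nu> (\<Psi> \<circ> X) (\<Psi> \<circ> Y)))"
proof -
  \<comment> \<open>Letter \<open>r\<close> is the generator numbered r + 1, so the maximality of
    \<open>k\<close> is applied to \<open>Suc r\<close>.\<close>
  have letter: "real (tnodes (\<tau> r)) \<le> p \<longleftrightarrow> r < k" for r
  proof
    assume "real (tnodes (\<tau> r)) \<le> p"
    with assms(7)[rule_format, of "Suc r"] show "r < k" by simp
  next
    assume "r < k"
    then have "r = k - 1 \<or> r < k - 1" by auto
    then have "tnodes (\<tau> r) \<le> tnodes (\<tau> (k - 1))" using assms(3) by auto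
    with assms(6) show "real (tnodes (\<tau> r)) \<le> p" by linarith
  qed
  interpret Pi_norm_setting \<tau> p k \<nu>
    by standard (use assms letter in auto)
  show ?thesis
  proof (intro conjI allI impI)
    show "\<exists>\<Psi>. is_Psi \<tau> p k \<Psi>" by (rule is_Psi_exists)
  next
    fix \<Psi> and X :: "real \<times> real \<Rightarrow> 'a series"
    assume Psi: "is_Psi \<tau> p k \<Psi>" and X: "\<forall>z\<in>time_simplex. X z \<in> HN (nat \<lfloor>p\<rfloor>)"
    show "multiplicative (starN (nat \<lfloor>p\<rfloor>)) X \<longleftrightarrow> multiplicative (concPi \<tau> p k) (\<Psi> \<circ> X)"
      by (rule multiplicative_Psi_iff[OF Psi X])
    show "(\<forall>z\<in>time_simplex. X z \<in> GN (nat \<lfloor>p\<rfloor>)) \<longleftrightarrow>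
        (\<forall>z\<in>time_simplex. (\<Psi> \<circ> X) z \<in> GPi \<tau> p k)"
      using Psi_GN_iff[OF Psi] X by simp
    show "branched_rough_path p X \<longleftrightarrow>
        Pi_rough_path \<tau> p k \<nu> (\<Psi> \<circ> X) \<and> weakly_geometric \<tau> p k (\<Psi> \<circ> X)"
      by (rule rough_path_Psi_iff[OF Psi X])
    show "\<forall>z\<in>time_simplex. S z = word_to_H \<tau> (Sbar z)"
      if "branched_rough_path p X" "branched_extension p X S" "Pi_extension \<tau> p k \<nu> (\<Psi> \<circ> X) Sbar"
      for S Sbar
      using extension_Psi[OF Psi X that] by blast
  next
    fix \<Psi> assume "is_Psi \<tau> p k \<Psi>"
    then show "\<exists>C>0. \<forall>X Y. (\<forall>z\<in>time_simplex. X z \<in> HN (nat \<lfloor>p\<rfloor>)) \<longrightarrow>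
         (\<forall>z\<in>time_simplex. Y z \<in> HN (nat \<lfloor>p\<rfloor>)) \<longrightarrow>
         ennreal (1 / C) * rho_Pivar \<tau> p k \<nu> (\<Psi> \<circ> X) (\<Psi> \<circ> Y) \<le> rho_pvar p X Y \<and>
         rho_pvar p X Y \<le> ennreal C * rho_Pivar \<tau> p k \<nu> (\<Psi> \<circ> X) (\<Psi> \<circ> Y)"
      by (rule distance_equiv[OF assms(5)])
  qed
qed

end
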